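(* Let $m\ge2$. For every commutative unital ring $k$ there is an isomorphism of $k$-algebras $$\mathsf U^{\mathrm{an}}(\mathcal T_m(k))\cong\prod_{d\in C_m}M_m(k).$$ If $k$ is a field, the category of finite-dimensional anchored slot modules over $\mathcal T_m(k)$ (equivalently, finite-dimensional $\mathsf U^{\mathrm{an}}(\mathcal T_m(k))$-modules) is semisimple with exactly $m$ simple objects (up to isomorphism), each of underlying $k$-dimension $m$.
   Context: $C_m=\mathbb Z/m$, $n=m+1$. $\mathcal T_m(k)$ is $A=k^{C_m}$ (functions with pointwise multiplication, $\varepsilon_t$ the characteristic function of $t$) with automorphism $\sigma(\varepsilon_t)=\varepsilon_{t+1}$ and the totally associative $n$-ary product $\mu(a_0,\ldots,a_m)=a_0\sigma(a_1)\cdots\sigma^{m-1}(a_{m-1})a_m$. Slot modules: a slot module is a $k$-module $M$ with multilinear maps $\lambda_i:A^{\otimes i}\otimes M\otimes A^{\otimes(m-i)}\to M$, $0\le i\le m$, such that all evaluations of a planar $n$-ary word containing exactly one entry of $M$ agree under total-associativity moves. It is (endpoint-)anchored if $\lambda_0(x,1,\ldots,1)=x$ and $\lambda_m(1,\ldots,1,x)=x$ for all $x$. Morphisms are $k$-linear maps commuting with every slot operation. Anchored envelope $\mathsf U^{\mathrm{an}}$: a one-hole context is a finite planar rooted full $n$-ary tree (every internal vertex has exactly $n$ ordered inputs) with one distinguished leaf labelled $\star$ (the hole) and all other (ordinary) leaves labelled by elements of $A$. Take the free $k$-module on one-hole contexts modulo: multilinearity in the ordinary leaf labels; scalar contraction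 (a vertex all of whose inputs are ordinary leaves $a_0,\ldots,a_m$ may be replaced by one ordinary leaf labelled $\mu(a_0,\ldots,a_m)$); and total associativity (rebracketing of two adjacent vertices). Grafting makes this an associative unital algebra: $CD$ is obtained by grafting $D$ into the hole of $C$, and the unit is the trivial tree $\star$. Imposing moreover (as algebra relations) that the one-vertex contexts with inputs $(\star,1,\ldots,1)$ and $(1,\ldots,1,\star)$ both equal the unit gives $\mathsf U^{\mathrm{an}}(\mathcal T_m(k))$. Its unital modules are the anchored slot modules. *)

theory Defs
  imports "HOL-Algebra.QuotRing" "Jordan_Normal_Form.Missing_VectorSpace"
begin

section \<open>Algebras over a commutative ring\<close>

text \<open>
  A \<open>k\<close>-algebra (not necessarily commutative) is a record of type \<^typ>\<open>('k, 'a) module\<close>,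
  of which all fields are meaningful. The locale \<^const>\<open>algebra\<close> is not used: it demands
  commutativity.
\<close>

definition base_alg :: "'k ring \<Rightarrow> ('k, 'k) module" where
  "base_alg R = \<lparr>carrier = carrier R, monoid.mult = monoid.mult R,
     one = one R, ring.zero = ring.zero R, ring.add = ring.add R,
     smult = monoid.mult R\<rparr>"

definition prod_alg :: "'i set \<Rightarrow> ('i \<Rightarrow> ('k, 'a) module) \<Rightarrow> ('k, 'i \<Rightarrow> 'a) module" where
  "prod_alg I B = \<lparr>carrier = (\<Pi>\<^sub>E i\<in>I. carrier (B i)),
     monoid.mult = (\<lambda>f g. \<lambda>i\<in>I. f i \<otimes>\<^bsub>B i\<^esub> g i),
     one = (\<lambda>i\<in>I. \<one>\<^bsub>B i\<^esub>),
     ring.zero = (\<lambda>i\<in>I. \<zero>\<^bsub>B i\<^esub>),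
     ring.add = (\<lambda>f g. \<lambda>i\<in>I. f i \<oplus>\<^bsub>B i\<^esub> g i),
     smult = (\<lambda>r f. \<lambda>i\<in>I. r \<odot>\<^bsub>B i\<^esub> f i)\<rparr>"

definition mat_alg :: "'k ring \<Rightarrow> nat \<Rightarrow> ('k, nat \<times> nat \<Rightarrow> 'k) module" where
  "mat_alg R m = \<lparr>carrier = ({..<m} \<times> {..<m}) \<rightarrow>\<^sub>E carrier R,
     monoid.mult = (\<lambda>P Q. \<lambda>(i, j)\<in>{..<m} \<times> {..<m}. \<Oplus>\<^bsub>R\<^esub>l\<in>{..<m}. P (i, l) \<otimes>\<^bsub>R\<^esub> Q (l, j)),
     one = (\<lambda>(i, j)\<in>{..<m} \<times> {..<m}. if i = j then \<one>\<^bsub>R\<^esub> else \<zero>\<^bsub>R\<^esub>),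
     ring.zero = (\<lambda>_\<in>{..<m} \<times> {..<m}. \<zero>\<^bsub>R\<^esub>),
     ring.add = (\<lambda>P Q. \<lambda>p\<in>{..<m} \<times> {..<m}. P p \<oplus>\<^bsub>R\<^esub> Q p),
     smult = (\<lambda>r P. \<lambda>p\<in>{..<m} \<times> {..<m}. r \<otimes>\<^bsub>R\<^esub> P p)\<rparr>"

definition quot_alg :: "('k, 'a) module \<Rightarrow> 'a set \<Rightarrow> ('k, 'a set) module" where
  "quot_alg A I = \<lparr>carrier = carrier (A Quot I), monoid.mult = monoid.mult (A Quot I),
     one = one (A Quot I), ring.zero = ring.zero (A Quot I),
     ring.add = ring.add (A Quot I),
     smult = (\<lambda>r Y. \<Union>x\<in>Y. I +>\<^bsub>A\<^esub> (r \<odot>\<^bsub>A\<^esub> x))\<rparr>"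

definition alg_iso :: "'k ring \<Rightarrow> ('k, 'a) module \<Rightarrow> ('k, 'b) module \<Rightarrow> ('a \<Rightarrow> 'b) set" where
  "alg_iso R A B = {h \<in> ring_iso A B.
     \<forall>r\<in>carrier R. \<forall>x\<in>carrier A. h (r \<odot>\<^bsub>A\<^esub> x) = r \<odot>\<^bsub>B\<^esub> h x}"


section \<open>The totally associative \<open>n\<close>-ary algebra \<open>T_m(k)\<close>, \<open>n = m + 1\<close>\<close>

text \<open>The group \<open>C_m\<close> is \<open>{..<m}\<close> with addition modulo \<open>m\<close>.\<close>

definition T_alg :: "'k ring \<Rightarrow> nat \<Rightarrow> ('k, nat \<Rightarrow> 'k) module" where
  "T_alg R m = prod_alg {..<m} (\<lambda>_. base_alg R)"

text \<open>
  \<open>\<sigma>(\<Sum>\<^sub>t a(t) \<epsilon>\<^sub>t) = \<Sum>\<^sub>t a(t) \<epsilon>\<^sub>t\<^sub>+\<^sub>1\<close>, so the value of \<open>\<sigma>(a)\<close> at \<open>s\<close> is \<open>a(s - 1)\<close>.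
\<close>

definition sigma :: "nat \<Rightarrow> (nat \<Rightarrow> 'k) \<Rightarrow> nat \<Rightarrow> 'k" where
  "sigma m a = (\<lambda>s\<in>{..<m}. a ((s + (m - 1)) mod m))"

definition eps :: "'k ring \<Rightarrow> nat \<Rightarrow> nat \<Rightarrow> nat \<Rightarrow> 'k" where
  "eps R m t = (\<lambda>s\<in>{..<m}. if s = t then \<one>\<^bsub>R\<^esub> else \<zero>\<^bsub>R\<^esub>)"

lemma sigma_eps:
  assumes "t < m"
  shows "sigma m (eps R m t) = eps R m ((t + 1) mod m)"
proof
  fix s
  show "sigma m (eps R m t) s = eps R m ((t + 1) mod m) s"
  proof (cases "s < m")
    case True
    have "(s + (m - 1)) mod m = (if s = 0 then m - 1 else s - 1)"
    proof (cases s)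
      case (Suc r)
      then have "s + (m - 1) = r + m" using True by simp
      then show ?thesis using Suc True by simp
    qed (use True in simp)
    moreover have "(t + 1) mod m = (if t = m - 1 then 0 else t + 1)"
      using assms by auto
    ultimately show ?thesis
      using True assms by (auto simp: sigma_def eps_def)
  qed (simp add: sigma_def eps_def)
qed

definition mu :: "'k ring \<Rightarrow> nat \<Rightarrow> (nat \<Rightarrow> 'k) list \<Rightarrow> nat \<Rightarrow> 'k" where
  "mu R m as = (\<Otimes>\<^bsub>T_alg R m\<^esub>i\<in>{..<m}. (sigma m ^^ i) (as ! i)) \<otimes>\<^bsub>T_alg R m\<^esub> as ! m"


section \<open>One-hole contexts\<close>

datatype 'a tree = Hole | Leaf 'a | Node "'a tree list"

fun holes :: "'a tree \<Rightarrow> nat" where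
  "holes Hole = 1"
| "holes (Leaf a) = 0"
| "holes (Node ts) = sum_list (map holes ts)"

fun full_tree :: "nat \<Rightarrow> 'a set \<Rightarrow> 'a tree \<Rightarrow> bool" where
  "full_tree n A Hole = True"
| "full_tree n A (Leaf a) = (a \<in> A)"
| "full_tree n A (Node ts) = (length ts = n \<and> (\<forall>t\<in>set ts. full_tree n A t))"

fun graft :: "'a tree \<Rightarrow> 'a tree \<Rightarrow> 'a tree" where
  "graft Hole D = D"
| "graft (Leaf a) D = Leaf a"
| "graft (Node ts) D = Node (map (\<lambda>t. graft t D) ts)"

definition contexts :: "'k ring \<Rightarrow> nat \<Rightarrow> (nat \<Rightarrow> 'k) tree set" where
  "contexts R m = {t. full_tree (m + 1) (carrier (T_alg R m)) t \<and> holes t = 1}"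

text \<open>
  A frame is the map that places a subtree at one fixed position of a fixed surrounding tree.
  The hole \<open>\<star>\<close> of a context may lie in the surrounding tree or in the subtree.
\<close>

inductive_set frames :: "('a tree \<Rightarrow> 'a tree) set" where
  "(\<lambda>t. t) \<in> frames"
| "K \<in> frames \<Longrightarrow> (\<lambda>t. Node (xs @ K t # ys)) \<in> frames"

text \<open>
  \<open>bracket m i ws\<close> is the two-vertex bracketing of a word \<open>ws\<close> of length \<open>2m + 1 = 2n - 1\<close> whose
  inner vertex collects the \<open>n\<close> entries starting at position \<open>i\<close>. The entries are
  arbitrary trees, so that \<open>assoc_moves\<close> rebrackets any two adjacent vertices of a context.
\<close>

definition bracket :: "nat \<Rightarrow> nat \<Rightarrow> 'a tree list \<Rightarrow> 'a tree" where
  "bracket m i ws = Node (take i ws @ Node (take (m + 1) (drop i ws)) # drop (i + (m + 1)) ws)"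

definition assoc_moves :: "'k ring \<Rightarrow> nat \<Rightarrow> ((nat \<Rightarrow> 'k) tree \<times> (nat \<Rightarrow> 'k) tree) set" where
  "assoc_moves R m = {(K (bracket m i ws), K (bracket m j ws)) | K ws i j.
     K \<in> frames \<and> length ws = 2 * m + 1 \<and> i \<le> m \<and> j \<le> m \<and> K (bracket m i ws) \<in> contexts R m}"


section \<open>The anchored envelope\<close>

text \<open>
  The free \<open>k\<close>-module on one-hole contexts (finitely supported coefficient functions) with
  grafting extended bilinearly.
\<close>

definition ctx_alg :: "'k ring \<Rightarrow> nat \<Rightarrow> ('k, (nat \<Rightarrow> 'k) tree \<Rightarrow> 'k) module" where
  "ctx_alg R m = \<lparr>
     carrier = {f. (\<forall>C\<in>contexts R m. f C \<in> carrier R) \<and> (\<forall>C. C \<notin> contexts R m \<longrightarrow> f C = \<zero>\<^bsub>R\<^esub>)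
       \<and> finite {C. f C \<noteq> \<zero>\<^bsub>R\<^esub>}},
     monoid.mult = (\<lambda>f g E. \<Oplus>\<^bsub>R\<^esub>p\<in>{(C, D). f C \<noteq> \<zero>\<^bsub>R\<^esub> \<and> g D \<noteq> \<zero>\<^bsub>R\<^esub> \<and> graft C D = E}.
       f (fst p) \<otimes>\<^bsub>R\<^esub> g (snd p)),
     one = (\<lambda>C. if C = Hole then \<one>\<^bsub>R\<^esub> else \<zero>\<^bsub>R\<^esub>),
     ring.zero = (\<lambda>_. \<zero>\<^bsub>R\<^esub>),
     ring.add = (\<lambda>f g C. f C \<oplus>\<^bsub>R\<^esub> g C),
     smult = (\<lambda>r f C. r \<otimes>\<^bsub>R\<^esub> f C)\<rparr>"

definition ctx_elt :: "'k ring \<Rightarrow> (nat \<Rightarrow> 'k) tree \<Rightarrow> (nat \<Rightarrow> 'k) tree \<Rightarrow> 'k" where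
  "ctx_elt R C = (\<lambda>D. if D = C then \<one>\<^bsub>R\<^esub> else \<zero>\<^bsub>R\<^esub>)"

definition multilinearity_rels :: "'k ring \<Rightarrow> nat \<Rightarrow> ((nat \<Rightarrow> 'k) tree \<Rightarrow> 'k) set" where
  "multilinearity_rels R m =
     {ctx_elt R (K (Leaf (a \<oplus>\<^bsub>T_alg R m\<^esub> b)))
        \<ominus>\<^bsub>ctx_alg R m\<^esub> (ctx_elt R (K (Leaf a)) \<oplus>\<^bsub>ctx_alg R m\<^esub> ctx_elt R (K (Leaf b))) | K a b.
        K \<in> frames \<and> K (Leaf a) \<in> contexts R m
        \<and> a \<in> carrier (T_alg R m) \<and> b \<in> carrier (T_alg R m)}
   \<union> {ctx_elt R (K (Leaf (r \<odot>\<^bsub>T_alg R m\<^esub> a)))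
        \<ominus>\<^bsub>ctx_alg R m\<^esub> (r \<odot>\<^bsub>ctx_alg R m\<^esub> ctx_elt R (K (Leaf a))) | K r a.
        K \<in> frames \<and> K (Leaf a) \<in> contexts R m
        \<and> r \<in> carrier R \<and> a \<in> carrier (T_alg R m)}"

definition contraction_rels :: "'k ring \<Rightarrow> nat \<Rightarrow> ((nat \<Rightarrow> 'k) tree \<Rightarrow> 'k) set" where
  "contraction_rels R m =
     {ctx_elt R (K (Node (map Leaf as))) \<ominus>\<^bsub>ctx_alg R m\<^esub> ctx_elt R (K (Leaf (mu R m as))) | K as.
        K \<in> frames \<and> K (Node (map Leaf as)) \<in> contexts R m
        \<and> length as = m + 1 \<and> set as \<subseteq> carrier (T_alg R m)}"

definition assoc_rels :: "'k ring \<Rightarrow> nat \<Rightarrow> ((nat \<Rightarrow> 'k) tree \<Rightarrow> 'k) set" where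
  "assoc_rels R m =
     {ctx_elt R C \<ominus>\<^bsub>ctx_alg R m\<^esub> ctx_elt R D | C D. (C, D) \<in> assoc_moves R m}"

definition anchor_rels :: "'k ring \<Rightarrow> nat \<Rightarrow> ((nat \<Rightarrow> 'k) tree \<Rightarrow> 'k) set" where
  "anchor_rels R m =
     {ctx_elt R (Node (Hole # replicate m (Leaf \<one>\<^bsub>T_alg R m\<^esub>)))
        \<ominus>\<^bsub>ctx_alg R m\<^esub> \<one>\<^bsub>ctx_alg R m\<^esub>,
      ctx_elt R (Node (replicate m (Leaf \<one>\<^bsub>T_alg R m\<^esub>) @ [Hole]))
        \<ominus>\<^bsub>ctx_alg R m\<^esub> \<one>\<^bsub>ctx_alg R m\<^esub>}"

text \<open>
  The first three families of relations are imposed at every position of every context, so their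
  \<open>k\<close>-span is already a two-sided ideal for grafting; the quotient by that span followed by the
  quotient by the ideal generated by the anchor relations is therefore the quotient by the
  two-sided ideal generated by all four families. Ideals of \<open>ctx_alg\<close> are stable under scalars,
  since \<open>r f\<close> is the product of \<open>r \<star>\<close> and \<open>f\<close>.
\<close>

definition Uan_ideal :: "'k ring \<Rightarrow> nat \<Rightarrow> ((nat \<Rightarrow> 'k) tree \<Rightarrow> 'k) set" where
  "Uan_ideal R m = Idl\<^bsub>ctx_alg R m\<^esub>
     (multilinearity_rels R m \<union> contraction_rels R m \<union> assoc_rels R m \<union> anchor_rels R m)"

definition Uan :: "'k ring \<Rightarrow> nat \<Rightarrow> ('k, ((nat \<Rightarrow> 'k) tree \<Rightarrow> 'k) set) module" where
  "Uan R m = quot_alg (ctx_alg R m) (Uan_ideal R m)"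


section \<open>Modules with operators\<close>

text \<open>
  Slot modules and modules over an algebra are both \<open>k\<close>-modules \<open>V\<close> with a family of \<open>k\<close>-linear
  operators \<open>act\<close> indexed by a set \<open>Op\<close>; morphisms, subobjects and simplicity have the same form.
\<close>

definition op_hom :: "'k ring \<Rightarrow> 'o set \<Rightarrow> ('k, 'v) module \<Rightarrow> ('o \<Rightarrow> 'v \<Rightarrow> 'v)
    \<Rightarrow> ('k, 'w) module \<Rightarrow> ('o \<Rightarrow> 'w \<Rightarrow> 'w) \<Rightarrow> ('v \<Rightarrow> 'w) set" where
  "op_hom R Op V act W act' =
     {f \<in> module_hom R V W. \<forall>p\<in>Op. \<forall>x\<in>carrier V. f (act p x) = act' p (f x)}"

definition op_isomorphic :: "'k ring \<Rightarrow> 'o set \<Rightarrow> ('k, 'v) module \<Rightarrow> ('o \<Rightarrow> 'v \<Rightarrow> 'v)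
    \<Rightarrow> ('k, 'w) module \<Rightarrow> ('o \<Rightarrow> 'w \<Rightarrow> 'w) \<Rightarrow> bool" where
  "op_isomorphic R Op V act W act' \<longleftrightarrow>
     (\<exists>f\<in>op_hom R Op V act W act'. bij_betw f (carrier V) (carrier W))"

definition op_submodule :: "'k ring \<Rightarrow> 'o set \<Rightarrow> ('k, 'v) module \<Rightarrow> ('o \<Rightarrow> 'v \<Rightarrow> 'v)
    \<Rightarrow> 'v set \<Rightarrow> bool" where
  "op_submodule R Op V act N \<longleftrightarrow> submodule R N V \<and> (\<forall>p\<in>Op. \<forall>x\<in>N. act p x \<in> N)"

definition op_simple :: "'k ring \<Rightarrow> 'o set \<Rightarrow> ('k, 'v) module \<Rightarrow> ('o \<Rightarrow> 'v \<Rightarrow> 'v) \<Rightarrow> bool" where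
  "op_simple R Op V act \<longleftrightarrow> carrier V \<noteq> {\<zero>\<^bsub>V\<^esub>}
     \<and> (\<forall>N. op_submodule R Op V act N \<longrightarrow> N = {\<zero>\<^bsub>V\<^esub>} \<or> N = carrier V)"

definition op_semisimple :: "'k ring \<Rightarrow> 'o set \<Rightarrow> ('k, 'v) module \<Rightarrow> ('o \<Rightarrow> 'v \<Rightarrow> 'v) \<Rightarrow> bool" where
  "op_semisimple R Op V act \<longleftrightarrow> (\<exists>(r::nat) N.
     (\<forall>i<r. op_submodule R Op V act (N i) \<and> op_simple R Op (V\<lparr>carrier := N i\<rparr>) act)
     \<and> (\<forall>x\<in>carrier V. \<exists>!f. f \<in> (\<Pi>\<^sub>E i\<in>{..<r}. N i) \<and> x = (\<Oplus>\<^bsub>V\<^esub>i\<in>{..<r}. f i)))"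


section \<open>Anchored slot modules\<close>

text \<open>
  The slot operation \<open>\<lambda>\<^sub>i(a\<^sub>0, \<dots>, a\<^sub>i\<^sub>-\<^sub>1, x, a\<^sub>i\<^sub>+\<^sub>1, \<dots>, a\<^sub>m)\<close> is written \<open>lam (as, bs) x\<close>, where
  \<open>as\<close> and \<open>bs\<close> list the entries to the left and to the right of \<open>x\<close>; thus \<open>i = length as\<close>.
\<close>

definition slot_ops :: "'k ring \<Rightarrow> nat \<Rightarrow> ((nat \<Rightarrow> 'k) list \<times> (nat \<Rightarrow> 'k) list) set" where
  "slot_ops R m = {(as, bs). set as \<subseteq> carrier (T_alg R m) \<and> set bs \<subseteq> carrier (T_alg R m)
     \<and> length as + length bs = m}"

text \<open>
  Evaluation of a context with \<open>x \<in> M\<close> put into its hole: values in \<open>A\<close> are tagged \<^const>\<open>Inl\<close>,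
  values in \<open>M\<close> are tagged \<^const>\<open>Inr\<close>. A vertex applies \<open>\<mu>\<close> if all its inputs lie in \<open>A\<close>, and
  otherwise the slot operation at the position of the input from \<open>M\<close>.
\<close>

definition vertex_value :: "('a list \<Rightarrow> 'a) \<Rightarrow> ('a list \<times> 'a list \<Rightarrow> 'v \<Rightarrow> 'v)
    \<Rightarrow> ('a + 'v) list \<Rightarrow> 'a + 'v" where
  "vertex_value \<mu> lam vs =
     (if \<forall>v\<in>set vs. isl v then Inl (\<mu> (map projl vs))
      else Inr (lam (map projl (takeWhile isl vs), map projl (tl (dropWhile isl vs)))
                  (projr (hd (dropWhile isl vs)))))"

fun tree_value :: "('a list \<Rightarrow> 'a) \<Rightarrow> ('a list \<times> 'a list \<Rightarrow> 'v \<Rightarrow> 'v) \<Rightarrow> 'v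
    \<Rightarrow> 'a tree \<Rightarrow> 'a + 'v" where
  "tree_value \<mu> lam x Hole = Inr x"
| "tree_value \<mu> lam x (Leaf a) = Inl a"
| "tree_value \<mu> lam x (Node ts) = vertex_value \<mu> lam (map (tree_value \<mu> lam x) ts)"

definition slot_module :: "'k ring \<Rightarrow> nat \<Rightarrow> ('k, 'v) module
    \<Rightarrow> ((nat \<Rightarrow> 'k) list \<times> (nat \<Rightarrow> 'k) list \<Rightarrow> 'v \<Rightarrow> 'v) \<Rightarrow> bool" where
  "slot_module R m V lam \<longleftrightarrow> module R V
     \<and> (\<forall>p\<in>slot_ops R m. lam p \<in> module_hom R V V)
     \<and> (\<forall>(as, bs)\<in>slot_ops R m. \<forall>r\<in>carrier R. \<forall>a\<in>carrier (T_alg R m). \<forall>b\<in>carrier (T_alg R m).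
          \<forall>x\<in>carrier V.
          (\<forall>i<length as. lam (as[i := r \<odot>\<^bsub>T_alg R m\<^esub> a \<oplus>\<^bsub>T_alg R m\<^esub> b], bs) x
             = r \<odot>\<^bsub>V\<^esub> lam (as[i := a], bs) x \<oplus>\<^bsub>V\<^esub> lam (as[i := b], bs) x)
        \<and> (\<forall>i<length bs. lam (as, bs[i := r \<odot>\<^bsub>T_alg R m\<^esub> a \<oplus>\<^bsub>T_alg R m\<^esub> b]) x
             = r \<odot>\<^bsub>V\<^esub> lam (as, bs[i := a]) x \<oplus>\<^bsub>V\<^esub> lam (as, bs[i := b]) x))
     \<and> (\<forall>(C, D)\<in>assoc_moves R m. \<forall>x\<in>carrier V.
          tree_value (mu R m) lam x C = tree_value (mu R m) lam x D)"

definition anchored_slot_module :: "'k ring \<Rightarrow> nat \<Rightarrow> ('k, 'v) module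
    \<Rightarrow> ((nat \<Rightarrow> 'k) list \<times> (nat \<Rightarrow> 'k) list \<Rightarrow> 'v \<Rightarrow> 'v) \<Rightarrow> bool" where
  "anchored_slot_module R m V lam \<longleftrightarrow> slot_module R m V lam
     \<and> (\<forall>x\<in>carrier V. lam ([], replicate m \<one>\<^bsub>T_alg R m\<^esub>) x = x
                      \<and> lam (replicate m \<one>\<^bsub>T_alg R m\<^esub>, []) x = x)"

definition fd_anchored_slot_module :: "'k ring \<Rightarrow> nat \<Rightarrow> ('k, 'v) module
    \<Rightarrow> ((nat \<Rightarrow> 'k) list \<times> (nat \<Rightarrow> 'k) list \<Rightarrow> 'v \<Rightarrow> 'v) \<Rightarrow> bool" where
  "fd_anchored_slot_module R m V lam \<longleftrightarrow>
     anchored_slot_module R m V lam \<and> vectorspace.fin_dim R V"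


section \<open>Modules over the anchored envelope\<close>

definition alg_module :: "'k ring \<Rightarrow> ('k, 'u) module \<Rightarrow> ('k, 'v) module \<Rightarrow> ('u \<Rightarrow> 'v \<Rightarrow> 'v) \<Rightarrow> bool"
where
  "alg_module R U V act \<longleftrightarrow> module R V
     \<and> (\<forall>u\<in>carrier U. act u \<in> module_hom R V V)
     \<and> (\<forall>u\<in>carrier U. \<forall>w\<in>carrier U. \<forall>r\<in>carrier R. \<forall>x\<in>carrier V.
          act (u \<oplus>\<^bsub>U\<^esub> w) x = act u x \<oplus>\<^bsub>V\<^esub> act w x
        \<and> act (r \<odot>\<^bsub>U\<^esub> u) x = r \<odot>\<^bsub>V\<^esub> act u x
        \<and> act (u \<otimes>\<^bsub>U\<^esub> w) x = act u (act w x))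
     \<and> (\<forall>x\<in>carrier V. act \<one>\<^bsub>U\<^esub> x = x)"

definition fd_Uan_module :: "'k ring \<Rightarrow> nat \<Rightarrow> ('k, 'v) module
    \<Rightarrow> (((nat \<Rightarrow> 'k) tree \<Rightarrow> 'k) set \<Rightarrow> 'v \<Rightarrow> 'v) \<Rightarrow> bool" where
  "fd_Uan_module R m V act \<longleftrightarrow> alg_module R (Uan R m) V act \<and> vectorspace.fin_dim R V"

text \<open>
  The class in the envelope of the one-vertex context with inputs \<open>as, \<star>, bs\<close>, and the slot
  operations it induces on a module over the envelope.
\<close>

definition slot_elt :: "'k ring \<Rightarrow> nat \<Rightarrow> (nat \<Rightarrow> 'k) list \<times> (nat \<Rightarrow> 'k) list
    \<Rightarrow> ((nat \<Rightarrow> 'k) tree \<Rightarrow> 'k) set" where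
  "slot_elt R m = (\<lambda>(as, bs). Uan_ideal R m +>\<^bsub>ctx_alg R m\<^esub>
     ctx_elt R (Node (map Leaf as @ Hole # map Leaf bs)))"

definition induced_slots :: "'k ring \<Rightarrow> nat \<Rightarrow> (((nat \<Rightarrow> 'k) tree \<Rightarrow> 'k) set \<Rightarrow> 'v \<Rightarrow> 'v)
    \<Rightarrow> (nat \<Rightarrow> 'k) list \<times> (nat \<Rightarrow> 'k) list \<Rightarrow> 'v \<Rightarrow> 'v" where
  "induced_slots R m act = (\<lambda>p. act (slot_elt R m p))"

end

theory Submission
  imports Defs
begin

text \<open>
  A label \<open>a\<close> stands for the element \<open>a z\<close> of the crossed product of \<open>A = k^C_m\<close> with \<open>C_m\<close>, in
  which \<open>z a = \<sigma>(a) z\<close> and \<open>z^m = 1\<close>. The product \<open>\<mu>\<close> of \<open>m + 1\<close> labels is then their product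
  in the crossed product, which explains total associativity. The crossed product is the algebra of
  \<open>m \<times> m\<close> matrices, with \<open>z\<close> the cyclic permutation matrix. A slot operation multiplies a matrix by
  a word on the left and a word on the right; since both words together have \<open>m\<close> letters, it
  preserves each cyclic diagonal, that is, the span of the \<open>e\<^sub>q\<^sub>+\<^sub>d\<^sub>,\<^sub>q\<close> for a fixed \<open>d\<close>. These
  \<open>m\<close> spans of rank \<open>m\<close> are the standard modules \<open>std d\<close>. The theorem says that the envelope is the
  product of their endomorphism algebras, and that over a field they are the simple modules.

  That nothing else occurs is a normal form argument. In every anchored slot module, associativity
  lets one insert the anchors, contract, and so factor each slot operation as
  \<open>lam (as, bs) = lmul (tprod as) \<circ> shift (length as) \<circ> rmul (tprod bs)\<close>
  (\<open>lam_factor\<close>), where \<open>lmul\<close> and \<open>rmul\<close> are commuting actions of \<open>A\<close> and \<open>shift\<close> is an action of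
  \<open>C_m\<close> that translates both. With the idempotents \<open>\<epsilon>\<^sub>t\<close> of \<open>A\<close> this yields operators
  \<open>matrix_unit d q r\<close> which the slot operations permute and scale exactly as they do the coordinate
  vectors of \<open>std d\<close> (\<open>lam_matrix_unit\<close>) and whose diagonal members add up to the identity
  (\<open>matrix_unit_sum\<close>). Thus every vector of every anchored slot module is a sum of images of
  coordinate vectors under homomorphisms from standard modules (\<open>from_std_hom\<close>).

  Evaluation of contexts turns an anchored slot module into a module over the envelope
  (\<open>uact_module\<close>), because it kills all four families of relations. Conversely a module over the
  envelope is an anchored slot module (\<open>induced_anchored\<close>), because the class of a context is a
  product of classes of one-vertex contexts (\<open>ctx_class_Node\<close>). Hence an element of the envelope
  acts on any module as its matrices on the standard modules prescribe (\<open>uact_determined\<close>). Applied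
  to the envelope as a module over itself, this shows that these matrices determine the element;
  that all matrices occur is seen by evaluating the matrix units on the standard modules. Over a field,
  \<open>std d\<close> is simple because its matrix units isolate coordinates, and a finite-dimensional module is
  a finite sum of images of standard modules; a minimal such sum is direct.
\<close>

section \<open>Linear maps, finite sums and residues\<close>

lemma module_hom_comp:
  "f \<in> module_hom R W X \<Longrightarrow> g \<in> module_hom R V W \<Longrightarrow> (\<lambda>x. f (g x)) \<in> module_hom R V X"
  by (simp add: module_hom_def Pi_iff)

lemma module_hom_finsum:
  assumes "module R V" "module R W" "f \<in> module_hom R V W" "finite I" "g \<in> I \<rightarrow> carrier V"
  shows "f (\<Oplus>\<^bsub>V\<^esub>i\<in>I. g i) = (\<Oplus>\<^bsub>W\<^esub>i\<in>I. f (g i))"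
proof -
  interpret V: module R V by fact
  interpret W: module R W by fact
  have cl: "f x \<in> carrier W" and add: "y \<in> carrier V \<Longrightarrow> f (x \<oplus>\<^bsub>V\<^esub> y) = f x \<oplus>\<^bsub>W\<^esub> f y" if "x \<in> carrier V" for x y
    using assms(3) that by (auto simp: module_hom_def)
  from assms(4,5) show ?thesis
  proof (induction I)
    case empty
    then show ?case using add[of "\<zero>\<^bsub>V\<^esub>" "\<zero>\<^bsub>V\<^esub>"] cl[of "\<zero>\<^bsub>V\<^esub>"] by (simp add: W.M.add.r_cancel_one)
  next
    case (insert i I)
    then show ?case by (simp add: Pi_iff cl add)
  qed
qed

lemma module_hom_zero:
  assumes "module R W" "module R V" "f \<in> module_hom R W V"
  shows "f \<zero>\<^bsub>W\<^esub> = \<zero>\<^bsub>V\<^esub>"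
  using module_hom_finsum[OF assms, of "{}"] assms(1,2)
  by (simp add: abelian_monoid.finsum_empty abelian_group.axioms(1) module.axioms(2))

lemma (in abelian_monoid) finsum_bij:
  assumes "bij_betw h A B" "f \<in> B \<rightarrow> carrier G"
  shows "(\<Oplus>b\<in>B. f b) = (\<Oplus>a\<in>A. f (h a))"
  using assms finsum_reindex[of f h A] by (simp add: bij_betw_def)

lemma mod_add_cancel: "(s + i) mod m = (t + i) mod m \<longleftrightarrow> s mod m = t mod m" for s t i m :: nat
  by (simp add: nat_mod_eq_iff)

section \<open>The algebra of functions on the cyclic group\<close>

locale twisted_nary = R?: cring R for R :: "'k ring" (structure) +
  fixes m :: nat
  assumes m_pos: "0 < m"
begin

abbreviation "T \<equiv> T_alg R m"

lemma T_simps: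
  "carrier T = {..<m} \<rightarrow>\<^sub>E carrier R"
  "a \<otimes>\<^bsub>T\<^esub> b = (\<lambda>t\<in>{..<m}. a t \<otimes> b t)"
  "a \<oplus>\<^bsub>T\<^esub> b = (\<lambda>t\<in>{..<m}. a t \<oplus> b t)"
  "\<one>\<^bsub>T\<^esub> = (\<lambda>t\<in>{..<m}. \<one>)"
  "\<zero>\<^bsub>T\<^esub> = (\<lambda>t\<in>{..<m}. \<zero>)"
  "r \<odot>\<^bsub>T\<^esub> a = (\<lambda>t\<in>{..<m}. r \<otimes> a t)"
  by (simp_all add: T_alg_def prod_alg_def base_alg_def)

lemma T_app:
  "t < m \<Longrightarrow> (a \<otimes>\<^bsub>T\<^esub> b) t = a t \<otimes> b t"
  "t < m \<Longrightarrow> (a \<oplus>\<^bsub>T\<^esub> b) t = a t \<oplus> b t"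
  "t < m \<Longrightarrow> \<one>\<^bsub>T\<^esub> t = \<one>"
  "t < m \<Longrightarrow> \<zero>\<^bsub>T\<^esub> t = \<zero>"
  "t < m \<Longrightarrow> (r \<odot>\<^bsub>T\<^esub> a) t = r \<otimes> a t"
  by (simp_all add: T_simps)

lemma T_ext: "a \<in> carrier T \<Longrightarrow> b \<in> carrier T \<Longrightarrow> (\<And>t. t < m \<Longrightarrow> a t = b t) \<Longrightarrow> a = b"
  unfolding T_simps by (rule PiE_ext) auto

lemma T_val [simp, intro]: "a \<in> carrier T \<Longrightarrow> t < m \<Longrightarrow> a t \<in> carrier R"
  by (auto simp: T_simps)

lemma T_val_mod [simp, intro]: "a \<in> carrier T \<Longrightarrow> a (t mod m) \<in> carrier R"
  using m_pos by auto

lemma T_closed [simp, intro]: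
  "a \<in> carrier T \<Longrightarrow> b \<in> carrier T \<Longrightarrow> a \<otimes>\<^bsub>T\<^esub> b \<in> carrier T"
  "a \<in> carrier T \<Longrightarrow> b \<in> carrier T \<Longrightarrow> a \<oplus>\<^bsub>T\<^esub> b \<in> carrier T"
  "\<one>\<^bsub>T\<^esub> \<in> carrier T"
  "\<zero>\<^bsub>T\<^esub> \<in> carrier T"
  "r \<in> carrier R \<Longrightarrow> a \<in> carrier T \<Longrightarrow> r \<odot>\<^bsub>T\<^esub> a \<in> carrier T"
  by (auto simp: T_simps)

lemma T_cring: "cring T"
proof (rule cringI)
  show "abelian_group T"
  proof (rule abelian_groupI)
    fix x assume x: "x \<in> carrier T"
    define y where "y = (\<lambda>t\<in>{..<m}. \<ominus> x t)"
    have "y \<in> carrier T" using x by (auto simp: y_def T_simps)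
    moreover have "y \<oplus>\<^bsub>T\<^esub> x = \<zero>\<^bsub>T\<^esub>"
      using x calculation by (intro T_ext) (auto simp: T_app y_def R.l_neg)
    ultimately show "\<exists>y\<in>carrier T. y \<oplus>\<^bsub>T\<^esub> x = \<zero>\<^bsub>T\<^esub>" by blast
  qed (auto intro!: T_ext simp: T_app R.a_ac)
  show "comm_monoid T"
    by (rule comm_monoidI) (auto intro!: T_ext simp: T_app R.m_ac)
qed (auto intro!: T_ext simp: T_app R.l_distr)

lemma T_module: "module R T"
  by (rule moduleI[OF R.is_cring cring.axioms(1)[OF T_cring, THEN ring.is_abelian_group]])
     (auto intro!: T_ext simp: T_app R.l_distr R.r_distr R.m_assoc)

end

sublocale twisted_nary \<subseteq> T: module R "T_alg R m"
  by (rule T_module)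

sublocale twisted_nary \<subseteq> T: cring "T_alg R m"
  by (rule T_cring)

context twisted_nary begin

lemma eps_closed [simp, intro]: "eps R m t \<in> carrier T"
  by (auto simp: T_simps eps_def)

lemma eps_app: "s < m \<Longrightarrow> eps R m t s = (if s = t then \<one> else \<zero>)"
  by (simp add: eps_def)

lemma mult_eps: "a \<in> carrier T \<Longrightarrow> t < m \<Longrightarrow> a \<otimes>\<^bsub>T\<^esub> eps R m t = a t \<odot>\<^bsub>T\<^esub> eps R m t"
  by (rule T_ext) (auto simp: T_app eps_app)

lemma T_finsum_app:
  assumes "finite I" "f \<in> I \<rightarrow> carrier T" "t < m"
  shows "(\<Oplus>\<^bsub>T\<^esub>i\<in>I. f i) t = (\<Oplus>i\<in>I. f i t)"
  using assms
proof (induction I)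
  case (insert i I)
  then have "(\<Oplus>\<^bsub>T\<^esub>i\<in>insert i I. f i) t = f i t \<oplus> (\<Oplus>\<^bsub>T\<^esub>i\<in>I. f i) t"
    by (simp add: T_app)
  also have "\<dots> = (\<Oplus>i\<in>insert i I. f i t)"
    using insert by (subst R.finsum_insert) (auto simp: Pi_iff)
  finally show ?case .
qed (simp add: T_app)

lemma T_expand:
  assumes "x \<in> carrier T"
  shows "x = (\<Oplus>\<^bsub>T\<^esub>t\<in>{..<m}. x t \<odot>\<^bsub>T\<^esub> eps R m t)"
proof (rule T_ext[OF assms])
  show "(\<Oplus>\<^bsub>T\<^esub>t\<in>{..<m}. x t \<odot>\<^bsub>T\<^esub> eps R m t) \<in> carrier T"
    using assms by (intro T.finsum_closed) auto
  fix s assume s: "s < m"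
  have "(\<Oplus>\<^bsub>T\<^esub>t\<in>{..<m}. x t \<odot>\<^bsub>T\<^esub> eps R m t) s = (\<Oplus>t\<in>{..<m}. (x t \<odot>\<^bsub>T\<^esub> eps R m t) s)"
    using assms s by (intro T_finsum_app) auto
  also have "\<dots> = (\<Oplus>t\<in>{..<m}. if s = t then x t else \<zero>)"
    using assms s by (intro R.finsum_cong') (auto simp: T_app eps_app)
  also have "\<dots> = x s"
    using assms s by (intro R.finsum_singleton) auto
  finally show "x s = (\<Oplus>\<^bsub>T\<^esub>t\<in>{..<m}. x t \<odot>\<^bsub>T\<^esub> eps R m t) s" by simp
qed

lemma T_one_expand: "\<one>\<^bsub>T\<^esub> = (\<Oplus>\<^bsub>T\<^esub>t\<in>{..<m}. eps R m t)"
proof -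
  have "\<one>\<^bsub>T\<^esub> = (\<Oplus>\<^bsub>T\<^esub>t\<in>{..<m}. \<one>\<^bsub>T\<^esub> t \<odot>\<^bsub>T\<^esub> eps R m t)"
    by (rule T_expand) simp
  also have "\<dots> = (\<Oplus>\<^bsub>T\<^esub>t\<in>{..<m}. eps R m t)"
    by (rule T.finsum_cong') (auto simp: T_app)
  finally show ?thesis .
qed

section \<open>Twisted products\<close>

lemma sigma_closed [simp, intro]: "a \<in> carrier T \<Longrightarrow> sigma m a \<in> carrier T"
  by (auto simp: T_simps sigma_def)

lemma sigma_pow_closed [simp, intro]: "a \<in> carrier T \<Longrightarrow> (sigma m ^^ i) a \<in> carrier T"
  by (induction i) auto

lemma sigma_shift: "sigma m a (Suc s mod m) = a (s mod m)"
proof -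
  have "(Suc s mod m + (m - 1)) mod m = (Suc s + (m - 1)) mod m"
    by (rule mod_add_left_eq)
  also have "Suc s + (m - 1) = s + m" using m_pos by simp
  finally show ?thesis using m_pos by (simp add: sigma_def)
qed

text \<open>
  All computations with \<open>\<sigma>\<close> evaluate at a translated index, where they involve no subtraction.
\<close>

lemma sigma_pow_shift: "(sigma m ^^ i) a ((s + i) mod m) = a (s mod m)"
  by (induction i) (simp_all add: sigma_shift)

lemma mod_translate:
  assumes "t < m"
  obtains s where "s < m" "t = (s + i) mod m"
proof
  show "(t + i * (m - 1)) mod m < m" using m_pos by simp
  have "((t + i * (m - 1)) mod m + i) mod m = (t + i * (m - 1) + i) mod m"
    by (rule mod_add_left_eq)
  also have "t + i * (m - 1) + i = t + i * m"
    using m_pos by (metis add.assoc add.commute mult_Suc_right Suc_diff_1)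
  finally show "t = ((t + i * (m - 1)) mod m + i) mod m" using assms by simp
qed

lemma mod_translate_bij: "bij_betw (\<lambda>s. (s + i) mod m) {..<m} {..<m}"
proof -
  have "inj_on (\<lambda>s. (s + i) mod m) {..<m}"
    by (rule inj_onI) (simp add: mod_add_cancel)
  moreover have "(\<lambda>s. (s + i) mod m) ` {..<m} \<subseteq> {..<m}" using m_pos by auto
  ultimately show ?thesis by (simp add: bij_betw_def endo_inj_surj)
qed

lemma T_ext_shift:
  assumes "a \<in> carrier T" "b \<in> carrier T" "\<And>s. s < m \<Longrightarrow> a ((s + i) mod m) = b ((s + i) mod m)"
  shows "a = b"
proof (rule T_ext[OF assms(1,2)])
  fix t assume "t < m"
  then obtain s where "s < m" "t = (s + i) mod m" by (rule mod_translate)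
  then show "a t = b t" using assms(3) by simp
qed

lemma sigma_pow_mult:
  assumes "a \<in> carrier T" "b \<in> carrier T"
  shows "(sigma m ^^ i) (a \<otimes>\<^bsub>T\<^esub> b) = (sigma m ^^ i) a \<otimes>\<^bsub>T\<^esub> (sigma m ^^ i) b"
  using assms m_pos by (intro T_ext_shift[where i = i]) (auto simp: sigma_pow_shift T_app)

lemma sigma_pow_add:
  assumes "a \<in> carrier T" "b \<in> carrier T"
  shows "(sigma m ^^ i) (a \<oplus>\<^bsub>T\<^esub> b) = (sigma m ^^ i) a \<oplus>\<^bsub>T\<^esub> (sigma m ^^ i) b"
  using assms m_pos by (intro T_ext_shift[where i = i]) (auto simp: sigma_pow_shift T_app)

lemma sigma_pow_smult:
  assumes "a \<in> carrier T" "r \<in> carrier R"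
  shows "(sigma m ^^ i) (r \<odot>\<^bsub>T\<^esub> a) = r \<odot>\<^bsub>T\<^esub> (sigma m ^^ i) a"
  using assms m_pos by (intro T_ext_shift[where i = i]) (auto simp: sigma_pow_shift T_app)

lemma sigma_pow_one [simp]: "(sigma m ^^ i) \<one>\<^bsub>T\<^esub> = \<one>\<^bsub>T\<^esub>"
  using m_pos by (intro T_ext_shift[where i = i]) (auto simp: sigma_pow_shift T_app)

lemma sigma_pow_cong:
  assumes "a \<in> carrier T" "i mod m = j mod m"
  shows "(sigma m ^^ i) a = (sigma m ^^ j) a"
proof (rule T_ext_shift[where i = i])
  fix s
  have "(s + i) mod m = (s + j) mod m" using assms(2) by (rule mod_add_cong[OF refl])
  then show "(sigma m ^^ i) a ((s + i) mod m) = (sigma m ^^ j) a ((s + i) mod m)"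
    by (metis sigma_pow_shift)
qed (use assms in auto)

lemma sigma_pow_eps: "(sigma m ^^ i) (eps R m (t mod m)) = eps R m ((t + i) mod m)"
proof (rule T_ext_shift[where i = i])
  fix s assume s: "s < m"
  show "(sigma m ^^ i) (eps R m (t mod m)) ((s + i) mod m) = eps R m ((t + i) mod m) ((s + i) mod m)"
    using m_pos by (simp add: sigma_pow_shift eps_app mod_add_cancel)
qed auto

text \<open>
  The product \<open>(a\<^sub>0 z) \<cdots> (a\<^sub>n\<^sub>-\<^sub>1 z)\<close> in the crossed product equals \<open>tprod [a\<^sub>0, \<dots>, a\<^sub>n\<^sub>-\<^sub>1] z^n\<close>.
\<close>

fun tprod :: "(nat \<Rightarrow> 'k) list \<Rightarrow> nat \<Rightarrow> 'k" where
  "tprod [] = \<one>\<^bsub>T\<^esub>"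
| "tprod (a # as) = a \<otimes>\<^bsub>T\<^esub> sigma m (tprod as)"

lemma tprod_closed [simp, intro]: "set as \<subseteq> carrier T \<Longrightarrow> tprod as \<in> carrier T"
  by (induction as) auto

lemma tprod_append:
  assumes "set as \<subseteq> carrier T" "set bs \<subseteq> carrier T"
  shows "tprod (as @ bs) = tprod as \<otimes>\<^bsub>T\<^esub> (sigma m ^^ length as) (tprod bs)"
  using assms
proof (induction as)
  case (Cons a as)
  then have "sigma m (tprod as \<otimes>\<^bsub>T\<^esub> (sigma m ^^ length as) (tprod bs))
    = sigma m (tprod as) \<otimes>\<^bsub>T\<^esub> sigma m ((sigma m ^^ length as) (tprod bs))"
    using sigma_pow_mult[of "tprod as" "(sigma m ^^ length as) (tprod bs)" 1] by simp
  with Cons show ?case by (simp add: T.m_assoc)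
qed simp

lemma tprod_ones [simp]: "tprod (replicate i \<one>\<^bsub>T\<^esub>) = \<one>\<^bsub>T\<^esub>"
  using sigma_pow_one[of 1] by (induction i) auto

text \<open>
  The pointwise form of the product rule, written so that no index has to be subtracted.
\<close>

lemma tprod_app_append:
  assumes "set as \<subseteq> carrier T" "set bs \<subseteq> carrier T"
  shows "tprod (as @ bs) ((s + length as) mod m) = tprod as ((s + length as) mod m) \<otimes> tprod bs (s mod m)"
  using assms m_pos by (simp add: tprod_append T_app sigma_pow_shift)

text \<open>
  The last factor of \<open>\<mu>\<close> carries no power of \<open>\<sigma>\<close>, which agrees with the power \<open>m\<close> that a word of
  length \<open>m + 1\<close> puts there.
\<close>

lemma mu_eq_tprod:
  assumes "set as \<subseteq> carrier T" "length as = m + 1"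
  shows "mu R m as = tprod as"
proof -
  have *: "(\<Otimes>\<^bsub>T\<^esub>i\<in>{..<k}. (sigma m ^^ i) (as ! i)) = tprod (take k as)" if "k \<le> m" for k
    using that
  proof (induction k)
    case (Suc k)
    have as: "as ! i \<in> carrier T" if "i \<le> m" for i using assms that by (auto dest!: nth_mem[of i as])
    have "(\<Otimes>\<^bsub>T\<^esub>i\<in>{..<Suc k}. (sigma m ^^ i) (as ! i)) = (sigma m ^^ k) (as ! k) \<otimes>\<^bsub>T\<^esub> tprod (take k as)"
      using Suc as by (simp add: lessThan_Suc)
    also have "\<dots> = tprod (take k as @ [as ! k])"
      using Suc as assms sigma_pow_one[of 1] set_take_subset[of k as]
      by (subst tprod_append) (auto simp: T.m_comm)
    also have "take k as @ [as ! k] = take (Suc k) as"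
      using Suc assms by (simp add: take_Suc_conv_app_nth)
    finally show ?case .
  qed simp
  have am: "as ! m \<in> carrier T" using assms by (auto dest!: nth_mem[of m as])
  have "tprod as = tprod (take m as @ [as ! m])"
    using assms by (metis Suc_eq_plus1 lessI order_refl take_Suc_conv_app_nth take_all)
  also have "\<dots> = tprod (take m as) \<otimes>\<^bsub>T\<^esub> (sigma m ^^ m) (as ! m)"
    using assms am sigma_pow_one[of 1] set_take_subset[of m as]
    by (subst tprod_append) auto
  also have "(sigma m ^^ m) (as ! m) = as ! m"
    using sigma_pow_cong[OF am, of m 0] by simp
  finally show ?thesis using *[of m] by (simp add: mu_def)
qed

lemma mu_closed [simp, intro]: "set as \<subseteq> carrier T \<Longrightarrow> length as = m + 1 \<Longrightarrow> mu R m as \<in> carrier T"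
  by (simp add: mu_eq_tprod)

lemma tprod_linear:
  assumes "set xs \<subseteq> carrier T" "set ys \<subseteq> carrier T" "a \<in> carrier T" "b \<in> carrier T" "r \<in> carrier R"
  shows "tprod (xs @ (r \<odot>\<^bsub>T\<^esub> a \<oplus>\<^bsub>T\<^esub> b) # ys) = r \<odot>\<^bsub>T\<^esub> tprod (xs @ a # ys) \<oplus>\<^bsub>T\<^esub> tprod (xs @ b # ys)"
proof -
  have "tprod (xs @ c # ys) = tprod xs \<otimes>\<^bsub>T\<^esub> ((sigma m ^^ length xs) c \<otimes>\<^bsub>T\<^esub> (sigma m ^^ Suc (length xs)) (tprod ys))"
    if "c \<in> carrier T" for c
    using that assms by (simp add: tprod_append sigma_pow_mult funpow_swap1)
  note e = this
  show ?thesis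
    using assms
    by (intro T_ext) (auto simp: e sigma_pow_add sigma_pow_smult T_app R.l_distr R.r_distr R.m_ac
        simp del: funpow.simps)
qed

lemma mu_multilinear:
  assumes "set xs \<subseteq> carrier T" "set ys \<subseteq> carrier T" "length xs + length ys = m"
    "a \<in> carrier T" "b \<in> carrier T" "r \<in> carrier R"
  shows "mu R m (xs @ (r \<odot>\<^bsub>T\<^esub> a \<oplus>\<^bsub>T\<^esub> b) # ys)
    = r \<odot>\<^bsub>T\<^esub> mu R m (xs @ a # ys) \<oplus>\<^bsub>T\<^esub> mu R m (xs @ b # ys)"
  using assms by (simp add: mu_eq_tprod tprod_linear)

end

section \<open>Evaluating one-hole contexts\<close>

lemma frames_comp: "K \<in> frames \<Longrightarrow> K' \<in> frames \<Longrightarrow> (\<lambda>t. K (K' t)) \<in> frames"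
  by (induction rule: frames.induct) (simp_all add: frames.intros(2))

lemma frames_Node: "(\<lambda>t. Node (xs @ t # ys)) \<in> frames"
  by (rule frames.intros(2)[OF frames.intros(1)])

lemma frame_holes: "K \<in> frames \<Longrightarrow> holes s = holes t \<Longrightarrow> holes (K s) = holes (K t)"
  by (induction rule: frames.induct) auto

lemma frame_full: "K \<in> frames \<Longrightarrow> full_tree n A (K s) \<Longrightarrow> full_tree n A t \<Longrightarrow> full_tree n A (K t)"
  by (induction rule: frames.induct) auto

lemma frame_full_inner: "K \<in> frames \<Longrightarrow> full_tree n A (K s) \<Longrightarrow> full_tree n A s"
  by (induction rule: frames.induct) auto

lemma frame_tree_value:
  "K \<in> frames \<Longrightarrow> tree_value \<mu> lam x s = tree_value \<mu> lam x t
    \<Longrightarrow> tree_value \<mu> lam x (K s) = tree_value \<mu> lam x (K t)"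
  by (induction rule: frames.induct) auto

lemma graft_hole_free: "holes C = 0 \<Longrightarrow> graft C D = C"
  by (induction C) (auto intro!: map_idI)

lemma graft_Hole: "graft C Hole = C"
  by (induction C) (auto intro: map_idI)

lemma graft_assoc: "graft (graft C D) E = graft C (graft D E)"
  by (induction C) auto

lemma holes_graft: "holes (graft C D) = holes C * holes D"
proof (induction C)
  case (Node ts)
  then have "map (holes \<circ> (\<lambda>t. graft t D)) ts = map (\<lambda>t. holes t * holes D) ts" by simp
  then show ?case by (simp only: graft.simps holes.simps list.map_comp sum_list_mult_const)
qed auto

lemma full_graft: "full_tree n A C \<Longrightarrow> full_tree n A D \<Longrightarrow> full_tree n A (graft C D)"
  by (induction C) auto

lemma sum_list_eq_1_split:
  assumes "sum_list (map f ts) = (1::nat)"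
  obtains ls t rs where "ts = ls @ t # rs" "\<forall>s\<in>set ls. f s = 0" "f t = 1" "\<forall>s\<in>set rs. f s = 0"
  using assms
proof (induction ts arbitrary: thesis)
  case (Cons a ts)
  show ?case
  proof (cases "f a = 0")
    case True
    with Cons.prems have "sum_list (map f ts) = 1" by simp
    then obtain ls t rs where "ts = ls @ t # rs" "\<forall>s\<in>set ls. f s = 0" "f t = 1" "\<forall>s\<in>set rs. f s = 0"
      using Cons.IH by metis
    then show ?thesis using Cons.prems(1)[of "a # ls" t rs] True by simp
  next
    case False
    moreover have "f a + sum_list (map f ts) = 1" using Cons.prems(2) by simp
    ultimately have "f a = 1" "sum_list (map f ts) = 0" by linarith+
    then have "\<forall>s\<in>set ts. f s = 0" by simp
    with \<open>f a = 1\<close> show ?thesis using Cons.prems(1)[of "[]" a ts] by simp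
  qed
qed simp

lemma append_Cons_eq_cases:
  assumes "xs @ k # ys = ls @ t # rs" "k \<noteq> t"
  obtains us where "xs = ls @ t # us" "rs = us @ k # ys" | us where "ls = xs @ k # us" "ys = us @ t # rs"
  using assms
proof (induction xs arbitrary: ls thesis)
  case Nil
  then show ?case by (cases ls) auto
next
  case (Cons x xs)
  show ?case
  proof (cases ls)
    case Nil
    then show ?thesis using Cons.prems by auto
  next
    case (Cons l ls')
    then have "xs @ k # ys = ls' @ t # rs" "x = l" using Cons.prems(3) by auto
    then show ?thesis using Cons.IH[of ls'] Cons.prems(1,2,4) Cons by (metis append_Cons)
  qed
qed

lemma bracket_append:
  "length ins = m + 1 \<Longrightarrow> i = length ls \<Longrightarrow> bracket m i (ls @ ins @ rs) = Node (ls @ Node ins # rs)"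
  by (simp add: bracket_def)

lemma holes_bracket: "holes (bracket m i ws) = sum_list (map holes ws)"
proof -
  have "ws = take i ws @ take (m + 1) (drop i ws) @ drop (i + (m + 1)) ws"
    by (metis append_take_drop_id drop_drop add.commute)
  then have "map holes ws = map holes (take i ws) @ map holes (take (m + 1) (drop i ws))
      @ map holes (drop (i + (m + 1)) ws)"
    by (metis map_append)
  then show ?thesis by (simp add: bracket_def)
qed

lemma full_bracket:
  "(\<And>w. w \<in> set ws \<Longrightarrow> full_tree (m + 1) A w) \<Longrightarrow> length ws = 2 * m + 1 \<Longrightarrow> i \<le> m
    \<Longrightarrow> full_tree (m + 1) A (bracket m i ws)"
  by (auto simp: bracket_def dest!: in_set_takeD in_set_dropD)

lemma vertex_value_Inl [simp]: "vertex_value \<mu> lam (map Inl as) = Inl (\<mu> as)"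
  by (simp add: vertex_value_def comp_def)

lemma vertex_value_Inr [simp]:
  "vertex_value \<mu> lam (map Inl as @ Inr y # map Inl bs) = Inr (lam (as, bs) y)"
  by (simp add: vertex_value_def takeWhile_append dropWhile_append comp_def)

context twisted_nary begin

abbreviation "full \<equiv> full_tree (m + 1) (carrier T)"

lemma contexts_iff: "C \<in> contexts R m \<longleftrightarrow> full C \<and> holes C = 1"
  by (simp add: contexts_def)

lemma Hole_context [simp, intro]: "Hole \<in> contexts R m"
  by (simp add: contexts_iff)

lemma graft_context [simp, intro]: "C \<in> contexts R m \<Longrightarrow> D \<in> contexts R m \<Longrightarrow> graft C D \<in> contexts R m"
  by (simp add: contexts_iff full_graft holes_graft)

lemma frame_context:
  "K \<in> frames \<Longrightarrow> K s \<in> contexts R m \<Longrightarrow> full t \<Longrightarrow> holes s = holes t \<Longrightarrow> K t \<in> contexts R m"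
  by (metis contexts_iff frame_holes frame_full)

fun scalar_value :: "(nat \<Rightarrow> 'k) tree \<Rightarrow> nat \<Rightarrow> 'k" where
  "scalar_value Hole = undefined"
| "scalar_value (Leaf a) = a"
| "scalar_value (Node ts) = mu R m (map scalar_value ts)"

definition scalar_trees :: "(nat \<Rightarrow> 'k) tree set" where
  "scalar_trees = {t. full t \<and> holes t = 0}"

lemma scalar_tree_Leaf [simp]: "Leaf a \<in> scalar_trees \<longleftrightarrow> a \<in> carrier T"
  by (simp add: scalar_trees_def)

lemma scalar_tree_Node [simp]: "Node ts \<in> scalar_trees \<longleftrightarrow> length ts = m + 1 \<and> set ts \<subseteq> scalar_trees"
  by (auto simp: scalar_trees_def)

lemma scalar_value_closed: "t \<in> scalar_trees \<Longrightarrow> scalar_value t \<in> carrier T"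
proof (induction t)
  case (Node ts)
  then have "set (map scalar_value ts) \<subseteq> carrier T" by auto
  with Node show ?case by (auto intro!: mu_closed simp del: set_map)
qed (auto simp: scalar_trees_def)

lemma scalar_values_closed: "set ts \<subseteq> scalar_trees \<Longrightarrow> set (map scalar_value ts) \<subseteq> carrier T"
  using scalar_value_closed by auto

lemma scalar_Leafs:
  assumes "set us \<subseteq> carrier T"
  shows "set (map Leaf us) \<subseteq> scalar_trees" "map scalar_value (map Leaf us) = us"
  using assms by (induction us) auto

lemma tree_value_scalar: "t \<in> scalar_trees \<Longrightarrow> tree_value (mu R m) lam x t = Inl (scalar_value t)"
proof (induction t)
  case (Node ts)
  then have "map (tree_value (mu R m) lam x) ts = map Inl (map scalar_value ts)" by auto
  then show ?case by (simp del: map_map)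
qed (auto simp: scalar_trees_def)

lemma context_cases:
  assumes "C \<in> contexts R m"
  obtains "C = Hole"
  | ls t rs where "C = Node (ls @ t # rs)" "set ls \<subseteq> scalar_trees" "t \<in> contexts R m"
      "set rs \<subseteq> scalar_trees" "length ls + length rs = m"
proof (cases C)
  case (Node ts)
  with assms have "sum_list (map holes ts) = 1" by (simp add: contexts_iff)
  then obtain ls t rs where *: "ts = ls @ t # rs" "\<forall>s\<in>set ls. holes s = 0" "holes t = 1" "\<forall>s\<in>set rs. holes s = 0"
    by (rule sum_list_eq_1_split)
  then show ?thesis using assms that(2)[of ls t rs] Node by (auto simp: contexts_iff scalar_trees_def)
qed (use assms that in \<open>auto simp: contexts_iff\<close>)

text \<open>
  A context is built from \<open>\<star>\<close> by vertices that have one context among their inputs; the other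
  inputs can be evaluated in \<open>A\<close>.
\<close>

lemma context_induct [consumes 1, case_names Hole Node]:
  assumes "C \<in> contexts R m" "P Hole"
    and step: "\<And>ls t rs. set ls \<subseteq> scalar_trees \<Longrightarrow> t \<in> contexts R m \<Longrightarrow> set rs \<subseteq> scalar_trees
      \<Longrightarrow> length ls + length rs = m \<Longrightarrow> P t \<Longrightarrow> P (Node (ls @ t # rs))"
  shows "P C"
  using assms(1)
proof (induction C)
  case (Node ts)
  from Node.prems show ?case
  proof (cases rule: context_cases)
    case (2 ls t rs)
    then show ?thesis using Node.IH[of t] step[of ls t rs] by auto
  qed simp
qed (use assms in \<open>auto simp: contexts_iff\<close>)

lemma Node_context:
  assumes "set ls \<subseteq> scalar_trees" "t \<in> contexts R m" "set rs \<subseteq> scalar_trees" "length ls + length rs = m"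
  shows "Node (ls @ t # rs) \<in> contexts R m"
  using assms by (auto simp: contexts_iff scalar_trees_def subset_iff sum_list_eq_0_iff)

definition ctx_op :: "((nat \<Rightarrow> 'k) list \<times> (nat \<Rightarrow> 'k) list \<Rightarrow> 'v \<Rightarrow> 'v) \<Rightarrow> (nat \<Rightarrow> 'k) tree \<Rightarrow> 'v \<Rightarrow> 'v" where
  "ctx_op lam C x = projr (tree_value (mu R m) lam x C)"

lemma ctx_op_Hole [simp]: "ctx_op lam Hole x = x"
  by (simp add: ctx_op_def)

text \<open>
  Only the values of the hole-free inputs matter, so that every vertex on the path to the hole acts
  as one slot operation.
\<close>

lemma tree_value_Node:
  assumes "set ls \<subseteq> scalar_trees" "set rs \<subseteq> scalar_trees" "tree_value (mu R m) lam x t = Inr y"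
  shows "tree_value (mu R m) lam x (Node (ls @ t # rs)) = Inr (lam (map scalar_value ls, map scalar_value rs) y)"
proof -
  have e: "map (tree_value (mu R m) lam x) us = map Inl (map scalar_value us)" if "set us \<subseteq> scalar_trees" for us
    using that by (auto simp: tree_value_scalar)
  show ?thesis
    by (simp only: tree_value.simps map_append list.map e[OF assms(1)] e[OF assms(2)] assms(3) vertex_value_Inr)
qed

lemma tree_value_context:
  "C \<in> contexts R m \<Longrightarrow> tree_value (mu R m) lam x C = Inr (ctx_op lam C x)"
proof (induction rule: context_induct)
  case (Node ls t rs)
  then have "tree_value (mu R m) lam x (Node (ls @ t # rs))
      = Inr (lam (map scalar_value ls, map scalar_value rs) (ctx_op lam t x))"
    by (intro tree_value_Node)
  then show ?case by (simp only: ctx_op_def sum.sel)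
qed (simp add: ctx_op_def)

lemma ctx_op_Node:
  assumes "set ls \<subseteq> scalar_trees" "t \<in> contexts R m" "set rs \<subseteq> scalar_trees"
  shows "ctx_op lam (Node (ls @ t # rs)) x = lam (map scalar_value ls, map scalar_value rs) (ctx_op lam t x)"
  using tree_value_Node[OF assms(1,3) tree_value_context[OF assms(2)], of lam x] by (simp only: ctx_op_def sum.sel)

lemma ctx_op_graft:
  assumes "C \<in> contexts R m" "D \<in> contexts R m"
  shows "ctx_op lam (graft C D) x = ctx_op lam C (ctx_op lam D x)"
  using assms(1)
proof (induction rule: context_induct)
  case (Node ls t rs)
  have e: "map (\<lambda>t. graft t D) us = us" if "set us \<subseteq> scalar_trees" for us
    using that by (auto intro!: map_idI simp: scalar_trees_def graft_hole_free)
  show ?case using Node assms(2) by (simp add: e ctx_op_Node)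
qed simp

end

section \<open>Slot operations as words\<close>

locale anchored_slots = twisted_nary R m for R :: "'k ring" (structure) and m +
  fixes V :: "('k, 'v) module" and lam
  assumes anchored: "anchored_slot_module R m V lam"

sublocale anchored_slots \<subseteq> V: module R V
  using anchored by (simp add: anchored_slot_module_def slot_module_def)

context anchored_slots begin

lemma slot: "slot_module R m V lam"
  using anchored by (simp add: anchored_slot_module_def)

lemma slot_opsI:
  "set as \<subseteq> carrier T \<Longrightarrow> set bs \<subseteq> carrier T \<Longrightarrow> length as + length bs = m \<Longrightarrow> (as, bs) \<in> slot_ops R m"
  by (simp add: slot_ops_def)

lemma lam_hom: "p \<in> slot_ops R m \<Longrightarrow> lam p \<in> module_hom R V V"
  using slot by (simp add: slot_module_def)

lemma lam_closed [simp]: "p \<in> slot_ops R m \<Longrightarrow> x \<in> carrier V \<Longrightarrow> lam p x \<in> carrier V"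
  using lam_hom[of p] by (auto simp: module_hom_def)

lemma lam_add: "p \<in> slot_ops R m \<Longrightarrow> x \<in> carrier V \<Longrightarrow> y \<in> carrier V
    \<Longrightarrow> lam p (x \<oplus>\<^bsub>V\<^esub> y) = lam p x \<oplus>\<^bsub>V\<^esub> lam p y"
  using lam_hom[of p] by (auto simp: module_hom_def)

lemma lam_smult: "p \<in> slot_ops R m \<Longrightarrow> r \<in> carrier R \<Longrightarrow> x \<in> carrier V
    \<Longrightarrow> lam p (r \<odot>\<^bsub>V\<^esub> x) = r \<odot>\<^bsub>V\<^esub> lam p x"
  using lam_hom[of p] by (auto simp: module_hom_def)

lemma slot_linear:
  assumes "(as, bs) \<in> slot_ops R m" "r \<in> carrier R" "a \<in> carrier T" "b \<in> carrier T" "x \<in> carrier V"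
  shows "i < length as \<Longrightarrow> lam (as[i := r \<odot>\<^bsub>T\<^esub> a \<oplus>\<^bsub>T\<^esub> b], bs) x
      = r \<odot>\<^bsub>V\<^esub> lam (as[i := a], bs) x \<oplus>\<^bsub>V\<^esub> lam (as[i := b], bs) x"
    and "i < length bs \<Longrightarrow> lam (as, bs[i := r \<odot>\<^bsub>T\<^esub> a \<oplus>\<^bsub>T\<^esub> b]) x
      = r \<odot>\<^bsub>V\<^esub> lam (as, bs[i := a]) x \<oplus>\<^bsub>V\<^esub> lam (as, bs[i := b]) x"
proof -
  have "\<forall>p\<in>slot_ops R m. case p of (as, bs) \<Rightarrow> \<forall>r\<in>carrier R. \<forall>a\<in>carrier T. \<forall>b\<in>carrier T. \<forall>x\<in>carrier V.
          (\<forall>i<length as. lam (as[i := r \<odot>\<^bsub>T\<^esub> a \<oplus>\<^bsub>T\<^esub> b], bs) x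
             = r \<odot>\<^bsub>V\<^esub> lam (as[i := a], bs) x \<oplus>\<^bsub>V\<^esub> lam (as[i := b], bs) x)
        \<and> (\<forall>i<length bs. lam (as, bs[i := r \<odot>\<^bsub>T\<^esub> a \<oplus>\<^bsub>T\<^esub> b]) x
             = r \<odot>\<^bsub>V\<^esub> lam (as, bs[i := a]) x \<oplus>\<^bsub>V\<^esub> lam (as, bs[i := b]) x)"
    using slot unfolding slot_module_def by (elim conjE)
  from this[THEN bspec, OF assms(1), unfolded prod.case, THEN bspec, OF assms(2), THEN bspec, OF assms(3),
      THEN bspec, OF assms(4), THEN bspec, OF assms(5)]
  show "i < length as \<Longrightarrow> lam (as[i := r \<odot>\<^bsub>T\<^esub> a \<oplus>\<^bsub>T\<^esub> b], bs) x
      = r \<odot>\<^bsub>V\<^esub> lam (as[i := a], bs) x \<oplus>\<^bsub>V\<^esub> lam (as[i := b], bs) x"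
    and "i < length bs \<Longrightarrow> lam (as, bs[i := r \<odot>\<^bsub>T\<^esub> a \<oplus>\<^bsub>T\<^esub> b]) x
      = r \<odot>\<^bsub>V\<^esub> lam (as, bs[i := a]) x \<oplus>\<^bsub>V\<^esub> lam (as, bs[i := b]) x"
    by blast+
qed

lemma lam_left_linear:
  assumes "(us @ a # ws, bs) \<in> slot_ops R m" "b \<in> carrier T" "r \<in> carrier R" "x \<in> carrier V"
  shows "lam (us @ (r \<odot>\<^bsub>T\<^esub> a \<oplus>\<^bsub>T\<^esub> b) # ws, bs) x
    = r \<odot>\<^bsub>V\<^esub> lam (us @ a # ws, bs) x \<oplus>\<^bsub>V\<^esub> lam (us @ b # ws, bs) x"
  using slot_linear(1)[OF assms(1,3) _ assms(2,4), of a "length us"] assms(1) by (simp add: slot_ops_def)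

lemma lam_right_linear:
  assumes "(as, us @ a # ws) \<in> slot_ops R m" "b \<in> carrier T" "r \<in> carrier R" "x \<in> carrier V"
  shows "lam (as, us @ (r \<odot>\<^bsub>T\<^esub> a \<oplus>\<^bsub>T\<^esub> b) # ws) x
    = r \<odot>\<^bsub>V\<^esub> lam (as, us @ a # ws) x \<oplus>\<^bsub>V\<^esub> lam (as, us @ b # ws) x"
  using slot_linear(2)[OF assms(1,3) _ assms(2,4), of a "length us"] assms(1) by (simp add: slot_ops_def)

lemma assoc_move_value:
  assumes "(C, D) \<in> assoc_moves R m" "x \<in> carrier V"
  shows "tree_value (mu R m) lam x C = tree_value (mu R m) lam x D"
  using slot assms by (auto simp: slot_module_def)

text \<open>
  For a word with two adjacent vertices and one hole, \<open>assoc_moves\<close> says that the value does not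
  depend on the position of the inner vertex. The three lemmas below compute this value when the hole
  lies in the inner vertex, to its right, and to its left.
\<close>

lemma word_move:
  assumes "set us \<subseteq> carrier T" "set vs \<subseteq> carrier T" "length us + length vs = 2 * m"
    "i \<le> m" "j \<le> m" "x \<in> carrier V"
  shows "tree_value (mu R m) lam x (bracket m i (map Leaf us @ Hole # map Leaf vs))
    = tree_value (mu R m) lam x (bracket m j (map Leaf us @ Hole # map Leaf vs))"
proof (rule assoc_move_value[OF _ assms(6)])
  let ?ws = "map Leaf us @ Hole # map Leaf vs"
  have "sum_list (map holes ?ws) = 1" by (simp add: comp_def)
  moreover have "full (bracket m i ?ws)"
    using assms(1-4) by (intro full_bracket) auto
  ultimately have "bracket m i ?ws \<in> contexts R m" by (simp add: contexts_iff holes_bracket)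
  then show "(bracket m i ?ws, bracket m j ?ws) \<in> assoc_moves R m"
    unfolding assoc_moves_def using assms(3-5) frames.intros(1) by fastforce
qed

lemma word_inner:
  assumes "set (as @ cs) \<subseteq> carrier T" "set (ds @ bs) \<subseteq> carrier T" "length as + length bs = m" "length cs + length ds = m"
  shows "tree_value (mu R m) lam x (bracket m (length as) (map Leaf (as @ cs) @ Hole # map Leaf (ds @ bs)))
    = Inr (lam (as, bs) (lam (cs, ds) x))"
proof -
  have s: "set (map Leaf us) \<subseteq> scalar_trees" "map scalar_value (map Leaf us) = us"
    if "set us \<subseteq> carrier T" for us
    using scalar_Leafs[OF that] .
  have "bracket m (length as) (map Leaf (as @ cs) @ Hole # map Leaf (ds @ bs))
    = Node (map Leaf as @ Node (map Leaf cs @ Hole # map Leaf ds) # map Leaf bs)"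
    using bracket_append[of "map Leaf cs @ Hole # map Leaf ds" m "length as" "map Leaf as" "map Leaf bs"] assms(4)
    by simp
  moreover have "tree_value (mu R m) lam x (Node (map Leaf cs @ Hole # map Leaf ds)) = Inr (lam (cs, ds) x)"
    using tree_value_Node[of "map Leaf cs" "map Leaf ds" lam x Hole x] assms(1,2) s[of cs] s[of ds]
    by simp
  moreover have "set as \<subseteq> carrier T" "set bs \<subseteq> carrier T" using assms(1,2) by simp_all
  ultimately show ?thesis
    using tree_value_Node[OF s(1)[of as] s(1)[of bs], of lam x] by (simp only: s(2))
qed

lemma word_left:
  assumes "set (us @ vs @ ws) \<subseteq> carrier T" "set ds \<subseteq> carrier T"
    "length us + Suc (length ws) + length ds = m" "length vs = m + 1"
  shows "tree_value (mu R m) lam x (bracket m (length us) (map Leaf (us @ vs @ ws) @ Hole # map Leaf ds))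
    = Inr (lam (us @ tprod vs # ws, ds) x)"
proof -
  have "bracket m (length us) (map Leaf (us @ vs @ ws) @ Hole # map Leaf ds)
    = Node ((map Leaf us @ Node (map Leaf vs) # map Leaf ws) @ Hole # map Leaf ds)"
    using bracket_append[of "map Leaf vs" m "length us" "map Leaf us" "map Leaf ws @ Hole # map Leaf ds"] assms(4)
    by simp
  moreover have "set (map Leaf us @ Node (map Leaf vs) # map Leaf ws) \<subseteq> scalar_trees"
    "set (map Leaf ds) \<subseteq> scalar_trees"
    using assms(1,2,4) by auto
  moreover have "map scalar_value (map Leaf us @ Node (map Leaf vs) # map Leaf ws) = us @ tprod vs # ws"
    "map scalar_value (map Leaf ds) = ds"
    using assms(1,2,4) scalar_Leafs(2) by (simp_all add: mu_eq_tprod)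
  ultimately show ?thesis
    using tree_value_Node[of "map Leaf us @ Node (map Leaf vs) # map Leaf ws" "map Leaf ds" lam x Hole x]
    by (simp only: tree_value.simps)
qed

lemma word_right:
  assumes "set as \<subseteq> carrier T" "set (us @ vs @ ws) \<subseteq> carrier T"
    "length as + (length us + Suc (length ws)) = m" "length vs = m + 1"
  shows "tree_value (mu R m) lam x (bracket m (length as + Suc (length us)) (map Leaf as @ Hole # map Leaf (us @ vs @ ws)))
    = Inr (lam (as, us @ tprod vs # ws) x)"
proof -
  have "bracket m (length as + Suc (length us)) (map Leaf as @ Hole # map Leaf (us @ vs @ ws))
    = Node (map Leaf as @ Hole # (map Leaf us @ Node (map Leaf vs) # map Leaf ws))"
    using bracket_append[of "map Leaf vs" m "length as + Suc (length us)" "map Leaf as @ Hole # map Leaf us" "map Leaf ws"] assms(4)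
    by simp
  moreover have "set (map Leaf us @ Node (map Leaf vs) # map Leaf ws) \<subseteq> scalar_trees"
    "set (map Leaf as) \<subseteq> scalar_trees"
    using assms(1,2,4) by auto
  moreover have "map scalar_value (map Leaf us @ Node (map Leaf vs) # map Leaf ws) = us @ tprod vs # ws"
    "map scalar_value (map Leaf as) = as"
    using assms(1,2,4) scalar_Leafs(2) by (simp_all add: mu_eq_tprod)
  ultimately show ?thesis
    using tree_value_Node[of "map Leaf as" "map Leaf us @ Node (map Leaf vs) # map Leaf ws" lam x Hole x]
    by (simp only: tree_value.simps)
qed

text \<open>
  A composite of two slot operations depends only on the total word to the left and to the right of
  the hole. If one of these words has more than \<open>m\<close> letters, \<open>m + 1\<close> consecutive ones can moreover be
  multiplied, and the composite is a single slot operation.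
\<close>

lemma lam_lam:
  assumes "set (as @ cs) \<subseteq> carrier T" "set (ds @ bs) \<subseteq> carrier T" "length as + length bs = m" "length cs + length ds = m"
    "as @ cs = as' @ cs'" "ds @ bs = ds' @ bs'" "length as' + length bs' = m" "x \<in> carrier V"
  shows "lam (as, bs) (lam (cs, ds) x) = lam (as', bs') (lam (cs', ds') x)"
proof -
  have "length cs' + length ds' = m"
    using assms(3,4,7) arg_cong[OF assms(5), of length] arg_cong[OF assms(6), of length] by simp
  then have "Inr (lam (as, bs) (lam (cs, ds) x)) = (Inr (lam (as', bs') (lam (cs', ds') x)) :: (nat \<Rightarrow> 'k) + 'v)"
    using word_inner[of as cs ds bs x] word_inner[of as' cs' ds' bs' x]
      word_move[of "as @ cs" "ds @ bs" "length as" "length as'" x] assms by simp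
  then show ?thesis by simp
qed

lemma lam_lam_left:
  assumes "set (as @ cs) \<subseteq> carrier T" "set (ds @ bs) \<subseteq> carrier T" "length as + length bs = m" "length cs + length ds = m"
    "as @ cs = us @ vs @ ws" "length vs = m + 1" "x \<in> carrier V"
  shows "lam (as, bs) (lam (cs, ds) x) = lam (us @ tprod vs # ws, ds @ bs) x"
proof -
  have l: "length us + Suc (length ws) + length (ds @ bs) = m"
    using assms(3,4,6) arg_cong[OF assms(5), of length] by simp
  have "Inr (lam (as, bs) (lam (cs, ds) x)) = (Inr (lam (us @ tprod vs # ws, ds @ bs) x) :: (nat \<Rightarrow> 'k) + 'v)"
    using word_inner[of as cs ds bs x] word_left[of us vs ws "ds @ bs" x]
      word_move[of "as @ cs" "ds @ bs" "length as" "length us" x] assms l by simp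
  then show ?thesis by simp
qed

lemma lam_lam_right:
  assumes "set (as @ cs) \<subseteq> carrier T" "set (ds @ bs) \<subseteq> carrier T" "length as + length bs = m" "length cs + length ds = m"
    "ds @ bs = us @ vs @ ws" "length vs = m + 1" "x \<in> carrier V"
  shows "lam (as, bs) (lam (cs, ds) x) = lam (as @ cs, us @ tprod vs # ws) x"
proof -
  have l: "length (as @ cs) + (length us + Suc (length ws)) = m"
    using assms(3,4,6) arg_cong[OF assms(5), of length] by simp
  have "Inr (lam (as, bs) (lam (cs, ds) x)) = (Inr (lam (as @ cs, us @ tprod vs # ws) x) :: (nat \<Rightarrow> 'k) + 'v)"
    using word_inner[of as cs ds bs x] word_right[of "as @ cs" us vs ws x]
      word_move[of "as @ cs" "ds @ bs" "length as" "length (as @ cs) + Suc (length us)" x] assms l by simp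
  then show ?thesis by simp
qed

section \<open>Left multiplication, right multiplication and shift\<close>

abbreviation ones :: "nat \<Rightarrow> (nat \<Rightarrow> 'k) list" where
  "ones i \<equiv> replicate i \<one>\<^bsub>T\<^esub>"

text \<open>
  The left and right multiplications by \<open>a\<close> and the conjugation by \<open>z^i\<close>, as slot operations: in the
  crossed product the padding contributes the remaining factors of \<open>z^m = 1\<close>.
\<close>

definition lmul :: "(nat \<Rightarrow> 'k) \<Rightarrow> 'v \<Rightarrow> 'v" where
  "lmul a = lam (a # ones (m - 1), [])"

definition rmul :: "(nat \<Rightarrow> 'k) \<Rightarrow> 'v \<Rightarrow> 'v" where
  "rmul b = lam ([], b # ones (m - 1))"

definition shift :: "nat \<Rightarrow> 'v \<Rightarrow> 'v" where
  "shift i = lam (ones i, ones (m - i))"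

lemma set_ones [simp]: "set (ones i) \<subseteq> carrier T"
  by auto

lemma word_ops [simp]:
  "a \<in> carrier T \<Longrightarrow> (a # ones (m - 1), []) \<in> slot_ops R m"
  "b \<in> carrier T \<Longrightarrow> ([], b # ones (m - 1)) \<in> slot_ops R m"
  "i \<le> m \<Longrightarrow> (ones i, ones (m - i)) \<in> slot_ops R m"
  using m_pos by (auto simp: slot_ops_def)

lemmas word_ops_Suc [simp] = word_ops(1,2)[unfolded One_nat_def]

lemma lmul_closed [simp]: "a \<in> carrier T \<Longrightarrow> x \<in> carrier V \<Longrightarrow> lmul a x \<in> carrier V"
  and rmul_closed [simp]: "b \<in> carrier T \<Longrightarrow> x \<in> carrier V \<Longrightarrow> rmul b x \<in> carrier V"
  and shift_closed [simp]: "i \<le> m \<Longrightarrow> x \<in> carrier V \<Longrightarrow> shift i x \<in> carrier V"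
  by (simp_all add: lmul_def rmul_def shift_def)

lemma shift_0 [simp]: "x \<in> carrier V \<Longrightarrow> shift 0 x = x"
  and shift_m [simp]: "x \<in> carrier V \<Longrightarrow> shift m x = x"
  using anchored by (simp_all add: shift_def anchored_slot_module_def)

lemma Cons_ones: "0 < i \<Longrightarrow> \<one>\<^bsub>T\<^esub> # ones (i - Suc 0) = ones i"
  by (cases i) auto

lemma lmul_one [simp]: "x \<in> carrier V \<Longrightarrow> lmul \<one>\<^bsub>T\<^esub> x = x"
  and rmul_one [simp]: "x \<in> carrier V \<Longrightarrow> rmul \<one>\<^bsub>T\<^esub> x = x"
  using shift_m shift_0 m_pos by (simp_all add: lmul_def rmul_def shift_def Cons_ones)

lemma tprod_ones_right [simp]: "set as \<subseteq> carrier T \<Longrightarrow> tprod (as @ ones i) = tprod as"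
  by (simp add: tprod_append)

lemma tprod_ones_left: "set as \<subseteq> carrier T \<Longrightarrow> tprod (ones i @ as) = (sigma m ^^ i) (tprod as)"
  by (simp add: tprod_append)

lemma tprod_single: "a \<in> carrier T \<Longrightarrow> tprod (a # ones i) = a"
  using tprod_ones_right[of "[a]" i] sigma_pow_one[of 1] by simp

lemma tprod_singleton [simp]: "a \<in> carrier T \<Longrightarrow> tprod [a] = a"
  using tprod_single[of a 0] by simp

lemma ones_add: "ones i @ ones j = ones (i + j)"
  by (simp add: replicate_add)

text \<open>
  Composing with the anchor \<open>lam (ones m, [])\<close> makes the left word long enough for its letters to be
  collected in a single product.
\<close>

lemma lam_normal_left:
  assumes "(a # as, bs) \<in> slot_ops R m" "x \<in> carrier V"
  shows "lam (a # as, bs) x = lam (tprod (a # as) # ones (length as), bs) x"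
proof -
  have *: "set (a # as) \<subseteq> carrier T" "set bs \<subseteq> carrier T" "length (a # as) + length bs = m"
    using assms(1) by (auto simp: slot_ops_def)
  have "lam (a # as, bs) x = lam (a # as, bs) (lam (ones m, []) x)"
    using shift_m[OF assms(2)] by (simp add: shift_def)
  also have "\<dots> = lam ([] @ tprod ((a # as) @ ones (m - length as)) # ones (length as), [] @ bs) x"
    using * assms(2) by (intro lam_lam_left) (auto simp: ones_add)
  also have "tprod ((a # as) @ ones (m - length as)) = tprod (a # as)"
    by (rule tprod_ones_right) (use * in simp)
  finally show ?thesis by simp
qed

text \<open>
  The first letter of the word meets \<open>\<sigma>\<^sup>m\<close>, which is the identity.
\<close>

lemma lmul_lam_Cons:
  assumes "(a # as, bs) \<in> slot_ops R m" "b \<in> carrier T" "x \<in> carrier V"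
  shows "lmul b (lam (a # as, bs) x) = lam ((b \<otimes>\<^bsub>T\<^esub> a) # as, bs) x"
proof -
  have *: "set (a # as) \<subseteq> carrier T" "set bs \<subseteq> carrier T" "length (a # as) + length bs = m"
    using assms(1) by (auto simp: slot_ops_def)
  have "lmul b (lam (a # as, bs) x) = lam ([] @ tprod (b # ones (m - 1) @ [a]) # as, bs @ []) x"
    unfolding lmul_def using * assms(2,3) m_pos by (intro lam_lam_left) auto
  also have "tprod (b # ones (m - 1) @ [a]) = tprod ((b # ones (m - 1)) @ [a])" by simp
  also have "\<dots> = b \<otimes>\<^bsub>T\<^esub> (sigma m ^^ m) a"
    using *(1) assms(2) m_pos by (subst tprod_append) (auto simp: tprod_single simp del: tprod.simps(2))
  also have "(sigma m ^^ m) a = a" using sigma_pow_cong[of a m 0] * by simp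
  finally show ?thesis by simp
qed

lemma lam_left_factor:
  assumes "(as, bs) \<in> slot_ops R m" "x \<in> carrier V"
  shows "lam (as, bs) x = lmul (tprod as) (lam (ones (length as), bs) x)"
proof (cases as)
  case Nil
  then show ?thesis using assms by simp
next
  case (Cons a as')
  have *: "(\<one>\<^bsub>T\<^esub> # ones (length as'), bs) \<in> slot_ops R m" "tprod (a # as') \<in> carrier T"
    using assms(1) Cons by (auto simp: slot_ops_def simp del: tprod.simps intro!: tprod_closed)
  have "lmul (tprod as) (lam (ones (length as), bs) x) = lam ((tprod as \<otimes>\<^bsub>T\<^esub> \<one>\<^bsub>T\<^esub>) # ones (length as'), bs) x"
    using lmul_lam_Cons[OF *(1) *(2) assms(2)] Cons by simp
  also have "\<dots> = lam (as, bs) x"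
    using lam_normal_left[of a as' bs x] assms Cons * by (simp del: tprod.simps)
  finally show ?thesis by simp
qed

lemma shift_rmul_Cons:
  assumes "i < m" "b \<in> carrier T" "x \<in> carrier V"
  shows "shift i (rmul b x) = lam (ones i, b # ones (m - i - 1)) x"
proof -
  have "shift i (rmul b x) = lam (ones i @ [], [] @ tprod (b # ones m) # ones (m - i - 1)) x"
    unfolding shift_def rmul_def using assms by (intro lam_lam_right) (auto simp: ones_add)
  then show ?thesis using assms by (simp add: tprod_single del: tprod.simps)
qed

lemma lam_right_factor:
  assumes "(ones i, bs) \<in> slot_ops R m" "x \<in> carrier V"
  shows "lam (ones i, bs) x = shift i (rmul (tprod bs) x)"
proof (cases "i < m")
  case False
  then have "i = m" "bs = []" using assms(1) by (auto simp: slot_ops_def)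
  then show ?thesis using assms by (simp add: shift_def)
next
  case True
  have *: "set bs \<subseteq> carrier T" "i + length bs = m" using assms(1) by (auto simp: slot_ops_def)
  \<comment> \<open>the other anchor prolongs the right word at its end, which leaves its twisted product unchanged\<close>
  have "lam (ones i, bs) x = lam ([], ones m) (lam (ones i, bs) x)"
    using shift_0[of "lam (ones i, bs) x"] assms by (simp add: shift_def)
  also have "\<dots> = lam ([] @ ones i, [] @ tprod (bs @ ones (i + 1)) # ones (m - i - 1)) x"
    using * True assms(2) by (intro lam_lam_right) (auto simp: ones_add Cons_ones add.commute simp del: replicate_Suc)
  also have "\<dots> = shift i (rmul (tprod bs) x)"
    using *(1) assms(2) True tprod_ones_right[of bs "i + 1"] by (simp add: shift_rmul_Cons tprod_closed del: replicate_Suc)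
  finally show ?thesis .
qed

text \<open>
  The normal form of slot operations: \<open>as\<close> and \<open>bs\<close> enter only through the twisted products and the
  position of the slot.
\<close>

theorem lam_factor:
  assumes "(as, bs) \<in> slot_ops R m" "x \<in> carrier V"
  shows "lam (as, bs) x = lmul (tprod as) (shift (length as) (rmul (tprod bs) x))"
  using assms lam_left_factor[OF assms] lam_right_factor[of "length as" bs x]
  by (simp add: slot_ops_def)

lemma lmul_lmul:
  assumes "a \<in> carrier T" "b \<in> carrier T" "x \<in> carrier V"
  shows "lmul a (lmul b x) = lmul (a \<otimes>\<^bsub>T\<^esub> b) x"
  using lmul_lam_Cons[of b "ones (m - 1)" "[]" a x] assms by (simp add: lmul_def)

lemma rmul_rmul:
  assumes "a \<in> carrier T" "b \<in> carrier T" "x \<in> carrier V"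
  shows "rmul a (rmul b x) = rmul (a \<otimes>\<^bsub>T\<^esub> b) x"
proof -
  have "rmul a (rmul b x) = lam ([] @ [], [] @ tprod (b # ones (m - 1) @ [a]) # ones (m - 1)) x"
    unfolding rmul_def using assms m_pos by (intro lam_lam_right) auto
  also have "tprod (b # ones (m - 1) @ [a]) = tprod ((b # ones (m - 1)) @ [a])" by simp
  also have "\<dots> = b \<otimes>\<^bsub>T\<^esub> (sigma m ^^ m) a"
    using assms m_pos by (subst tprod_append) (auto simp: tprod_single simp del: tprod.simps(2))
  also have "(sigma m ^^ m) a = a" using sigma_pow_cong[of a m 0] assms by simp
  finally show ?thesis using assms by (simp add: rmul_def T.m_comm)
qed

lemma lmul_rmul:
  assumes "a \<in> carrier T" "b \<in> carrier T" "x \<in> carrier V"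
  shows "lmul a (rmul b x) = rmul b (lmul a x)"
  unfolding lmul_def rmul_def using assms m_pos by (intro lam_lam) auto

text \<open>
  This and the next lemma are the relation \<open>z a = \<sigma>(a) z\<close> for both actions of \<open>A\<close>.
\<close>

lemma shift_lmul:
  assumes "i \<le> m" "a \<in> carrier T" "x \<in> carrier V"
  shows "shift i (lmul a x) = lmul ((sigma m ^^ i) a) (shift i x)"
proof (cases "i = 0")
  case False
  have "shift i (lmul a x) = lam ([] @ tprod (ones i @ a # ones (m - i)) # ones (i - 1), [] @ ones (m - i)) x"
    unfolding shift_def lmul_def using assms False by (intro lam_lam_left) (auto simp: ones_add)
  also have "tprod (ones i @ a # ones (m - i)) = (sigma m ^^ i) a"
    using assms by (subst tprod_ones_left) (auto simp: tprod_single simp del: tprod.simps)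
  also have "lam ([] @ (sigma m ^^ i) a # ones (i - 1), [] @ ones (m - i)) x
    = lmul ((sigma m ^^ i) a) (lam (ones (length ((sigma m ^^ i) a # ones (i - 1))), ones (m - i)) x)"
    using assms False lam_left_factor[of "(sigma m ^^ i) a # ones (i - 1)" "ones (m - i)" x]
    by (simp add: tprod_single slot_ops_def del: tprod.simps)
  finally show ?thesis using False by (simp add: shift_def)
qed (use assms in simp)

lemma shift_rmul:
  assumes "i \<le> m" "b \<in> carrier T" "x \<in> carrier V"
  shows "shift i (rmul b x) = rmul ((sigma m ^^ i) b) (shift i x)"
proof (cases "i = m")
  case True
  then show ?thesis using assms sigma_pow_cong[of b m 0] by simp
next
  case False
  then have i: "i < m" using assms by simp
  have "rmul ((sigma m ^^ i) b) (shift i x)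
    = lam ([] @ ones i, [] @ tprod (ones (m - i) @ (sigma m ^^ i) b # ones i) # ones (m - i - 1)) x"
    unfolding shift_def rmul_def using assms i by (intro lam_lam_right) (auto simp: ones_add)
  also have "tprod (ones (m - i) @ (sigma m ^^ i) b # ones i) = (sigma m ^^ (m - i)) ((sigma m ^^ i) b)"
    using assms by (subst tprod_ones_left) (auto simp: tprod_single simp del: tprod.simps)
  also have "\<dots> = (sigma m ^^ (m - i + i)) b" by (simp only: funpow_add comp_def)
  also have "\<dots> = b" using sigma_pow_cong[of b m 0] assms i by simp
  finally show ?thesis using shift_rmul_Cons[OF i assms(2,3)] by simp
qed

lemma shift_shift:
  assumes "i \<le> m" "j \<le> m" "x \<in> carrier V"
  shows "shift i (shift j x) = shift ((i + j) mod m) x"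
proof (cases "i + j \<le> m")
  case True
  have "shift i (shift j x) = shift 0 (shift (i + j) x)"
    unfolding shift_def using assms True by (intro lam_lam) (auto simp: ones_add)
  also have "\<dots> = shift ((i + j) mod m) x"
    using assms True by (cases "i + j = m") auto
  finally show ?thesis .
next
  case False
  define k where "k = i + j - m"
  have k: "0 < k" "k \<le> m" "i + j = k + m" using assms False by (auto simp: k_def)
  have "shift i (shift j x) = lam ([] @ tprod (ones (m + 1)) # ones (k - 1), ones (m - j) @ ones (m - i)) x"
    unfolding shift_def using assms k by (intro lam_lam_left) (auto simp: ones_add Cons_ones add.commute simp del: replicate_Suc)
  also have "\<dots> = shift k x"
  proof -
    have "m - j + (m - i) = m - k" using k assms by simp
    then show ?thesis using k(1) tprod_ones[of "m + 1"] by (simp add: shift_def ones_add Cons_ones del: replicate_Suc)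
  qed
  also have "\<dots> = shift (k mod m) x" using k assms by (cases "k = m") auto
  finally show ?thesis using k by simp
qed

end

section \<open>Matrix units on an anchored slot module\<close>

context twisted_nary begin

text \<open>
  The vector \<open>x\<close> stands for the matrix \<open>\<Sum>\<^sub>q x(q) e\<^sub>q\<^sub>+\<^sub>d\<^sub>,\<^sub>q\<close> of the crossed product, which is multiplied by
  \<open>a\<^sub>0 z \<cdots> a\<^sub>i\<^sub>-\<^sub>1 z\<close> on the left and by \<open>a\<^sub>i\<^sub>+\<^sub>1 z \<cdots> a\<^sub>m z\<close> on the right. Modulo \<open>m\<close>, adding \<open>i (m - 1)\<close>
  subtracts \<open>i\<close>.
\<close>

definition std :: "nat \<Rightarrow> (nat \<Rightarrow> 'k) list \<times> (nat \<Rightarrow> 'k) list \<Rightarrow> (nat \<Rightarrow> 'k) \<Rightarrow> nat \<Rightarrow> 'k" where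
  "std d = (\<lambda>(as, bs) x. \<lambda>s\<in>{..<m}.
     tprod as ((s + d) mod m) \<otimes> (tprod bs ((s + length as * (m - 1)) mod m) \<otimes> x ((s + length as * (m - 1)) mod m)))"

lemma std_shift:
  "std d (as, bs) x ((q + length as) mod m)
    = tprod as ((q + length as + d) mod m) \<otimes> (tprod bs (q mod m) \<otimes> x (q mod m))"
proof -
  have "((q + length as) mod m + length as * (m - 1)) mod m = (q + length as + length as * (m - 1)) mod m"
    by (rule mod_add_left_eq)
  also have "q + length as + length as * (m - 1) = q + length as * m"
    using m_pos by (metis add.assoc add.commute mult_Suc_right Suc_diff_1)
  finally have "((q + length as) mod m + length as * (m - 1)) mod m = q mod m" by simp
  moreover have "((q + length as) mod m + d) mod m = (q + length as + d) mod m"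
    by (rule mod_add_left_eq)
  ultimately show ?thesis using m_pos by (simp add: std_def)
qed

lemma T_restrict: "(\<And>t. t < m \<Longrightarrow> f t \<in> carrier R) \<Longrightarrow> (\<lambda>t\<in>{..<m}. f t) \<in> carrier T"
  by (simp add: T_simps)

lemma std_closed [simp, intro]:
  "set as \<subseteq> carrier T \<Longrightarrow> set bs \<subseteq> carrier T \<Longrightarrow> x \<in> carrier T \<Longrightarrow> std d (as, bs) x \<in> carrier T"
  using m_pos by (auto simp: std_def intro!: T_restrict)

end

context anchored_slots begin

lemma lmul_linear:
  assumes "a \<in> carrier T" "b \<in> carrier T" "r \<in> carrier R" "x \<in> carrier V"
  shows "lmul (r \<odot>\<^bsub>T\<^esub> a \<oplus>\<^bsub>T\<^esub> b) x = r \<odot>\<^bsub>V\<^esub> lmul a x \<oplus>\<^bsub>V\<^esub> lmul b x"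
  using lam_left_linear[of "[]" a "ones (m - 1)" "[]" b r x] assms by (simp add: lmul_def)

lemma rmul_linear:
  assumes "a \<in> carrier T" "b \<in> carrier T" "r \<in> carrier R" "x \<in> carrier V"
  shows "rmul (r \<odot>\<^bsub>T\<^esub> a \<oplus>\<^bsub>T\<^esub> b) x = r \<odot>\<^bsub>V\<^esub> rmul a x \<oplus>\<^bsub>V\<^esub> rmul b x"
  using lam_right_linear[of "[]" "[]" a "ones (m - 1)" b r x] assms by (simp add: rmul_def)

text \<open>
  Multilinearity is available in the form \<open>r a + b\<close>; taking \<open>r = 1\<close> and \<open>a = b = 0\<close> shows that \<open>f\<close>
  vanishes at zero, and the two halves of linearity follow.
\<close>

lemma affine_imp_linear:
  assumes closed: "\<And>a. a \<in> carrier T \<Longrightarrow> f a \<in> carrier V"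
    and affine: "\<And>r a b. r \<in> carrier R \<Longrightarrow> a \<in> carrier T \<Longrightarrow> b \<in> carrier T
      \<Longrightarrow> f (r \<odot>\<^bsub>T\<^esub> a \<oplus>\<^bsub>T\<^esub> b) = r \<odot>\<^bsub>V\<^esub> f a \<oplus>\<^bsub>V\<^esub> f b"
  shows "f \<zero>\<^bsub>T\<^esub> = \<zero>\<^bsub>V\<^esub>"
    and "a \<in> carrier T \<Longrightarrow> r \<in> carrier R \<Longrightarrow> f (r \<odot>\<^bsub>T\<^esub> a) = r \<odot>\<^bsub>V\<^esub> f a"
    and "a \<in> carrier T \<Longrightarrow> b \<in> carrier T \<Longrightarrow> f (a \<oplus>\<^bsub>T\<^esub> b) = f a \<oplus>\<^bsub>V\<^esub> f b"
proof -
  show zero: "f \<zero>\<^bsub>T\<^esub> = \<zero>\<^bsub>V\<^esub>"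
    using affine[of \<one> "\<zero>\<^bsub>T\<^esub>" "\<zero>\<^bsub>T\<^esub>"] closed[of "\<zero>\<^bsub>T\<^esub>"] by (simp add: V.M.add.r_cancel_one)
  show "f (r \<odot>\<^bsub>T\<^esub> a) = r \<odot>\<^bsub>V\<^esub> f a" if "a \<in> carrier T" "r \<in> carrier R"
    using affine[of r a "\<zero>\<^bsub>T\<^esub>"] that closed[of a] zero by simp
  show "f (a \<oplus>\<^bsub>T\<^esub> b) = f a \<oplus>\<^bsub>V\<^esub> f b" if "a \<in> carrier T" "b \<in> carrier T"
    using affine[of \<one> a b] that closed by simp
qed

lemma lmul_smult: "a \<in> carrier T \<Longrightarrow> r \<in> carrier R \<Longrightarrow> x \<in> carrier V \<Longrightarrow> lmul (r \<odot>\<^bsub>T\<^esub> a) x = r \<odot>\<^bsub>V\<^esub> lmul a x"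
  and rmul_smult: "a \<in> carrier T \<Longrightarrow> r \<in> carrier R \<Longrightarrow> x \<in> carrier V \<Longrightarrow> rmul (r \<odot>\<^bsub>T\<^esub> a) x = r \<odot>\<^bsub>V\<^esub> rmul a x"
  by (rule affine_imp_linear(2)[of "\<lambda>a. lmul a x"]; simp add: lmul_linear)
     (rule affine_imp_linear(2)[of "\<lambda>a. rmul a x"]; simp add: rmul_linear)

lemma affine_finsum:
  assumes "finite I" "g \<in> I \<rightarrow> carrier T"
    and closed: "\<And>a. a \<in> carrier T \<Longrightarrow> f a \<in> carrier V"
    and affine: "\<And>r a b. r \<in> carrier R \<Longrightarrow> a \<in> carrier T \<Longrightarrow> b \<in> carrier T
      \<Longrightarrow> f (r \<odot>\<^bsub>T\<^esub> a \<oplus>\<^bsub>T\<^esub> b) = r \<odot>\<^bsub>V\<^esub> f a \<oplus>\<^bsub>V\<^esub> f b"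
  shows "f (\<Oplus>\<^bsub>T\<^esub>i\<in>I. g i) = (\<Oplus>\<^bsub>V\<^esub>i\<in>I. f (g i))"
  using assms(1,2)
proof (induction I)
  case empty
  then show ?case using affine_imp_linear(1)[of f, OF closed affine] by simp
next
  case (insert i I)
  then show ?case
    using affine_imp_linear(3)[of f, OF closed affine] closed by (simp add: Pi_iff)
qed

text \<open>
  The idempotents \<open>\<epsilon>\<^sub>t\<close> are a partition of unity of \<open>A\<close>.
\<close>

lemma lmul_eps_sum:
  assumes "x \<in> carrier V"
  shows "(\<Oplus>\<^bsub>V\<^esub>t\<in>{..<m}. lmul (eps R m t) x) = x"
  using affine_finsum[of "{..<m}" "eps R m" "\<lambda>a. lmul a x"] assms
  by (simp add: lmul_linear T_one_expand[symmetric])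

lemma rmul_eps_sum:
  assumes "x \<in> carrier V"
  shows "(\<Oplus>\<^bsub>V\<^esub>t\<in>{..<m}. rmul (eps R m t) x) = x"
  using affine_finsum[of "{..<m}" "eps R m" "\<lambda>a. rmul a x"] assms
  by (simp add: rmul_linear T_one_expand[symmetric])

text \<open>
  The operator \<open>rmul \<epsilon>\<^sub>r\<close> projects to column \<open>r\<close>, the shift by \<open>q - r\<close> moves column \<open>r\<close> to
  column \<open>q\<close>, and \<open>lmul \<epsilon>\<^sub>q\<^sub>+\<^sub>d\<close> projects to the diagonal \<open>d\<close>. Hence on \<open>std d\<close> this is the matrix
  unit at \<open>(q, r)\<close>, and on the other standard modules it is zero (\<open>std_matrix_unit\<close> below).
\<close>

definition matrix_unit :: "nat \<Rightarrow> nat \<Rightarrow> nat \<Rightarrow> 'v \<Rightarrow> 'v" where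
  "matrix_unit d q r x = lmul (eps R m ((q + d) mod m)) (shift ((q + (m - r)) mod m) (rmul (eps R m r) x))"

lemma mod_le_m [simp]: "t mod m \<le> m"
  using m_pos by (simp add: less_imp_le)

lemma matrix_unit_closed [simp]: "x \<in> carrier V \<Longrightarrow> matrix_unit d q r x \<in> carrier V"
  by (simp add: matrix_unit_def)

lemma lam_finsum:
  assumes "p \<in> slot_ops R m" "finite I" "g \<in> I \<rightarrow> carrier V"
  shows "lam p (\<Oplus>\<^bsub>V\<^esub>i\<in>I. g i) = (\<Oplus>\<^bsub>V\<^esub>i\<in>I. lam p (g i))"
  by (rule module_hom_finsum[OF V.module_axioms V.module_axioms lam_hom[OF assms(1)] assms(2,3)])

lemma lmul_V_smult: "a \<in> carrier T \<Longrightarrow> r \<in> carrier R \<Longrightarrow> x \<in> carrier V \<Longrightarrow> lmul a (r \<odot>\<^bsub>V\<^esub> x) = r \<odot>\<^bsub>V\<^esub> lmul a x"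
  and shift_V_smult: "i \<le> m \<Longrightarrow> r \<in> carrier R \<Longrightarrow> x \<in> carrier V \<Longrightarrow> shift i (r \<odot>\<^bsub>V\<^esub> x) = r \<odot>\<^bsub>V\<^esub> shift i x"
  by (simp_all add: lmul_def shift_def lam_smult)

text \<open>
  Slot operations act on the index \<open>q\<close> as on the coordinate vectors of \<open>std d\<close>, with the same scalar;
  \<open>r\<close> is a mere label. This follows from the normal form, since \<open>\<epsilon>\<^sub>t\<close> absorbs every factor from \<open>A\<close>
  into its value at \<open>t\<close>.
\<close>

lemma lam_matrix_unit:
  assumes p: "(as, bs) \<in> slot_ops R m" and q: "q < m" "r < m" and x: "x \<in> carrier V"
  shows "lam (as, bs) (matrix_unit d q r x)
    = (tprod as ((q + length as + d) mod m) \<otimes> tprod bs q) \<odot>\<^bsub>V\<^esub> matrix_unit d ((q + length as) mod m) r x"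
proof -
  define i where "i = length as"
  define j where "j = (q + (m - r)) mod m"
  define w where "w = rmul (eps R m q) (shift j x)"
  have as: "set as \<subseteq> carrier T" "set bs \<subseteq> carrier T" "i \<le> m" using p by (auto simp: slot_ops_def i_def)
  then have P [simp]: "tprod as \<in> carrier T" "tprod bs \<in> carrier T" by auto
  have jm [simp]: "j \<le> m" by (simp add: j_def)
  have [simp]: "w \<in> carrier V" using x by (simp add: w_def)
  \<comment> \<open>\<open>j\<close> represents \<open>q - r\<close>\<close>
  have "(r + j) mod m = (r + (q + (m - r))) mod m" unfolding j_def by (rule mod_add_right_eq)
  also have "r + (q + (m - r)) = q + m" using q by simp
  finally have rj: "(r + j) mod m = q" using q by simp
  have w: "shift j (rmul (eps R m r) x) = w"
    using sigma_pow_eps[of j r] q x rj by (simp add: shift_rmul w_def)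
  have "rmul (tprod bs) (matrix_unit d q r x) = lmul (eps R m ((q + d) mod m)) (rmul (tprod bs) w)"
    by (simp add: matrix_unit_def w lmul_rmul flip: j_def)
  also have "rmul (tprod bs) w = tprod bs q \<odot>\<^bsub>V\<^esub> w"
    using q x by (simp add: w_def rmul_rmul mult_eps rmul_smult)
  finally have "rmul (tprod bs) (matrix_unit d q r x) = tprod bs q \<odot>\<^bsub>V\<^esub> lmul (eps R m ((q + d) mod m)) w"
    using q by (simp add: lmul_V_smult)
  then have "lam (as, bs) (matrix_unit d q r x)
      = tprod bs q \<odot>\<^bsub>V\<^esub> lmul (tprod as) (shift i (lmul (eps R m ((q + d) mod m)) w))"
    using p x q as by (simp add: lam_factor shift_V_smult lmul_V_smult flip: i_def)
  also have "shift i (lmul (eps R m ((q + d) mod m)) w) = lmul (eps R m ((q + d + i) mod m)) (shift i w)"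
    using as by (simp add: shift_lmul sigma_pow_eps)
  also have "lmul (tprod as) \<dots> = tprod as ((q + d + i) mod m) \<odot>\<^bsub>V\<^esub> lmul (eps R m ((q + d + i) mod m)) (shift i w)"
    using as m_pos by (simp add: lmul_lmul mult_eps lmul_smult)
  also have "shift i w = shift ((i + j) mod m) (rmul (eps R m r) x)"
    using x as by (simp add: shift_shift flip: w)
  also have "(i + j) mod m = ((q + i) mod m + (m - r)) mod m"
    unfolding j_def by (metis add.assoc add.commute mod_add_left_eq)
  also have "lmul (eps R m ((q + d + i) mod m)) (shift (((q + i) mod m + (m - r)) mod m) (rmul (eps R m r) x))
      = matrix_unit d ((q + i) mod m) r x"
  proof -
    have "((q + i) mod m + d) mod m = (q + d + i) mod m"
      by (metis add.assoc add.commute mod_add_left_eq)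
    then show ?thesis by (simp add: matrix_unit_def)
  qed
  finally show ?thesis
    using q m_pos x by (simp add: V.smult_assoc1 R.m_comm i_def ac_simps)
qed

text \<open>
  For fixed \<open>q\<close> the index \<open>q + d\<close> runs through \<open>C_m\<close> together with \<open>d\<close>, so both partitions of unity
  apply.
\<close>

theorem matrix_unit_sum:
  assumes "x \<in> carrier V"
  shows "(\<Oplus>\<^bsub>V\<^esub>q\<in>{..<m}. \<Oplus>\<^bsub>V\<^esub>d\<in>{..<m}. matrix_unit d q q x) = x"
proof -
  have "(\<Oplus>\<^bsub>V\<^esub>d\<in>{..<m}. matrix_unit d q q x) = rmul (eps R m q) x" if "q < m" for q
  proof -
    let ?y = "rmul (eps R m q) x"
    have "?y = (\<Oplus>\<^bsub>V\<^esub>t\<in>{..<m}. lmul (eps R m t) ?y)"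
      using assms by (simp add: lmul_eps_sum)
    also have "\<dots> = (\<Oplus>\<^bsub>V\<^esub>d\<in>{..<m}. lmul (eps R m ((d + q) mod m)) ?y)"
      using assms by (intro V.finsum_bij[OF mod_translate_bij]) auto
    also have "\<dots> = (\<Oplus>\<^bsub>V\<^esub>d\<in>{..<m}. matrix_unit d q q x)"
      using assms that by (intro V.finsum_cong') (auto simp: matrix_unit_def add.commute)
    finally show ?thesis by simp
  qed
  then have "(\<Oplus>\<^bsub>V\<^esub>q\<in>{..<m}. \<Oplus>\<^bsub>V\<^esub>d\<in>{..<m}. matrix_unit d q q x) = (\<Oplus>\<^bsub>V\<^esub>q\<in>{..<m}. rmul (eps R m q) x)"
    using assms by (intro V.finsum_cong') auto
  then show ?thesis using assms by (simp add: rmul_eps_sum)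
qed

text \<open>
  Every column index \<open>r\<close> and vector \<open>x\<close> give a homomorphism from \<open>std d\<close>, which sends the coordinate
  vector \<open>\<epsilon>\<^sub>q\<close> to \<open>matrix_unit d q r x\<close>.
\<close>

definition from_std :: "nat \<Rightarrow> nat \<Rightarrow> 'v \<Rightarrow> (nat \<Rightarrow> 'k) \<Rightarrow> 'v" where
  "from_std d r x c = (\<Oplus>\<^bsub>V\<^esub>q\<in>{..<m}. c q \<odot>\<^bsub>V\<^esub> matrix_unit d q r x)"

lemma from_std_closed [simp]: "x \<in> carrier V \<Longrightarrow> c \<in> carrier T \<Longrightarrow> from_std d r x c \<in> carrier V"
  unfolding from_std_def by (intro V.finsum_closed) auto

lemma from_std_eps:
  assumes "x \<in> carrier V" "q < m"
  shows "from_std d r x (eps R m q) = matrix_unit d q r x"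
proof -
  have "from_std d r x (eps R m q) = (\<Oplus>\<^bsub>V\<^esub>s\<in>{..<m}. if q = s then matrix_unit d s r x else \<zero>\<^bsub>V\<^esub>)"
    unfolding from_std_def using assms by (intro V.finsum_cong') (auto simp: eps_app)
  also have "\<dots> = matrix_unit d q r x"
    using assms by (intro V.finsum_singleton) auto
  finally show ?thesis .
qed

theorem from_std_hom:
  assumes x: "x \<in> carrier V" and "r < m"
  shows "from_std d r x \<in> op_hom R (slot_ops R m) T (std d) V lam"
proof -
  have "from_std d r x \<in> module_hom R T V"
    unfolding module_hom_def
  proof (intro CollectI conjI allI impI)
    show "from_std d r x \<in> carrier T \<rightarrow> carrier V" using x by simp
    fix b c assume "b \<in> carrier T \<and> c \<in> carrier T"
    then show "from_std d r x (b \<oplus>\<^bsub>T\<^esub> c) = from_std d r x b \<oplus>\<^bsub>V\<^esub> from_std d r x c"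
    proof -
      assume bc: "b \<in> carrier T \<and> c \<in> carrier T"
      have "from_std d r x (b \<oplus>\<^bsub>T\<^esub> c)
        = (\<Oplus>\<^bsub>V\<^esub>q\<in>{..<m}. b q \<odot>\<^bsub>V\<^esub> matrix_unit d q r x \<oplus>\<^bsub>V\<^esub> c q \<odot>\<^bsub>V\<^esub> matrix_unit d q r x)"
        unfolding from_std_def using x bc
        by (intro V.finsum_cong') (auto simp: T_app V.smult_l_distr)
      also have "\<dots> = from_std d r x b \<oplus>\<^bsub>V\<^esub> from_std d r x c"
        unfolding from_std_def using x bc by (intro V.finsum_addf) auto
      finally show ?thesis .
    qed
  next
    fix a c assume "a \<in> carrier R \<and> c \<in> carrier T"
    then show "from_std d r x (a \<odot>\<^bsub>T\<^esub> c) = a \<odot>\<^bsub>V\<^esub> from_std d r x c"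
      unfolding from_std_def using x
      by (subst V.finsum_smult_ldistr) (auto simp: T_app V.smult_assoc1 intro!: V.finsum_cong')
  qed
  moreover have "from_std d r x (std d p c) = lam p (from_std d r x c)"
    if pc: "p \<in> slot_ops R m" "c \<in> carrier T" for p c
  proof -
    obtain as bs where p: "p = (as, bs)" "set as \<subseteq> carrier T" "set bs \<subseteq> carrier T"
      using pc(1) by (cases p) (auto simp: slot_ops_def)
    define i where "i = length as"
    have "from_std d r x (std d p c)
      = (\<Oplus>\<^bsub>V\<^esub>q\<in>{..<m}. std d p c ((q + i) mod m) \<odot>\<^bsub>V\<^esub> matrix_unit d ((q + i) mod m) r x)"
      unfolding from_std_def using x pc p by (intro V.finsum_bij[OF mod_translate_bij]) auto
    also have "\<dots> = (\<Oplus>\<^bsub>V\<^esub>q\<in>{..<m}. lam p (c q \<odot>\<^bsub>V\<^esub> matrix_unit d q r x))"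
    proof (intro V.finsum_cong')
      show "(\<lambda>q. lam p (c q \<odot>\<^bsub>V\<^esub> matrix_unit d q r x)) \<in> {..<m} \<rightarrow> carrier V" using x pc by auto
      fix q assume "q \<in> {..<m}"
      then have q: "q < m" by simp
      have [simp]: "tprod as ((q + i + d) mod m) \<in> carrier R" "tprod bs q \<in> carrier R" "c q \<in> carrier R"
        using p pc q by auto
      have "lam p (c q \<odot>\<^bsub>V\<^esub> matrix_unit d q r x)
        = c q \<odot>\<^bsub>V\<^esub> ((tprod as ((q + i + d) mod m) \<otimes> tprod bs q) \<odot>\<^bsub>V\<^esub> matrix_unit d ((q + i) mod m) r x)"
        using pc p(1) q x assms(2) by (simp add: lam_smult lam_matrix_unit i_def)
      also have "\<dots> = (tprod as ((q + i + d) mod m) \<otimes> (tprod bs q \<otimes> c q)) \<odot>\<^bsub>V\<^esub> matrix_unit d ((q + i) mod m) r x"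
        using x by (simp add: R.m_ac flip: V.smult_assoc1)
      finally show "std d p c ((q + i) mod m) \<odot>\<^bsub>V\<^esub> matrix_unit d ((q + i) mod m) r x = lam p (c q \<odot>\<^bsub>V\<^esub> matrix_unit d q r x)"
        using std_shift[of d as bs c q] q p(1) by (simp add: i_def)
    qed simp
    also have "\<dots> = lam p (from_std d r x c)"
      unfolding from_std_def using x pc by (subst lam_finsum) auto
    finally show ?thesis .
  qed
  ultimately show ?thesis by (simp add: op_hom_def)
qed

end

section \<open>The standard modules are anchored slot modules\<close>

text \<open>
  The word of leaves, with \<open>None\<close> for the hole. Rebracketing does not change it, so an evaluation that
  depends only on the word is totally associative.
\<close>

fun frontier :: "'a tree \<Rightarrow> 'a option list" where
  "frontier Hole = [None]"
| "frontier (Leaf a) = [Some a]"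
| "frontier (Node ts) = concat (map frontier ts)"

lemma frame_frontier: "K \<in> frames \<Longrightarrow> frontier s = frontier t \<Longrightarrow> frontier (K s) = frontier (K t)"
  by (induction rule: frames.induct) auto

lemma frontier_bracket: "frontier (bracket m i ws) = concat (map frontier ws)"
proof -
  have "ws = take i ws @ take (m + 1) (drop i ws) @ drop (i + (m + 1)) ws"
    by (metis append_take_drop_id drop_drop add.commute)
  then have "map frontier ws = map frontier (take i ws) @ map frontier (take (m + 1) (drop i ws))
      @ map frontier (drop (i + (m + 1)) ws)"
    by (metis map_append)
  then show ?thesis by (simp add: bracket_def)
qed

lemma map_Some_None_unique:
  "map Some us @ None # map Some vs = map Some us' @ None # map Some vs' \<Longrightarrow> us = us' \<and> vs = vs'"
proof (induction us arbitrary: us')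
  case Nil
  then show ?case by (cases us') (auto simp: inj_map_eq_map)
next
  case (Cons u us)
  then show ?case by (cases us') auto
qed

context twisted_nary begin

lemma assoc_moves_contexts:
  assumes "(C, D) \<in> assoc_moves R m"
  shows "C \<in> contexts R m" "D \<in> contexts R m"
proof -
  from assms obtain K ws i j where *: "C = K (bracket m i ws)" "D = K (bracket m j ws)" "K \<in> frames"
    "length ws = 2 * m + 1" "i \<le> m" "j \<le> m" "K (bracket m i ws) \<in> contexts R m"
    by (auto simp: assoc_moves_def)
  then have "full (bracket m i ws)" by (auto simp: contexts_iff intro: frame_full_inner)
  then have "\<forall>w\<in>set (take i ws @ take (m + 1) (drop i ws) @ drop (i + (m + 1)) ws). full w"
    by (auto simp: bracket_def)
  moreover have "ws = take i ws @ take (m + 1) (drop i ws) @ drop (i + (m + 1)) ws"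
    by (metis append_take_drop_id drop_drop add.commute)
  ultimately have "\<forall>w\<in>set ws. full w" by metis
  then have "full (bracket m j ws)" using * by (intro full_bracket) auto
  with * show "C \<in> contexts R m" "D \<in> contexts R m"
    by (auto intro: frame_context simp: holes_bracket)
qed

lemma assoc_moves_frontier: "(C, D) \<in> assoc_moves R m \<Longrightarrow> frontier C = frontier D"
  by (auto simp: assoc_moves_def frontier_bracket intro: frame_frontier)

lemma std_app:
  "s < m \<Longrightarrow> std d (as, bs) x s
    = tprod as ((s + d) mod m) \<otimes> (tprod bs ((s + length as * (m - 1)) mod m) \<otimes> x ((s + length as * (m - 1)) mod m))"
  by (simp add: std_def)

text \<open>
  A hole-free tree evaluates to the twisted product of its leaves. Its number of leaves is \<open>1\<close> modulo
  \<open>m\<close>, which is why the value again behaves as a single letter.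
\<close>

definition reads_as :: "(nat \<Rightarrow> 'k) tree \<Rightarrow> (nat \<Rightarrow> 'k) list \<Rightarrow> bool" where
  "reads_as t us \<longleftrightarrow> frontier t = map Some us \<and> set us \<subseteq> carrier T \<and> length us mod m = 1 mod m
     \<and> scalar_value t = tprod us"

lemma reads_as_list:
  assumes "\<And>t. t \<in> set ts \<Longrightarrow> \<exists>us. reads_as t us"
  shows "\<exists>us. concat (map frontier ts) = map Some us \<and> set us \<subseteq> carrier T
    \<and> length us mod m = length ts mod m \<and> tprod (map scalar_value ts) = tprod us"
  using assms
proof (induction ts)
  case (Cons t ts)
  then obtain us vs where us: "reads_as t us"
    and vs: "concat (map frontier ts) = map Some vs" "set vs \<subseteq> carrier T"
      "length vs mod m = length ts mod m" "tprod (map scalar_value ts) = tprod vs"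
    by (metis list.set_intros(1,2))
  have "tprod (map scalar_value (t # ts)) = tprod us \<otimes>\<^bsub>T\<^esub> (sigma m ^^ 1) (tprod vs)"
    using us vs by (simp add: reads_as_def)
  also have "(sigma m ^^ 1) (tprod vs) = (sigma m ^^ length us) (tprod vs)"
    using us vs by (intro sigma_pow_cong) (auto simp: reads_as_def)
  also have "tprod us \<otimes>\<^bsub>T\<^esub> \<dots> = tprod (us @ vs)"
    using us vs by (simp add: tprod_append reads_as_def)
  finally have "tprod (map scalar_value (t # ts)) = tprod (us @ vs)" .
  moreover have "length (us @ vs) mod m = length (t # ts) mod m"
    using us vs mod_add_cong[of "length us" m 1 "length vs" "length ts"] by (simp add: reads_as_def)
  ultimately show ?case
    using us vs by (intro exI[of _ "us @ vs"]) (simp add: reads_as_def)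
qed auto

lemma scalar_tree_reads_as: "t \<in> scalar_trees \<Longrightarrow> \<exists>us. reads_as t us"
proof (induction t)
  case (Leaf a)
  then have "reads_as (Leaf a) [a]"
    using sigma_pow_one[of 1] by (simp add: reads_as_def)
  then show ?case ..
next
  case (Node ts)
  then have "\<exists>us. concat (map frontier ts) = map Some us \<and> set us \<subseteq> carrier T
    \<and> length us mod m = length ts mod m \<and> tprod (map scalar_value ts) = tprod us"
    by (intro reads_as_list) auto
  then obtain us where us: "concat (map frontier ts) = map Some us" "set us \<subseteq> carrier T"
    "length us mod m = length ts mod m" "tprod (map scalar_value ts) = tprod us" by blast
  have "set (map scalar_value ts) \<subseteq> carrier T" "length (map scalar_value ts) = m + 1"
    using Node.prems scalar_values_closed by (simp_all del: set_map)
  then have "scalar_value (Node ts) = tprod us"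
    using us(4) by (simp only: scalar_value.simps mu_eq_tprod)
  moreover have "length us mod m = 1 mod m"
    using us(3) Node.prems by (metis add.commute mod_add_self2 scalar_tree_Node)
  ultimately have "reads_as (Node ts) us"
    using us(1,2) by (simp add: reads_as_def)
  then show ?case ..
qed (simp add: scalar_trees_def)

lemma std_cong:
  assumes "tprod as = tprod as'" "tprod bs = tprod bs'" "length as mod m = length as' mod m"
  shows "std d (as, bs) x = std d (as', bs') x"
proof -
  have "(s + length as * (m - 1)) mod m = (s + length as' * (m - 1)) mod m" for s
    using assms(3) by (intro mod_add_cong mod_mult_cong) auto
  then show ?thesis using assms by (simp add: std_def)
qed

text \<open>
  Words compose by concatenation. The word \<open>cs\<close> together with \<open>ds\<close> has length divisible by \<open>m\<close>, and hence the
  letters of \<open>bs\<close> are evaluated at the same places on both sides.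
\<close>

lemma std_std:
  assumes "set as \<subseteq> carrier T" "set bs \<subseteq> carrier T" "set cs \<subseteq> carrier T" "set ds \<subseteq> carrier T"
    "x \<in> carrier T" "(length cs + length ds) mod m = 0"
  shows "std d (as, bs) (std d (cs, ds) x) = std d (as @ cs, ds @ bs) x"
proof (rule T_ext_shift[where i = "length cs + length as"])
  fix q assume q: "q < m"
  let ?c = "length cs" and ?a = "length as"
  have P: "tprod us (t mod m) \<in> carrier R" if "set us \<subseteq> carrier T" for us t
    using that by auto
  have "std d (as, bs) (std d (cs, ds) x) ((q + (?c + ?a)) mod m)
    = tprod as ((q + ?c + ?a + d) mod m) \<otimes> (tprod bs ((q + ?c) mod m) \<otimes> std d (cs, ds) x ((q + ?c) mod m))"
    using std_shift[of d as bs "std d (cs, ds) x" "q + ?c"] by (simp add: add.assoc)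
  also have "std d (cs, ds) x ((q + ?c) mod m)
    = tprod cs ((q + ?c + d) mod m) \<otimes> (tprod ds (q mod m) \<otimes> x (q mod m))"
    by (rule std_shift)
  finally have lhs: "std d (as, bs) (std d (cs, ds) x) ((q + (?c + ?a)) mod m)
    = (tprod as ((q + ?c + ?a + d) mod m) \<otimes> tprod cs ((q + ?c + d) mod m))
      \<otimes> ((tprod ds (q mod m) \<otimes> tprod bs ((q + ?c) mod m)) \<otimes> x (q mod m))"
    using P assms by (simp add: R.m_ac)
  have "tprod (as @ cs) ((q + ?c + d + ?a) mod m) = tprod as ((q + ?c + d + ?a) mod m) \<otimes> tprod cs ((q + ?c + d) mod m)"
    using assms by (intro tprod_app_append)
  then have L: "tprod (as @ cs) ((q + (?c + ?a) + d) mod m) = tprod as ((q + ?c + ?a + d) mod m) \<otimes> tprod cs ((q + ?c + d) mod m)"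
    by (simp add: ac_simps)
  have "(q + ?c + length ds) mod m = (q + (?c + length ds) mod m) mod m"
    unfolding add.assoc by (rule mod_add_right_eq[symmetric])
  then have qq: "(q + ?c + length ds) mod m = q mod m" using assms(6) by simp
  have "tprod (ds @ bs) ((q + ?c + length ds) mod m)
    = tprod ds ((q + ?c + length ds) mod m) \<otimes> tprod bs ((q + ?c) mod m)"
    using assms by (intro tprod_app_append)
  then have Rr: "tprod (ds @ bs) (q mod m) = tprod ds (q mod m) \<otimes> tprod bs ((q + ?c) mod m)"
    by (simp only: qq)
  show "std d (as, bs) (std d (cs, ds) x) ((q + (?c + ?a)) mod m) = std d (as @ cs, ds @ bs) x ((q + (?c + ?a)) mod m)"
    using std_shift[of d "as @ cs" "ds @ bs" x q] by (simp add: lhs L Rr add.commute[of "?a" "?c"])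
qed (use assms in auto)

lemma std_trivial: "x \<in> carrier T \<Longrightarrow> std d ([], []) x = x"
  by (rule T_ext) (auto simp: std_app T_app)

text \<open>
  A context acts on \<open>std d\<close> through its word of leaves alone.
\<close>

lemma ctx_op_std:
  assumes "C \<in> contexts R m"
  shows "\<exists>us vs. frontier C = map Some us @ None # map Some vs \<and> set us \<subseteq> carrier T \<and> set vs \<subseteq> carrier T
    \<and> (length us + length vs) mod m = 0 \<and> (\<forall>x\<in>carrier T. ctx_op (std d) C x = std d (us, vs) x)"
  using assms
proof (induction rule: context_induct)
  case Hole
  show ?case by (intro exI[of _ "[]"]) (simp add: std_trivial)
next
  case (Node ls t rs)
  from Node.IH obtain us vs where t: "frontier t = map Some us @ None # map Some vs" "set us \<subseteq> carrier T" "set vs \<subseteq> carrier T"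
    "(length us + length vs) mod m = 0" "\<forall>x\<in>carrier T. ctx_op (std d) t x = std d (us, vs) x"
    by (elim exE conjE) (rule that)
  obtain as where as: "concat (map frontier ls) = map Some as" "set as \<subseteq> carrier T"
    "length as mod m = length ls mod m" "tprod (map scalar_value ls) = tprod as"
    using reads_as_list[of ls] scalar_tree_reads_as Node.hyps(1) by (metis subsetD)
  obtain bs where bs: "concat (map frontier rs) = map Some bs" "set bs \<subseteq> carrier T"
    "length bs mod m = length rs mod m" "tprod (map scalar_value rs) = tprod bs"
    using reads_as_list[of rs] scalar_tree_reads_as Node.hyps(3) by (metis subsetD)
  have "(length as + length bs) mod m = (length ls + length rs) mod m"
    using as(3) bs(3) by (rule mod_add_cong)
  then have "(length as + length bs) mod m = 0" using Node.hyps(4) by simp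
  then have "(length as + length bs + (length us + length vs)) mod m = 0"
    using t(4) by (metis mod_0 mod_add_cong add_0)
  then have len: "(length (as @ us) + length (vs @ bs)) mod m = 0" by (simp add: ac_simps)
  have "ctx_op (std d) (Node (ls @ t # rs)) x = std d (as @ us, vs @ bs) x" if "x \<in> carrier T" for x
  proof -
    have "ctx_op (std d) (Node (ls @ t # rs)) x = std d (map scalar_value ls, map scalar_value rs) (std d (us, vs) x)"
      using Node.hyps that t(5) by (simp add: ctx_op_Node)
    also have "\<dots> = std d (as, bs) (std d (us, vs) x)"
      using as bs by (intro std_cong) auto
    finally show ?thesis using that as bs t by (simp add: std_std)
  qed
  then show ?case
    using len as(1,2) bs(1,2) t(1-3) by (intro exI[of _ "as @ us"] exI[of _ "vs @ bs"]) simp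
qed

lemma std_module_hom:
  assumes slot: "p \<in> slot_ops R m"
  shows "std d p \<in> module_hom R T T"
proof -
  obtain as bs where p: "p = (as, bs)" "set as \<subseteq> carrier T" "set bs \<subseteq> carrier T"
    using assms by (cases p) (auto simp: slot_ops_def)
  have P: "tprod us (t mod m) \<in> carrier R" if "set us \<subseteq> carrier T" for us t
    using that by auto
  show ?thesis
    unfolding module_hom_def p(1)
  proof (intro CollectI conjI allI impI)
    show "std d (as, bs) \<in> carrier T \<rightarrow> carrier T" using p by auto
    fix x y assume "x \<in> carrier T \<and> y \<in> carrier T"
    then show "std d (as, bs) (x \<oplus>\<^bsub>T\<^esub> y) = std d (as, bs) x \<oplus>\<^bsub>T\<^esub> std d (as, bs) y"
      using p P m_pos by (intro T_ext) (auto simp: std_app T_app R.r_distr)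
  next
    fix r x assume "r \<in> carrier R \<and> x \<in> carrier T"
    then show "std d (as, bs) (r \<odot>\<^bsub>T\<^esub> x) = r \<odot>\<^bsub>T\<^esub> std d (as, bs) x"
      using p P m_pos by (intro T_ext) (auto simp: std_app T_app R.m_ac)
  qed
qed

lemma std_slot_linear:
  assumes "set as \<subseteq> carrier T" "set bs \<subseteq> carrier T" "r \<in> carrier R" "a \<in> carrier T" "b \<in> carrier T" "x \<in> carrier T"
  shows "i < length as \<Longrightarrow> std d (as[i := r \<odot>\<^bsub>T\<^esub> a \<oplus>\<^bsub>T\<^esub> b], bs) x
      = r \<odot>\<^bsub>T\<^esub> std d (as[i := a], bs) x \<oplus>\<^bsub>T\<^esub> std d (as[i := b], bs) x"
    and "i < length bs \<Longrightarrow> std d (as, bs[i := r \<odot>\<^bsub>T\<^esub> a \<oplus>\<^bsub>T\<^esub> b]) x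
      = r \<odot>\<^bsub>T\<^esub> std d (as, bs[i := a]) x \<oplus>\<^bsub>T\<^esub> std d (as, bs[i := b]) x"
proof -
  have P: "tprod us (t mod m) \<in> carrier R" if "set us \<subseteq> carrier T" for us t
    using that by auto
  have upd: "tprod (us[i := r \<odot>\<^bsub>T\<^esub> a \<oplus>\<^bsub>T\<^esub> b]) = r \<odot>\<^bsub>T\<^esub> tprod (us[i := a]) \<oplus>\<^bsub>T\<^esub> tprod (us[i := b])"
    if "set us \<subseteq> carrier T" "i < length us" for us
    using that assms set_take_subset[of i us] set_drop_subset[of "Suc i" us]
    by (simp add: upd_conv_take_nth_drop tprod_linear)
  have sub: "set (us[i := c]) \<subseteq> carrier T" if "set us \<subseteq> carrier T" "c \<in> carrier T" for us c
    using that set_update_subset_insert[of us i c] by auto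
  show "std d (as[i := r \<odot>\<^bsub>T\<^esub> a \<oplus>\<^bsub>T\<^esub> b], bs) x
      = r \<odot>\<^bsub>T\<^esub> std d (as[i := a], bs) x \<oplus>\<^bsub>T\<^esub> std d (as[i := b], bs) x" if "i < length as"
    using that assms upd[of as] sub P m_pos
    by (intro T_ext) (auto simp: std_app T_app R.l_distr R.r_distr R.m_ac)
  show "std d (as, bs[i := r \<odot>\<^bsub>T\<^esub> a \<oplus>\<^bsub>T\<^esub> b]) x
      = r \<odot>\<^bsub>T\<^esub> std d (as, bs[i := a]) x \<oplus>\<^bsub>T\<^esub> std d (as, bs[i := b]) x" if "i < length bs"
    using that assms upd[of bs] sub P m_pos
    by (intro T_ext) (auto simp: std_app T_app R.l_distr R.r_distr R.m_ac)
qed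

theorem std_anchored: "anchored_slot_module R m T (std d)"
  unfolding anchored_slot_module_def slot_module_def
proof (intro conjI ballI)
  show "module R T" by (rule T_module)
  show "std d p \<in> module_hom R T T" if "p \<in> slot_ops R m" for p
    using that by (rule std_module_hom)
  fix p assume "p \<in> slot_ops R m"
  then obtain as bs where [simp]: "p = (as, bs)" and *: "set as \<subseteq> carrier T" "set bs \<subseteq> carrier T"
    by (cases p) (auto simp: slot_ops_def)
  show "case p of (as, bs) \<Rightarrow> \<forall>r\<in>carrier R. \<forall>a\<in>carrier T. \<forall>b\<in>carrier T. \<forall>x\<in>carrier T.
          (\<forall>i<length as. std d (as[i := r \<odot>\<^bsub>T\<^esub> a \<oplus>\<^bsub>T\<^esub> b], bs) x
             = r \<odot>\<^bsub>T\<^esub> std d (as[i := a], bs) x \<oplus>\<^bsub>T\<^esub> std d (as[i := b], bs) x)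
        \<and> (\<forall>i<length bs. std d (as, bs[i := r \<odot>\<^bsub>T\<^esub> a \<oplus>\<^bsub>T\<^esub> b]) x
             = r \<odot>\<^bsub>T\<^esub> std d (as, bs[i := a]) x \<oplus>\<^bsub>T\<^esub> std d (as, bs[i := b]) x)"
    using * by (auto simp: std_slot_linear)
next
  fix p assume p: "p \<in> assoc_moves R m"
  obtain C D where [simp]: "p = (C, D)" by (cases p)
  have C: "C \<in> contexts R m" "D \<in> contexts R m" "frontier C = frontier D"
    using p assoc_moves_contexts assoc_moves_frontier by auto
  have "ctx_op (std d) C x = ctx_op (std d) D x" if "x \<in> carrier T" for x
    using ctx_op_std[OF C(1), of d] ctx_op_std[OF C(2), of d] that C(3) map_Some_None_unique by (metis (no_types, lifting))
  then show "case p of (C, D) \<Rightarrow> \<forall>x\<in>carrier T. tree_value (mu R m) (std d) x C = tree_value (mu R m) (std d) x D"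
    using C by (simp add: tree_value_context)
next
  fix x assume x: "x \<in> carrier T"
  show "std d ([], replicate m \<one>\<^bsub>T\<^esub>) x = x"
    using x by (intro T_ext) (auto simp: std_app T_app)
  show "std d (replicate m \<one>\<^bsub>T\<^esub>, []) x = x"
  proof (rule T_ext_shift[where i = m])
    fix q assume "q < m"
    then show "std d (replicate m \<one>\<^bsub>T\<^esub>, []) x ((q + m) mod m) = x ((q + m) mod m)"
      using std_shift[of d "replicate m \<one>\<^bsub>T\<^esub>" "[]" x q] x m_pos by (simp add: T_app)
  qed (use x in auto)
qed

end

sublocale twisted_nary \<subseteq> std: anchored_slots R m "T_alg R m" "std d" for d
  by unfold_locales (rule std_anchored)

context twisted_nary begin

text \<open>
  The three factors of \<open>matrix_unit\<close> are evaluated one after the other: \<open>x\<close> is reduced to its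
  coordinate at \<open>r\<close>, this coordinate is moved to \<open>q\<close>, and it survives only on the right diagonal.
\<close>

lemma std_matrix_unit:
  assumes "d < m" "q < m" "r < m" "d' < m" "x \<in> carrier T"
  shows "std.matrix_unit d' d q r x = (if d = d' then x r \<odot>\<^bsub>T\<^esub> eps R m q else \<zero>\<^bsub>T\<^esub>)"
proof -
  define j where "j = (q + (m - r)) mod m"
  have jm: "j \<le> m" by (simp add: j_def)
  have [simp]: "x r \<in> carrier R" using assms by simp
  have "(r + j) mod m = (r + (q + (m - r))) mod m" unfolding j_def by (rule mod_add_right_eq)
  also have "r + (q + (m - r)) = q + m" using assms by simp
  finally have rj: "(r + j) mod m = q" using assms by simp
  have R1: "std.rmul d' (eps R m r) x = x r \<odot>\<^bsub>T\<^esub> eps R m r"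
    unfolding std.rmul_def using assms
    by (intro T_ext) (auto simp: std_app T_app eps_app std.tprod_single R.m_ac simp del: tprod.simps(2))
  have R2: "std.shift d' j (x r \<odot>\<^bsub>T\<^esub> eps R m r) = x r \<odot>\<^bsub>T\<^esub> eps R m q"
  proof (rule T_ext_shift[where i = j])
    fix s assume s: "s < m"
    have "(s + j) mod m = q \<longleftrightarrow> s = r"
      using mod_add_cancel[of s j m r] s assms rj by auto
    then show "std.shift d' j (x r \<odot>\<^bsub>T\<^esub> eps R m r) ((s + j) mod m) = (x r \<odot>\<^bsub>T\<^esub> eps R m q) ((s + j) mod m)"
      using std_shift[of d' "replicate j \<one>\<^bsub>T\<^esub>" "replicate (m - j) \<one>\<^bsub>T\<^esub>" "x r \<odot>\<^bsub>T\<^esub> eps R m r" s] s m_pos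
      by (simp add: std.shift_def T_app eps_app)
  qed (use jm in auto)
  have e: "(d' + (m + q)) mod m = (d + q) mod m \<longleftrightarrow> d = d'"
  proof -
    have "(d' + (m + q)) mod m = (d' + q) mod m"
      by (metis add.assoc add.commute mod_add_self2)
    then show ?thesis using mod_add_cancel[of d q m d'] assms by auto
  qed
  have "std.lmul d' (eps R m ((q + d) mod m)) (x r \<odot>\<^bsub>T\<^esub> eps R m q) = (if d = d' then x r \<odot>\<^bsub>T\<^esub> eps R m q else \<zero>\<^bsub>T\<^esub>)"
  proof (rule T_ext_shift[where i = m])
    fix s assume s: "s < m"
    show "std.lmul d' (eps R m ((q + d) mod m)) (x r \<odot>\<^bsub>T\<^esub> eps R m q) ((s + m) mod m)
      = (if d = d' then x r \<odot>\<^bsub>T\<^esub> eps R m q else \<zero>\<^bsub>T\<^esub>) ((s + m) mod m)"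
      using std_shift[of d' "eps R m ((q + d) mod m) # replicate (m - 1) \<one>\<^bsub>T\<^esub>" "[]" "x r \<odot>\<^bsub>T\<^esub> eps R m q" s] s m_pos e
      by (cases "s = q") (auto simp: std.lmul_def T_app eps_app std.tprod_single ac_simps simp del: tprod.simps(2))
  qed auto
  then show ?thesis
    by (simp add: std.matrix_unit_def R1 R2 flip: j_def)
qed

end

section \<open>The grafting algebra of contexts\<close>

context twisted_nary begin

abbreviation "Ctx \<equiv> ctx_alg R m"

lemma Ctx_iff:
  "f \<in> carrier Ctx \<longleftrightarrow> (\<forall>C\<in>contexts R m. f C \<in> carrier R) \<and> (\<forall>C. C \<notin> contexts R m \<longrightarrow> f C = \<zero>)
     \<and> finite {C. f C \<noteq> \<zero>}"
  by (simp add: ctx_alg_def)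

lemma Ctx_simps:
  "\<one>\<^bsub>Ctx\<^esub> = (\<lambda>C. if C = Hole then \<one> else \<zero>)"
  "\<zero>\<^bsub>Ctx\<^esub> = (\<lambda>_. \<zero>)"
  "f \<oplus>\<^bsub>Ctx\<^esub> g = (\<lambda>C. f C \<oplus> g C)"
  "r \<odot>\<^bsub>Ctx\<^esub> f = (\<lambda>C. r \<otimes> f C)"
  by (simp_all add: ctx_alg_def)

lemma Ctx_val [simp]: "f \<in> carrier Ctx \<Longrightarrow> f C \<in> carrier R"
  by (cases "C \<in> contexts R m") (auto simp: Ctx_iff)

lemma Ctx_supp: "f \<in> carrier Ctx \<Longrightarrow> finite {C. f C \<noteq> \<zero>}" "f \<in> carrier Ctx \<Longrightarrow> {C. f C \<noteq> \<zero>} \<subseteq> contexts R m"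
  by (auto simp: Ctx_iff)

lemma Ctx_intro:
  assumes "\<And>C. C \<in> contexts R m \<Longrightarrow> f C \<in> carrier R" "\<And>C. C \<notin> X \<Longrightarrow> f C = \<zero>" "finite X" "X \<subseteq> contexts R m"
  shows "f \<in> carrier Ctx"
  using assms finite_subset[of "{C. f C \<noteq> \<zero>}" X] by (auto simp: Ctx_iff)

definition ctx_monom :: "'k \<Rightarrow> (nat \<Rightarrow> 'k) tree \<Rightarrow> (nat \<Rightarrow> 'k) tree \<Rightarrow> 'k" where
  "ctx_monom r C = (\<lambda>D. if D = C then r else \<zero>)"

lemma ctx_monom_closed [simp, intro]: "r \<in> carrier R \<Longrightarrow> C \<in> contexts R m \<Longrightarrow> ctx_monom r C \<in> carrier Ctx"
  by (rule Ctx_intro[where X = "{C}"]) (auto simp: ctx_monom_def)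

lemma ctx_elt_monom: "ctx_elt R C = ctx_monom \<one> C"
  by (simp add: ctx_elt_def ctx_monom_def)

lemma ctx_elt_closed [simp, intro]: "C \<in> contexts R m \<Longrightarrow> ctx_elt R C \<in> carrier Ctx"
  by (simp add: ctx_elt_monom)

lemma Ctx_one_elt: "\<one>\<^bsub>Ctx\<^esub> = ctx_elt R Hole"
  by (simp add: Ctx_simps ctx_elt_def)

lemma Ctx_add_closed [simp, intro]:
  assumes "f \<in> carrier Ctx" "g \<in> carrier Ctx" shows "f \<oplus>\<^bsub>Ctx\<^esub> g \<in> carrier Ctx"
  unfolding Ctx_simps using assms Ctx_supp[OF assms(1)] Ctx_supp[OF assms(2)]
  by (intro Ctx_intro[where X = "{C. f C \<noteq> \<zero>} \<union> {C. g C \<noteq> \<zero>}"]) auto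

lemma Ctx_smult_closed [simp, intro]:
  assumes "f \<in> carrier Ctx" "r \<in> carrier R" shows "r \<odot>\<^bsub>Ctx\<^esub> f \<in> carrier Ctx"
  unfolding Ctx_simps using assms Ctx_supp[OF assms(1)]
  by (intro Ctx_intro[where X = "{C. f C \<noteq> \<zero>}"]) auto

lemma Ctx_zero_closed [simp, intro]: "\<zero>\<^bsub>Ctx\<^esub> \<in> carrier Ctx"
  unfolding Ctx_simps by (intro Ctx_intro[where X = "{}"]) auto

lemma Ctx_abelian_group: "abelian_group Ctx"
proof (rule abelian_groupI)
  fix f assume f: "f \<in> carrier Ctx"
  show "\<exists>g\<in>carrier Ctx. g \<oplus>\<^bsub>Ctx\<^esub> f = \<zero>\<^bsub>Ctx\<^esub>"
  proof
    show "(\<ominus> \<one>) \<odot>\<^bsub>Ctx\<^esub> f \<in> carrier Ctx" using f by simp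
    show "(\<ominus> \<one>) \<odot>\<^bsub>Ctx\<^esub> f \<oplus>\<^bsub>Ctx\<^esub> f = \<zero>\<^bsub>Ctx\<^esub>"
      using f by (auto simp: Ctx_simps fun_eq_iff R.l_minus R.l_neg)
  qed
qed (auto simp: Ctx_simps(2,3)[THEN fun_cong] fun_eq_iff R.a_ac)

text \<open>
  Multiples of single contexts span.
\<close>

lemma Ctx_induct [consumes 1, case_names zero add]:
  assumes f: "f \<in> carrier Ctx" and zero: "P \<zero>\<^bsub>Ctx\<^esub>"
    and add: "\<And>r C g. r \<in> carrier R \<Longrightarrow> C \<in> contexts R m \<Longrightarrow> g \<in> carrier Ctx \<Longrightarrow> P g \<Longrightarrow> P (ctx_monom r C \<oplus>\<^bsub>Ctx\<^esub> g)"
  shows "P f"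
proof -
  have "P f" if "finite X" "X \<subseteq> contexts R m" "f \<in> carrier Ctx" "{C. f C \<noteq> \<zero>} \<subseteq> X" for X f
    using that
  proof (induction X arbitrary: f)
    case empty
    then have "f = \<zero>\<^bsub>Ctx\<^esub>" by (auto simp: Ctx_simps)
    then show ?case using zero by simp
  next
    case (insert C X)
    define g where "g = f(C := \<zero>)"
    have g: "g \<in> carrier Ctx"
      using insert by (intro Ctx_intro[where X = X]) (auto simp: g_def)
    moreover have "{C. g C \<noteq> \<zero>} \<subseteq> X" using insert.prems by (auto simp: g_def)
    then have "P g" using insert.prems g by (intro insert.IH) auto
    moreover have "f = ctx_monom (f C) C \<oplus>\<^bsub>Ctx\<^esub> g"
      using insert.prems by (auto simp: Ctx_simps ctx_monom_def g_def fun_eq_iff)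
    moreover have "f C \<in> carrier R" using insert.prems by simp
    ultimately show ?case using insert.prems add[of "f C" C g] by simp
  qed
  then show ?thesis using f Ctx_supp[OF f] by blast
qed

text \<open>
  The index set of the sum that defines the product depends on the supports of the factors. Summing over
  any larger finite rectangle gives the same value, and bilinearity becomes visible.
\<close>

lemma Ctx_mult_app:
  assumes "f \<in> carrier Ctx" "g \<in> carrier Ctx" "finite X" "finite Y" "{C. f C \<noteq> \<zero>} \<subseteq> X" "{C. g C \<noteq> \<zero>} \<subseteq> Y"
  shows "(f \<otimes>\<^bsub>Ctx\<^esub> g) E = (\<Oplus>p\<in>X \<times> Y. if graft (fst p) (snd p) = E then f (fst p) \<otimes> g (snd p) else \<zero>)"
proof -
  let ?Z = "{(C, D). f C \<noteq> \<zero> \<and> g D \<noteq> \<zero> \<and> graft C D = E}"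
  have "(f \<otimes>\<^bsub>Ctx\<^esub> g) E = (\<Oplus>p\<in>?Z. f (fst p) \<otimes> g (snd p))"
    by (simp only: ctx_alg_def monoid.select_convs)
  also have "\<dots> = (\<Oplus>p\<in>X \<times> Y. if graft (fst p) (snd p) = E then f (fst p) \<otimes> g (snd p) else \<zero>)"
  proof (rule R.add.finprod_mono_neutral_cong_left)
    show "finite (X \<times> Y)" using assms by simp
    show "?Z \<subseteq> X \<times> Y" using assms by auto
    fix p assume "p \<in> X \<times> Y - ?Z"
    then show "(if graft (fst p) (snd p) = E then f (fst p) \<otimes> g (snd p) else \<zero>) = \<zero>"
      using assms(1,2) by (cases p) auto
  qed (use assms in auto)
  finally show ?thesis .
qed

lemma Ctx_mult_monom:
  assumes "r \<in> carrier R" "s \<in> carrier R" "C \<in> contexts R m" "D \<in> contexts R m"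
  shows "ctx_monom r C \<otimes>\<^bsub>Ctx\<^esub> ctx_monom s D = ctx_monom (r \<otimes> s) (graft C D)"
proof
  fix E
  have "(ctx_monom r C \<otimes>\<^bsub>Ctx\<^esub> ctx_monom s D) E
    = (\<Oplus>p\<in>{C} \<times> {D}. if graft (fst p) (snd p) = E then ctx_monom r C (fst p) \<otimes> ctx_monom s D (snd p) else \<zero>)"
    by (intro Ctx_mult_app ctx_monom_closed assms) (auto simp: ctx_monom_def)
  also have "{C} \<times> {D} = {(C, D)}" by auto
  also have "(\<Oplus>p\<in>{(C, D)}. if graft (fst p) (snd p) = E then ctx_monom r C (fst p) \<otimes> ctx_monom s D (snd p) else \<zero>)
    = ctx_monom (r \<otimes> s) (graft C D) E"
    using assms by (simp add: ctx_monom_def)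
  finally show "(ctx_monom r C \<otimes>\<^bsub>Ctx\<^esub> ctx_monom s D) E = ctx_monom (r \<otimes> s) (graft C D) E" .
qed

lemma Ctx_mult_closed [simp, intro]:
  assumes f: "f \<in> carrier Ctx" and g: "g \<in> carrier Ctx"
  shows "f \<otimes>\<^bsub>Ctx\<^esub> g \<in> carrier Ctx"
proof (rule Ctx_intro)
  let ?X = "{C. f C \<noteq> \<zero>}" and ?Y = "{C. g C \<noteq> \<zero>}"
  let ?Z = "(\<lambda>p. graft (fst p) (snd p)) ` (?X \<times> ?Y)"
  note e = Ctx_mult_app[OF f g Ctx_supp(1)[OF f] Ctx_supp(1)[OF g] subset_refl subset_refl]
  show "finite ?Z" using Ctx_supp[OF f] Ctx_supp[OF g] by simp
  show "?Z \<subseteq> contexts R m" using Ctx_supp(2)[OF f] Ctx_supp(2)[OF g] by (auto intro!: graft_context)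
  show "(f \<otimes>\<^bsub>Ctx\<^esub> g) E \<in> carrier R" for E
    unfolding e using f g by (intro R.finsum_closed) auto
  show "(f \<otimes>\<^bsub>Ctx\<^esub> g) E = \<zero>" if "E \<notin> ?Z" for E
    unfolding e using that by (intro R.add.finprod_one_eqI) force
qed

lemma Ctx_l_distr:
  assumes "f \<in> carrier Ctx" "g \<in> carrier Ctx" "h \<in> carrier Ctx"
  shows "(f \<oplus>\<^bsub>Ctx\<^esub> g) \<otimes>\<^bsub>Ctx\<^esub> h = f \<otimes>\<^bsub>Ctx\<^esub> h \<oplus>\<^bsub>Ctx\<^esub> g \<otimes>\<^bsub>Ctx\<^esub> h"
proof
  fix E
  let ?X = "{C. f C \<noteq> \<zero>} \<union> {C. g C \<noteq> \<zero>}" and ?Y = "{C. h C \<noteq> \<zero>}"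
  have fin: "finite ?X" "finite ?Y" using assms Ctx_supp(1) by auto
  have sub: "{C. (f \<oplus>\<^bsub>Ctx\<^esub> g) C \<noteq> \<zero>} \<subseteq> ?X" by (auto simp: Ctx_simps)
  let ?t = "\<lambda>f p. if graft (fst p) (snd p) = E then f (fst p) \<otimes> h (snd p) else \<zero>"
  have "((f \<oplus>\<^bsub>Ctx\<^esub> g) \<otimes>\<^bsub>Ctx\<^esub> h) E = (\<Oplus>p\<in>?X \<times> ?Y. ?t (f \<oplus>\<^bsub>Ctx\<^esub> g) p)"
    by (rule Ctx_mult_app) (use assms fin sub in auto)
  also have "\<dots> = (\<Oplus>p\<in>?X \<times> ?Y. ?t f p \<oplus> ?t g p)"
    using assms by (intro R.finsum_cong') (auto simp: Ctx_simps R.l_distr)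
  also have "\<dots> = (\<Oplus>p\<in>?X \<times> ?Y. ?t f p) \<oplus> (\<Oplus>p\<in>?X \<times> ?Y. ?t g p)"
    using assms by (intro R.finsum_addf) auto
  also have "(\<Oplus>p\<in>?X \<times> ?Y. ?t f p) = (f \<otimes>\<^bsub>Ctx\<^esub> h) E"
    by (rule Ctx_mult_app[symmetric]) (use assms fin in auto)
  also have "(\<Oplus>p\<in>?X \<times> ?Y. ?t g p) = (g \<otimes>\<^bsub>Ctx\<^esub> h) E"
    by (rule Ctx_mult_app[symmetric]) (use assms fin in auto)
  finally show "((f \<oplus>\<^bsub>Ctx\<^esub> g) \<otimes>\<^bsub>Ctx\<^esub> h) E = (f \<otimes>\<^bsub>Ctx\<^esub> h \<oplus>\<^bsub>Ctx\<^esub> g \<otimes>\<^bsub>Ctx\<^esub> h) E" by (simp add: Ctx_simps)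
qed

lemma Ctx_r_distr:
  assumes "f \<in> carrier Ctx" "g \<in> carrier Ctx" "h \<in> carrier Ctx"
  shows "h \<otimes>\<^bsub>Ctx\<^esub> (f \<oplus>\<^bsub>Ctx\<^esub> g) = h \<otimes>\<^bsub>Ctx\<^esub> f \<oplus>\<^bsub>Ctx\<^esub> h \<otimes>\<^bsub>Ctx\<^esub> g"
proof
  fix E
  let ?X = "{C. f C \<noteq> \<zero>} \<union> {C. g C \<noteq> \<zero>}" and ?Y = "{C. h C \<noteq> \<zero>}"
  have fin: "finite ?X" "finite ?Y" using assms Ctx_supp(1) by auto
  have sub: "{C. (f \<oplus>\<^bsub>Ctx\<^esub> g) C \<noteq> \<zero>} \<subseteq> ?X" by (auto simp: Ctx_simps)
  let ?t = "\<lambda>f p. if graft (fst p) (snd p) = E then h (fst p) \<otimes> f (snd p) else \<zero>"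
  have "(h \<otimes>\<^bsub>Ctx\<^esub> (f \<oplus>\<^bsub>Ctx\<^esub> g)) E = (\<Oplus>p\<in>?Y \<times> ?X. ?t (f \<oplus>\<^bsub>Ctx\<^esub> g) p)"
    by (rule Ctx_mult_app) (use assms fin sub in auto)
  also have "\<dots> = (\<Oplus>p\<in>?Y \<times> ?X. ?t f p \<oplus> ?t g p)"
    using assms by (intro R.finsum_cong') (auto simp: Ctx_simps R.r_distr)
  also have "\<dots> = (\<Oplus>p\<in>?Y \<times> ?X. ?t f p) \<oplus> (\<Oplus>p\<in>?Y \<times> ?X. ?t g p)"
    using assms by (intro R.finsum_addf) auto
  also have "(\<Oplus>p\<in>?Y \<times> ?X. ?t f p) = (h \<otimes>\<^bsub>Ctx\<^esub> f) E"
    by (rule Ctx_mult_app[symmetric]) (use assms fin in auto)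
  also have "(\<Oplus>p\<in>?Y \<times> ?X. ?t g p) = (h \<otimes>\<^bsub>Ctx\<^esub> g) E"
    by (rule Ctx_mult_app[symmetric]) (use assms fin in auto)
  finally show "(h \<otimes>\<^bsub>Ctx\<^esub> (f \<oplus>\<^bsub>Ctx\<^esub> g)) E = (h \<otimes>\<^bsub>Ctx\<^esub> f \<oplus>\<^bsub>Ctx\<^esub> h \<otimes>\<^bsub>Ctx\<^esub> g) E" by (simp add: Ctx_simps)
qed

lemma Ctx_mult_zero:
  assumes "f \<in> carrier Ctx"
  shows "\<zero>\<^bsub>Ctx\<^esub> \<otimes>\<^bsub>Ctx\<^esub> f = \<zero>\<^bsub>Ctx\<^esub>" "f \<otimes>\<^bsub>Ctx\<^esub> \<zero>\<^bsub>Ctx\<^esub> = \<zero>\<^bsub>Ctx\<^esub>"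
proof -
  show "\<zero>\<^bsub>Ctx\<^esub> \<otimes>\<^bsub>Ctx\<^esub> f = \<zero>\<^bsub>Ctx\<^esub>"
    using Ctx_mult_app[OF Ctx_zero_closed assms, of "{}" "{C. f C \<noteq> \<zero>}"] Ctx_supp(1)[OF assms]
    by (auto simp: fun_eq_iff Ctx_simps(2))
  show "f \<otimes>\<^bsub>Ctx\<^esub> \<zero>\<^bsub>Ctx\<^esub> = \<zero>\<^bsub>Ctx\<^esub>"
    using Ctx_mult_app[OF assms Ctx_zero_closed, of "{C. f C \<noteq> \<zero>}" "{}"] Ctx_supp(1)[OF assms]
    by (auto simp: fun_eq_iff Ctx_simps(2))
qed

text \<open>
  By bilinearity it suffices to consider single contexts, for which this is associativity of grafting.
\<close>

lemma Ctx_assoc: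
  assumes f: "f \<in> carrier Ctx" and g: "g \<in> carrier Ctx" and h: "h \<in> carrier Ctx"
  shows "f \<otimes>\<^bsub>Ctx\<^esub> g \<otimes>\<^bsub>Ctx\<^esub> h = f \<otimes>\<^bsub>Ctx\<^esub> (g \<otimes>\<^bsub>Ctx\<^esub> h)"
proof -
  have 1: "ctx_monom r C \<otimes>\<^bsub>Ctx\<^esub> ctx_monom s D \<otimes>\<^bsub>Ctx\<^esub> h = ctx_monom r C \<otimes>\<^bsub>Ctx\<^esub> (ctx_monom s D \<otimes>\<^bsub>Ctx\<^esub> h)"
    if "r \<in> carrier R" "s \<in> carrier R" "C \<in> contexts R m" "D \<in> contexts R m" for r s C D
    using h
    by (induction rule: Ctx_induct)
       (use that in \<open>simp_all add: Ctx_mult_zero Ctx_r_distr Ctx_mult_monom R.m_assoc graft_assoc\<close>)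
  have 2: "ctx_monom r C \<otimes>\<^bsub>Ctx\<^esub> g \<otimes>\<^bsub>Ctx\<^esub> h = ctx_monom r C \<otimes>\<^bsub>Ctx\<^esub> (g \<otimes>\<^bsub>Ctx\<^esub> h)"
    if "r \<in> carrier R" "C \<in> contexts R m" for r C
    using g
    by (induction rule: Ctx_induct)
       (use that h in \<open>simp_all add: Ctx_mult_zero Ctx_r_distr Ctx_l_distr 1\<close>)
  show ?thesis
    using f
    by (induction rule: Ctx_induct) (use g h in \<open>simp_all add: Ctx_mult_zero Ctx_l_distr 2\<close>)
qed

lemma Ctx_monom_one:
  assumes "f \<in> carrier Ctx"
  shows "\<one>\<^bsub>Ctx\<^esub> \<otimes>\<^bsub>Ctx\<^esub> f = f" "f \<otimes>\<^bsub>Ctx\<^esub> \<one>\<^bsub>Ctx\<^esub> = f"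
proof -
  show "\<one>\<^bsub>Ctx\<^esub> \<otimes>\<^bsub>Ctx\<^esub> f = f" "f \<otimes>\<^bsub>Ctx\<^esub> \<one>\<^bsub>Ctx\<^esub> = f"
    using assms unfolding Ctx_one_elt ctx_elt_monom
    by (induction rule: Ctx_induct)
       (simp_all add: Ctx_mult_zero Ctx_r_distr Ctx_l_distr Ctx_mult_monom graft_Hole)
qed

theorem Ctx_ring: "ring Ctx"
proof (rule ringI[OF Ctx_abelian_group])
  show "Group.monoid Ctx"
    by (rule monoidI) (auto simp: Ctx_assoc Ctx_monom_one Ctx_one_elt[THEN arg_cong, of "\<lambda>x. x \<in> carrier Ctx"])
qed (simp_all add: Ctx_l_distr Ctx_r_distr)

text \<open>
  Scalars act as multiples of the trivial context, so that ideals are closed under them.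
\<close>

lemma Ctx_smult_mult:
  assumes "f \<in> carrier Ctx" "r \<in> carrier R"
  shows "r \<odot>\<^bsub>Ctx\<^esub> f = ctx_monom r Hole \<otimes>\<^bsub>Ctx\<^esub> f"
  using assms(1)
proof (induction rule: Ctx_induct)
  case zero
  have "r \<odot>\<^bsub>Ctx\<^esub> \<zero>\<^bsub>Ctx\<^esub> = \<zero>\<^bsub>Ctx\<^esub>" using assms by (simp add: Ctx_simps)
  then show ?case using assms by (simp add: Ctx_mult_zero)
next
  case (add s C g)
  have "r \<odot>\<^bsub>Ctx\<^esub> (ctx_monom s C \<oplus>\<^bsub>Ctx\<^esub> g) = ctx_monom (r \<otimes> s) C \<oplus>\<^bsub>Ctx\<^esub> r \<odot>\<^bsub>Ctx\<^esub> g"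
    using add assms by (auto simp: Ctx_simps ctx_monom_def fun_eq_iff R.r_distr)
  then show ?case using add assms by (simp add: Ctx_r_distr Ctx_mult_monom)
qed

lemma Ctx_module: "module R Ctx"
proof (rule moduleI[OF R.is_cring Ctx_abelian_group])
qed (auto simp: Ctx_simps(3,4)[THEN fun_cong] fun_eq_iff R.l_distr R.r_distr R.m_assoc)

end

sublocale twisted_nary \<subseteq> Ctx: ring "ctx_alg R m"
  by (rule Ctx_ring)

sublocale twisted_nary \<subseteq> Ctx: module R "ctx_alg R m"
  by (rule Ctx_module)

section \<open>The envelope acts on anchored slot modules\<close>

context twisted_nary begin

lemma frame_scalar: "K \<in> frames \<Longrightarrow> K (Leaf a) \<in> scalar_trees \<Longrightarrow> b \<in> carrier T \<Longrightarrow> K (Leaf b) \<in> scalar_trees"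
  by (auto simp: scalar_trees_def intro: frame_full dest: frame_holes[where s = "Leaf a" and t = "Leaf b"])

text \<open>
  The twisted product is linear in each letter, and this persists through every surrounding vertex.
\<close>

lemma frame_scalar_value_affine:
  assumes "K \<in> frames" "K (Leaf a) \<in> scalar_trees" "b \<in> carrier T" "r \<in> carrier R"
  shows "scalar_value (K (Leaf (r \<odot>\<^bsub>T\<^esub> a \<oplus>\<^bsub>T\<^esub> b)))
    = r \<odot>\<^bsub>T\<^esub> scalar_value (K (Leaf a)) \<oplus>\<^bsub>T\<^esub> scalar_value (K (Leaf b))"
  using assms(1,2)
proof (induction rule: frames.induct)
  case (2 K xs ys)
  have s: "set xs \<subseteq> scalar_trees" "set ys \<subseteq> scalar_trees" "K (Leaf a) \<in> scalar_trees" "length xs + length ys = m"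
    using 2 by auto
  have "K (Leaf b) \<in> scalar_trees" using frame_scalar[OF 2(1) s(3) assms(3)] .
  then have "scalar_value (K (Leaf a)) \<in> carrier T" "scalar_value (K (Leaf b)) \<in> carrier T"
    using s(3) scalar_value_closed by blast+
  then show ?case
    using 2(2)[OF s(3)] s(4) scalar_values_closed[OF s(1)] scalar_values_closed[OF s(2)] assms(4)
    by (simp add: mu_multilinear del: set_map)
qed auto

end

context anchored_slots begin

lemma ctx_op_hom:
  assumes "C \<in> contexts R m"
  shows "ctx_op lam C \<in> module_hom R V V"
  using assms
proof (induction rule: context_induct)
  case Hole
  then show ?case by (simp add: module_hom_def)
next
  case (Node ls t rs)
  have p: "(map scalar_value ls, map scalar_value rs) \<in> slot_ops R m"
    using Node.hyps scalar_values_closed by (intro slot_opsI) auto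
  have "ctx_op lam (Node (ls @ t # rs)) = (\<lambda>x. lam (map scalar_value ls, map scalar_value rs) (ctx_op lam t x))"
    using Node.hyps(1-3) by (simp add: ctx_op_Node fun_eq_iff)
  then show ?case using module_hom_comp[OF lam_hom[OF p] Node.IH] by simp
qed

lemma ctx_op_closed [simp]: "C \<in> contexts R m \<Longrightarrow> x \<in> carrier V \<Longrightarrow> ctx_op lam C x \<in> carrier V"
  using ctx_op_hom[of C] by (auto simp: module_hom_def)

lemma ctx_op_add: "C \<in> contexts R m \<Longrightarrow> x \<in> carrier V \<Longrightarrow> y \<in> carrier V
    \<Longrightarrow> ctx_op lam C (x \<oplus>\<^bsub>V\<^esub> y) = ctx_op lam C x \<oplus>\<^bsub>V\<^esub> ctx_op lam C y"
  using ctx_op_hom[of C] by (auto simp: module_hom_def)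

lemma ctx_op_smult: "C \<in> contexts R m \<Longrightarrow> r \<in> carrier R \<Longrightarrow> x \<in> carrier V
    \<Longrightarrow> ctx_op lam C (r \<odot>\<^bsub>V\<^esub> x) = r \<odot>\<^bsub>V\<^esub> ctx_op lam C x"
  using ctx_op_hom[of C] by (auto simp: module_hom_def)

text \<open>
  Along the frame, the leaf at first lies in a hole-free subtree, where \<open>\<mu>\<close> is linear. At the vertex
  where this subtree meets the path to the hole, its value becomes a label of a slot operation, which is linear
  in its labels; the vertices above act linearly on the module.
\<close>

lemma frame_ctx_op_affine:
  assumes "K \<in> frames" "K (Leaf a) \<in> contexts R m" "b \<in> carrier T" "r \<in> carrier R" "x \<in> carrier V"
  shows "ctx_op lam (K (Leaf (r \<odot>\<^bsub>T\<^esub> a \<oplus>\<^bsub>T\<^esub> b))) x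
    = r \<odot>\<^bsub>V\<^esub> ctx_op lam (K (Leaf a)) x \<oplus>\<^bsub>V\<^esub> ctx_op lam (K (Leaf b)) x"
  using assms(1,2)
proof (induction rule: frames.induct)
  case 1
  then show ?case by (simp add: contexts_iff)
next
  case (2 K xs ys)
  have "full (K (Leaf a))" using 2(3) by (simp add: contexts_iff)
  then have a: "a \<in> carrier T" using frame_full_inner[OF 2(1)] by fastforce
  let ?c = "r \<odot>\<^bsub>T\<^esub> a \<oplus>\<^bsub>T\<^esub> b"
  have c: "?c \<in> carrier T" using a assms by simp
  from 2(3) obtain ls t rs where t: "xs @ K (Leaf a) # ys = ls @ t # rs" "set ls \<subseteq> scalar_trees"
      "t \<in> contexts R m" "set rs \<subseteq> scalar_trees" "length ls + length rs = m"
    by (rule context_cases) auto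
  show ?case
  proof (cases "K (Leaf a) = t")
    case True
    have h: "holes s = 0" if "s \<in> scalar_trees" for s :: "(nat \<Rightarrow> 'k) tree" using that by (simp add: scalar_trees_def)
    have "\<forall>s\<in>set xs \<union> set ys. s \<in> scalar_trees"
    proof -
      have ht: "holes (K (Leaf a)) = 1" using True t(3) by (simp add: contexts_iff)
      have "holes (Node (xs @ K (Leaf a) # ys)) = 1" using 2(3) by (simp only: contexts_iff)
      then have "sum_list (map holes xs) = 0" "sum_list (map holes ys) = 0" using ht by auto
      then show ?thesis using 2(3) by (auto simp: scalar_trees_def contexts_iff)
    qed
    then have s: "set xs \<subseteq> scalar_trees" "set ys \<subseteq> scalar_trees" by auto
    have K: "K (Leaf d) \<in> contexts R m" if "d \<in> carrier T" for d
      using frame_context[OF 2(1), of "Leaf a" "Leaf d"] True t(3) that by simp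
    have len: "length xs + length ys = m" using 2(3) by (simp add: contexts_iff)
    have p: "(map scalar_value xs, map scalar_value ys) \<in> slot_ops R m"
      using s len scalar_values_closed by (intro slot_opsI) auto
    have "ctx_op lam (K (Leaf ?c)) x = r \<odot>\<^bsub>V\<^esub> ctx_op lam (K (Leaf a)) x \<oplus>\<^bsub>V\<^esub> ctx_op lam (K (Leaf b)) x"
      using K[OF a] by (rule 2(2))
    then show ?thesis
      using K[OF a] K[OF assms(3)] K[OF c] s p assms(4,5) by (simp add: ctx_op_Node lam_add lam_smult)
  next
    case False
    with t(1) show ?thesis
    proof (rule append_Cons_eq_cases)
      fix us assume us: "xs = ls @ t # us" "rs = us @ K (Leaf a) # ys"
      have k: "K (Leaf a) \<in> scalar_trees" "set us \<subseteq> scalar_trees" "set ys \<subseteq> scalar_trees" using us t by auto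
      have K: "K (Leaf d) \<in> scalar_trees" if "d \<in> carrier T" for d
        using frame_scalar[OF 2(1) k(1) that] .
      have e: "ctx_op lam (Node (xs @ K (Leaf d) # ys)) x
        = lam (map scalar_value ls, map scalar_value us @ scalar_value (K (Leaf d)) # map scalar_value ys) (ctx_op lam t x)"
        if "d \<in> carrier T" for d
        using ctx_op_Node[of ls t "us @ K (Leaf d) # ys" lam x] t k K[OF that] us by simp
      have p: "(map scalar_value ls, map scalar_value us @ scalar_value (K (Leaf a)) # map scalar_value ys) \<in> slot_ops R m"
        using scalar_values_closed[OF t(2)] scalar_values_closed[OF t(4)] us t(5) by (intro slot_opsI) auto
      show ?thesis
        unfolding e[OF a] e[OF assms(3)] e[OF c] frame_scalar_value_affine[OF 2(1) k(1) assms(3,4)]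
        using p t(3) assms scalar_value_closed[OF K[OF assms(3)]] by (intro lam_right_linear) auto
    next
      fix us assume us: "ls = xs @ K (Leaf a) # us" "ys = us @ t # rs"
      have k: "K (Leaf a) \<in> scalar_trees" "set us \<subseteq> scalar_trees" "set xs \<subseteq> scalar_trees" using us t by auto
      have K: "K (Leaf d) \<in> scalar_trees" if "d \<in> carrier T" for d
        using frame_scalar[OF 2(1) k(1) that] .
      have e: "ctx_op lam (Node (xs @ K (Leaf d) # ys)) x
        = lam (map scalar_value xs @ scalar_value (K (Leaf d)) # map scalar_value us, map scalar_value rs) (ctx_op lam t x)"
        if "d \<in> carrier T" for d
        using ctx_op_Node[of "xs @ K (Leaf d) # us" t rs lam x] t k K[OF that] us by simp
      have p: "(map scalar_value xs @ scalar_value (K (Leaf a)) # map scalar_value us, map scalar_value rs) \<in> slot_ops R m"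
        using scalar_values_closed[OF t(2)] scalar_values_closed[OF t(4)] us t(5) by (intro slot_opsI) auto
      show ?thesis
        unfolding e[OF a] e[OF assms(3)] e[OF c] frame_scalar_value_affine[OF 2(1) k(1) assms(3,4)]
        using p t(3) assms scalar_value_closed[OF K[OF assms(3)]] by (intro lam_left_linear) auto
    qed
  qed
qed

definition act_ctx :: "((nat \<Rightarrow> 'k) tree \<Rightarrow> 'k) \<Rightarrow> 'v \<Rightarrow> 'v" where
  "act_ctx f x = (\<Oplus>\<^bsub>V\<^esub>C\<in>{C. f C \<noteq> \<zero>}. f C \<odot>\<^bsub>V\<^esub> ctx_op lam C x)"

lemma act_ctx_eq:
  assumes "f \<in> carrier Ctx" "x \<in> carrier V" "finite X" "X \<subseteq> contexts R m" "{C. f C \<noteq> \<zero>} \<subseteq> X"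
  shows "act_ctx f x = (\<Oplus>\<^bsub>V\<^esub>C\<in>X. f C \<odot>\<^bsub>V\<^esub> ctx_op lam C x)"
  unfolding act_ctx_def using assms
  by (intro V.add.finprod_mono_neutral_cong_left) auto

lemma act_ctx_closed [simp]:
  "f \<in> carrier Ctx \<Longrightarrow> x \<in> carrier V \<Longrightarrow> act_ctx f x \<in> carrier V"
  unfolding act_ctx_def using Ctx_supp(2)[of f] by (intro V.finsum_closed) auto

lemma act_ctx_add:
  assumes "f \<in> carrier Ctx" "g \<in> carrier Ctx" "x \<in> carrier V"
  shows "act_ctx (f \<oplus>\<^bsub>Ctx\<^esub> g) x = act_ctx f x \<oplus>\<^bsub>V\<^esub> act_ctx g x"
proof -
  let ?X = "{C. f C \<noteq> \<zero>} \<union> {C. g C \<noteq> \<zero>}"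
  have X: "finite ?X" "?X \<subseteq> contexts R m" using assms Ctx_supp by auto
  have "act_ctx (f \<oplus>\<^bsub>Ctx\<^esub> g) x = (\<Oplus>\<^bsub>V\<^esub>C\<in>?X. (f \<oplus>\<^bsub>Ctx\<^esub> g) C \<odot>\<^bsub>V\<^esub> ctx_op lam C x)"
    using assms X by (intro act_ctx_eq) (auto simp: Ctx_simps(3)[THEN fun_cong])
  also have "\<dots> = (\<Oplus>\<^bsub>V\<^esub>C\<in>?X. f C \<odot>\<^bsub>V\<^esub> ctx_op lam C x \<oplus>\<^bsub>V\<^esub> g C \<odot>\<^bsub>V\<^esub> ctx_op lam C x)"
    using assms X by (intro V.finsum_cong') (auto simp: Ctx_simps(3)[THEN fun_cong] V.smult_l_distr)
  also have "\<dots> = (\<Oplus>\<^bsub>V\<^esub>C\<in>?X. f C \<odot>\<^bsub>V\<^esub> ctx_op lam C x) \<oplus>\<^bsub>V\<^esub> (\<Oplus>\<^bsub>V\<^esub>C\<in>?X. g C \<odot>\<^bsub>V\<^esub> ctx_op lam C x)"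
    using assms X by (intro V.finsum_addf) auto
  also have "(\<Oplus>\<^bsub>V\<^esub>C\<in>?X. f C \<odot>\<^bsub>V\<^esub> ctx_op lam C x) = act_ctx f x"
    using assms X by (intro act_ctx_eq[symmetric]) auto
  also have "(\<Oplus>\<^bsub>V\<^esub>C\<in>?X. g C \<odot>\<^bsub>V\<^esub> ctx_op lam C x) = act_ctx g x"
    using assms X by (intro act_ctx_eq[symmetric]) auto
  finally show ?thesis .
qed

lemma act_ctx_monom:
  assumes "r \<in> carrier R" "C \<in> contexts R m" "x \<in> carrier V"
  shows "act_ctx (ctx_monom r C) x = r \<odot>\<^bsub>V\<^esub> ctx_op lam C x"
proof -
  have "act_ctx (ctx_monom r C) x = (\<Oplus>\<^bsub>V\<^esub>D\<in>{C}. ctx_monom r C D \<odot>\<^bsub>V\<^esub> ctx_op lam D x)"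
    using assms by (intro act_ctx_eq ctx_monom_closed) (auto simp: ctx_monom_def)
  also have "\<dots> = r \<odot>\<^bsub>V\<^esub> ctx_op lam C x" using assms by (simp add: ctx_monom_def)
  finally show ?thesis .
qed

lemma act_ctx_elt: "C \<in> contexts R m \<Longrightarrow> x \<in> carrier V \<Longrightarrow> act_ctx (ctx_elt R C) x = ctx_op lam C x"
  by (simp add: ctx_elt_monom act_ctx_monom)

lemma act_ctx_zero [simp]: "act_ctx \<zero>\<^bsub>Ctx\<^esub> x = \<zero>\<^bsub>V\<^esub>"
  by (simp add: act_ctx_def Ctx_simps)

lemma act_ctx_smult:
  assumes "f \<in> carrier Ctx" "r \<in> carrier R" "x \<in> carrier V"
  shows "act_ctx (r \<odot>\<^bsub>Ctx\<^esub> f) x = r \<odot>\<^bsub>V\<^esub> act_ctx f x"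
  using assms(1)
proof (induction rule: Ctx_induct)
  case zero
  then show ?case using assms by simp
next
  case (add s C g)
  have "r \<odot>\<^bsub>Ctx\<^esub> (ctx_monom s C \<oplus>\<^bsub>Ctx\<^esub> g) = ctx_monom (r \<otimes> s) C \<oplus>\<^bsub>Ctx\<^esub> r \<odot>\<^bsub>Ctx\<^esub> g"
    using add assms by (auto simp: Ctx_simps ctx_monom_def fun_eq_iff R.r_distr)
  then show ?case
    using add assms by (simp add: act_ctx_add act_ctx_monom V.smult_assoc1 V.smult_r_distr)
qed

lemma act_ctx_hom: "f \<in> carrier Ctx \<Longrightarrow> act_ctx f \<in> module_hom R V V"
proof (induction rule: Ctx_induct)
  case zero
  then show ?case by (simp add: module_hom_def)
next
  case (add s C g)
  then show ?case
    by (auto simp: module_hom_def act_ctx_add act_ctx_monom ctx_op_add ctx_op_smult V.smult_r_distr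
        V.a_ac R.m_comm simp flip: V.smult_assoc1)
qed

lemma act_ctx_V_add: "f \<in> carrier Ctx \<Longrightarrow> x \<in> carrier V \<Longrightarrow> y \<in> carrier V
    \<Longrightarrow> act_ctx f (x \<oplus>\<^bsub>V\<^esub> y) = act_ctx f x \<oplus>\<^bsub>V\<^esub> act_ctx f y"
  using act_ctx_hom[of f] by (auto simp: module_hom_def)

lemma act_ctx_V_zero: "f \<in> carrier Ctx \<Longrightarrow> act_ctx f \<zero>\<^bsub>V\<^esub> = \<zero>\<^bsub>V\<^esub>"
  using act_ctx_V_add[of f "\<zero>\<^bsub>V\<^esub>" "\<zero>\<^bsub>V\<^esub>"] by (simp add: V.M.add.r_cancel_one)

text \<open>
  On single contexts this is \<open>ctx_op_graft\<close>.
\<close>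

lemma act_ctx_mult:
  assumes f: "f \<in> carrier Ctx" and g: "g \<in> carrier Ctx" and x: "x \<in> carrier V"
  shows "act_ctx (f \<otimes>\<^bsub>Ctx\<^esub> g) x = act_ctx f (act_ctx g x)"
proof -
  have 1: "act_ctx (ctx_monom r C \<otimes>\<^bsub>Ctx\<^esub> g) x = act_ctx (ctx_monom r C) (act_ctx g x)"
    if "r \<in> carrier R" "C \<in> contexts R m" for r C
    using g
  proof (induction rule: Ctx_induct)
    case zero
    then show ?case using that by (simp add: Ctx_mult_zero act_ctx_V_zero)
  next
    case (add s D h)
    then show ?case using that x
      by (simp add: Ctx.r_distr Ctx_mult_monom act_ctx_add act_ctx_V_add act_ctx_monom ctx_op_graft ctx_op_smult V.smult_assoc1)
  qed
  show ?thesis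
    using f by (induction rule: Ctx_induct) (use g x in \<open>simp_all add: Ctx_mult_zero Ctx.l_distr act_ctx_add 1\<close>)
qed

definition act_kernel :: "((nat \<Rightarrow> 'k) tree \<Rightarrow> 'k) set" where
  "act_kernel = {f \<in> carrier Ctx. \<forall>x\<in>carrier V. act_ctx f x = \<zero>\<^bsub>V\<^esub>}"

lemma act_ctx_neg:
  assumes "f \<in> carrier Ctx" "x \<in> carrier V"
  shows "act_ctx (\<ominus>\<^bsub>Ctx\<^esub> f) x = \<ominus>\<^bsub>V\<^esub> act_ctx f x"
proof -
  have "act_ctx (\<ominus>\<^bsub>Ctx\<^esub> f) x \<oplus>\<^bsub>V\<^esub> act_ctx f x = \<zero>\<^bsub>V\<^esub>"
    using assms by (simp add: Ctx.l_neg flip: act_ctx_add)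
  then show ?thesis using assms by (metis Ctx.a_inv_closed V.minus_equality act_ctx_closed)
qed

lemma act_kernel_minus:
  assumes "f \<in> carrier Ctx" "g \<in> carrier Ctx" "\<And>x. x \<in> carrier V \<Longrightarrow> act_ctx f x = act_ctx g x"
  shows "f \<ominus>\<^bsub>Ctx\<^esub> g \<in> act_kernel"
  using assms by (simp add: act_kernel_def a_minus_def act_ctx_add act_ctx_neg V.r_neg)

lemma act_kernel_ideal: "ideal act_kernel Ctx"
proof (rule idealI[OF Ctx_ring])
  show "subgroup act_kernel (add_monoid Ctx)"
  proof (rule Ctx.add.subgroupI)
    show "act_kernel \<noteq> {}" by (auto simp: act_kernel_def intro!: exI[of _ "\<zero>\<^bsub>Ctx\<^esub>"])
  qed (auto simp: act_kernel_def act_ctx_add act_ctx_neg simp flip: a_inv_def)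
qed (auto simp: act_kernel_def act_ctx_mult act_ctx_V_zero)

lemma multilinearity_kernel: "multilinearity_rels R m \<subseteq> act_kernel"
proof -
  have c: "K (Leaf b) \<in> contexts R m" if "K \<in> frames" "K (Leaf a) \<in> contexts R m" "b \<in> carrier T" for K a b
    using frame_context[OF that(1,2), of "Leaf b"] that(3) by simp
  have zero: "ctx_op lam (K (Leaf \<zero>\<^bsub>T\<^esub>)) x = \<zero>\<^bsub>V\<^esub>"
    if "K \<in> frames" "K (Leaf a) \<in> contexts R m" "x \<in> carrier V" for K a x
  proof -
    have "K (Leaf \<zero>\<^bsub>T\<^esub>) \<in> contexts R m" using c[OF that(1,2)] by simp
    then show ?thesis
      using frame_ctx_op_affine[of K "\<zero>\<^bsub>T\<^esub>" "\<zero>\<^bsub>T\<^esub>" \<one> x] that by (simp add: V.M.add.r_cancel_one)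
  qed
  show ?thesis
    unfolding multilinearity_rels_def
  proof (intro Un_least subsetI)
    fix f assume "f \<in> {ctx_elt R (K (Leaf (a \<oplus>\<^bsub>T\<^esub> b))) \<ominus>\<^bsub>Ctx\<^esub>
      (ctx_elt R (K (Leaf a)) \<oplus>\<^bsub>Ctx\<^esub> ctx_elt R (K (Leaf b))) |K a b.
      K \<in> frames \<and> K (Leaf a) \<in> contexts R m \<and> a \<in> carrier T \<and> b \<in> carrier T}"
    then obtain K a b where f: "f = ctx_elt R (K (Leaf (a \<oplus>\<^bsub>T\<^esub> b))) \<ominus>\<^bsub>Ctx\<^esub>
      (ctx_elt R (K (Leaf a)) \<oplus>\<^bsub>Ctx\<^esub> ctx_elt R (K (Leaf b)))"
      and K: "K \<in> frames" "K (Leaf a) \<in> contexts R m" "a \<in> carrier T" "b \<in> carrier T" by blast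
    note cc = c[OF K(1,2)]
    show "f \<in> act_kernel" unfolding f
    proof (rule act_kernel_minus)
      fix x assume x: "x \<in> carrier V"
      show "act_ctx (ctx_elt R (K (Leaf (a \<oplus>\<^bsub>T\<^esub> b)))) x
        = act_ctx (ctx_elt R (K (Leaf a)) \<oplus>\<^bsub>Ctx\<^esub> ctx_elt R (K (Leaf b))) x"
        using frame_ctx_op_affine[OF K(1,2,4) R.one_closed x] K x cc
        by (simp add: act_ctx_elt act_ctx_add)
    qed (use K cc in auto)
  next
    fix f assume "f \<in> {ctx_elt R (K (Leaf (r \<odot>\<^bsub>T\<^esub> a))) \<ominus>\<^bsub>Ctx\<^esub> (r \<odot>\<^bsub>Ctx\<^esub> ctx_elt R (K (Leaf a))) |K r a.
      K \<in> frames \<and> K (Leaf a) \<in> contexts R m \<and> r \<in> carrier R \<and> a \<in> carrier T}"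
    then obtain K a r where f: "f = ctx_elt R (K (Leaf (r \<odot>\<^bsub>T\<^esub> a))) \<ominus>\<^bsub>Ctx\<^esub> (r \<odot>\<^bsub>Ctx\<^esub> ctx_elt R (K (Leaf a)))"
      and K: "K \<in> frames" "K (Leaf a) \<in> contexts R m" "r \<in> carrier R" "a \<in> carrier T" by blast
    note cc = c[OF K(1,2)]
    show "f \<in> act_kernel" unfolding f
    proof (rule act_kernel_minus)
      fix x assume x: "x \<in> carrier V"
      show "act_ctx (ctx_elt R (K (Leaf (r \<odot>\<^bsub>T\<^esub> a)))) x = act_ctx (r \<odot>\<^bsub>Ctx\<^esub> ctx_elt R (K (Leaf a))) x"
        using frame_ctx_op_affine[OF K(1,2) T.zero_closed K(3) x] K x cc zero[OF K(1,2) x]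
        by (simp add: act_ctx_elt act_ctx_smult)
    qed (use K cc in auto)
  qed
qed

lemma same_value_kernel:
  assumes "C \<in> contexts R m" "D \<in> contexts R m"
    "\<And>x. x \<in> carrier V \<Longrightarrow> tree_value (mu R m) lam x C = tree_value (mu R m) lam x D"
  shows "ctx_elt R C \<ominus>\<^bsub>Ctx\<^esub> ctx_elt R D \<in> act_kernel"
  using assms by (intro act_kernel_minus) (auto simp: act_ctx_elt tree_value_context)

lemma contraction_kernel: "contraction_rels R m \<subseteq> act_kernel"
proof
  fix f assume "f \<in> contraction_rels R m"
  then obtain K as where f: "f = ctx_elt R (K (Node (map Leaf as))) \<ominus>\<^bsub>Ctx\<^esub> ctx_elt R (K (Leaf (mu R m as)))"
    and K: "K \<in> frames" "K (Node (map Leaf as)) \<in> contexts R m" "length as = m + 1" "set as \<subseteq> carrier T"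
    unfolding contraction_rels_def by blast
  have s: "set (map Leaf as) \<subseteq> scalar_trees" "map scalar_value (map Leaf as) = as"
    using scalar_Leafs[OF K(4)] .
  then have n: "Node (map Leaf as) \<in> scalar_trees" "scalar_value (Node (map Leaf as)) = mu R m as"
    using K(3) by simp_all
  have K2: "K (Leaf (mu R m as)) \<in> contexts R m"
    using frame_context[OF K(1,2), of "Leaf (mu R m as)"] K(3,4) n(1) by (simp add: scalar_trees_def del: holes.simps(3))
  show "f \<in> act_kernel"
    unfolding f using K(2) K2
  proof (rule same_value_kernel)
    fix x assume "x \<in> carrier V"
    have "tree_value (mu R m) lam x (Node (map Leaf as)) = tree_value (mu R m) lam x (Leaf (mu R m as))"
      unfolding tree_value_scalar[OF n(1)] n(2) by (simp only: tree_value.simps)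
    then show "tree_value (mu R m) lam x (K (Node (map Leaf as))) = tree_value (mu R m) lam x (K (Leaf (mu R m as)))"
      by (rule frame_tree_value[OF K(1)])
  qed
qed

lemma assoc_kernel: "assoc_rels R m \<subseteq> act_kernel"
proof
  fix f assume "f \<in> assoc_rels R m"
  then obtain C D where f: "f = ctx_elt R C \<ominus>\<^bsub>Ctx\<^esub> ctx_elt R D" and CD: "(C, D) \<in> assoc_moves R m"
    unfolding assoc_rels_def by blast
  show "f \<in> act_kernel"
    unfolding f using assoc_moves_contexts[OF CD] assoc_move_value[OF CD] by (rule same_value_kernel)
qed

lemma anchor_kernel: "anchor_rels R m \<subseteq> act_kernel"
proof -
  have s: "set (replicate i (Leaf \<one>\<^bsub>T\<^esub>)) \<subseteq> scalar_trees" "map scalar_value (replicate i (Leaf \<one>\<^bsub>T\<^esub>)) = ones i" for i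
    by auto
  have c: "Node (Hole # replicate m (Leaf \<one>\<^bsub>T\<^esub>)) \<in> contexts R m" "Node (replicate m (Leaf \<one>\<^bsub>T\<^esub>) @ [Hole]) \<in> contexts R m"
    using Node_context[of "[]" Hole "replicate m (Leaf \<one>\<^bsub>T\<^esub>)"] Node_context[of "replicate m (Leaf \<one>\<^bsub>T\<^esub>)" Hole "[]"] s by simp_all
  have "ctx_op lam (Node (Hole # replicate m (Leaf \<one>\<^bsub>T\<^esub>))) x = x"
    "ctx_op lam (Node (replicate m (Leaf \<one>\<^bsub>T\<^esub>) @ [Hole])) x = x" if "x \<in> carrier V" for x
    using ctx_op_Node[of "[]" Hole "replicate m (Leaf \<one>\<^bsub>T\<^esub>)" lam x]
      ctx_op_Node[of "replicate m (Leaf \<one>\<^bsub>T\<^esub>)" Hole "[]" lam x] s that shift_0[of x] shift_m[of x]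
    by (simp_all add: shift_def)
  with c show ?thesis
    unfolding anchor_rels_def Ctx_one_elt by (auto intro!: act_kernel_minus simp: act_ctx_elt)
qed

lemma relations_kernel:
  "multilinearity_rels R m \<union> contraction_rels R m \<union> assoc_rels R m \<union> anchor_rels R m \<subseteq> act_kernel"
  using multilinearity_kernel contraction_kernel assoc_kernel anchor_kernel by blast

text \<open>
  The elements that act as zero form an ideal, and it contains all relations.
\<close>

lemma Uan_ideal_kernel: "Uan_ideal R m \<subseteq> act_kernel"
  unfolding Uan_ideal_def by (rule Ctx.genideal_minimal[OF act_kernel_ideal relations_kernel])

end

section \<open>The envelope\<close>

context twisted_nary begin

abbreviation "U \<equiv> Uan R m"

lemma relations_closed:
  "multilinearity_rels R m \<union> contraction_rels R m \<union> assoc_rels R m \<union> anchor_rels R m \<subseteq> carrier Ctx"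
  \<comment> \<open>any anchored slot module would do, since \<open>act_kernel\<close> consists of elements of the grafting algebra\<close>
  using std.relations_kernel[of 0] by (auto simp: std.act_kernel_def)

lemma Uan_ideal: "ideal (Uan_ideal R m) Ctx"
  unfolding Uan_ideal_def by (rule Ctx.genideal_ideal[OF relations_closed])

lemma relations_ideal:
  "multilinearity_rels R m \<union> contraction_rels R m \<union> assoc_rels R m \<union> anchor_rels R m \<subseteq> Uan_ideal R m"
  unfolding Uan_ideal_def by (rule Ctx.genideal_self[OF relations_closed])

end

sublocale twisted_nary \<subseteq> I: ideal "Uan_ideal R m" "ctx_alg R m"
  by (rule Uan_ideal)

context twisted_nary begin

definition env_class :: "((nat \<Rightarrow> 'k) tree \<Rightarrow> 'k) \<Rightarrow> ((nat \<Rightarrow> 'k) tree \<Rightarrow> 'k) set" where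
  "env_class f = Uan_ideal R m +>\<^bsub>Ctx\<^esub> f"

lemma U_simps:
  "carrier U = a_rcosets\<^bsub>Ctx\<^esub> Uan_ideal R m"
  "u \<otimes>\<^bsub>U\<^esub> w = [mod Uan_ideal R m:] u \<Otimes>\<^bsub>Ctx\<^esub> w"
  "\<one>\<^bsub>U\<^esub> = env_class \<one>\<^bsub>Ctx\<^esub>"
  "\<zero>\<^bsub>U\<^esub> = Uan_ideal R m"
  "u \<oplus>\<^bsub>U\<^esub> w = u <+>\<^bsub>Ctx\<^esub> w"
  "r \<odot>\<^bsub>U\<^esub> u = (\<Union>x\<in>u. env_class (r \<odot>\<^bsub>Ctx\<^esub> x))"
  by (simp_all add: Uan_def quot_alg_def FactRing_def env_class_def)

lemma env_class_closed [simp, intro]: "f \<in> carrier Ctx \<Longrightarrow> env_class f \<in> carrier U"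
  by (auto simp: U_simps(1) env_class_def A_RCOSETS_def RCOSETS_def a_r_coset_def)

lemma U_cases:
  assumes "u \<in> carrier U"
  obtains f where "f \<in> carrier Ctx" "u = env_class f"
  using assms by (auto simp: U_simps(1) env_class_def A_RCOSETS_def RCOSETS_def a_r_coset_def)

lemma env_class_mult: "f \<in> carrier Ctx \<Longrightarrow> g \<in> carrier Ctx \<Longrightarrow> env_class f \<otimes>\<^bsub>U\<^esub> env_class g = env_class (f \<otimes>\<^bsub>Ctx\<^esub> g)"
  unfolding U_simps env_class_def by (rule I.rcoset_mult_add)

lemma env_class_add: "f \<in> carrier Ctx \<Longrightarrow> g \<in> carrier Ctx \<Longrightarrow> env_class f \<oplus>\<^bsub>U\<^esub> env_class g = env_class (f \<oplus>\<^bsub>Ctx\<^esub> g)"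
  unfolding U_simps env_class_def by (rule I.a_rcos_sum)

lemma env_class_zero: "\<zero>\<^bsub>U\<^esub> = env_class \<zero>\<^bsub>Ctx\<^esub>"
  unfolding U_simps env_class_def using I.a_subset by simp

lemma env_class_eq_iff: "f \<in> carrier Ctx \<Longrightarrow> g \<in> carrier Ctx \<Longrightarrow> env_class f = env_class g \<longleftrightarrow> f \<ominus>\<^bsub>Ctx\<^esub> g \<in> Uan_ideal R m"
  unfolding env_class_def using Ctx.quotient_eq_iff_same_a_r_cos[OF Uan_ideal] by blast

lemma env_class_mem: "x \<in> env_class f \<Longrightarrow> f \<in> carrier Ctx \<Longrightarrow> x \<in> carrier Ctx \<and> env_class x = env_class f"
  unfolding env_class_def using I.a_elemrcos_carrier I.a_repr_independence' by blast

lemma env_class_smult: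
  assumes f: "f \<in> carrier Ctx" and r: "r \<in> carrier R"
  shows "r \<odot>\<^bsub>U\<^esub> env_class f = env_class (r \<odot>\<^bsub>Ctx\<^esub> f)"
proof -
  have "env_class (r \<odot>\<^bsub>Ctx\<^esub> x) = env_class (r \<odot>\<^bsub>Ctx\<^esub> f)" if "x \<in> env_class f" for x
  proof -
    have x: "x \<in> carrier Ctx" "env_class x = env_class f" using env_class_mem[OF that f] by auto
    have "env_class (r \<odot>\<^bsub>Ctx\<^esub> x) = env_class (ctx_monom r Hole) \<otimes>\<^bsub>U\<^esub> env_class x"
      unfolding Ctx_smult_mult[OF x(1) r] using x r by (intro env_class_mult[symmetric]) auto
    also have "\<dots> = env_class (r \<odot>\<^bsub>Ctx\<^esub> f)"
      unfolding Ctx_smult_mult[OF f r] x(2) using f r by (intro env_class_mult) auto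
    finally show ?thesis .
  qed
  moreover have "f \<in> env_class f" unfolding env_class_def using f I.a_rcos_self by blast
  ultimately show ?thesis unfolding U_simps by blast
qed

lemma U_abelian_group: "abelian_group U"
proof (rule abelian_groupI)
  fix u assume "u \<in> carrier U"
  then obtain f where f: "f \<in> carrier Ctx" "u = env_class f" by (rule U_cases)
  then show "\<exists>w\<in>carrier U. w \<oplus>\<^bsub>U\<^esub> u = \<zero>\<^bsub>U\<^esub>"
    by (intro bexI[of _ "env_class (\<ominus>\<^bsub>Ctx\<^esub> f)"]) (auto simp: env_class_add env_class_zero Ctx.l_neg)
qed (auto simp: env_class_add env_class_zero Ctx.a_ac elim!: U_cases)

lemma U_module: "module R U"
  by (rule moduleI[OF R.is_cring U_abelian_group])
     (auto simp: env_class_add env_class_smult Ctx.smult_l_distr Ctx.smult_r_distr Ctx.smult_assoc1 elim!: U_cases)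

lemma U_one_closed [simp, intro]: "\<one>\<^bsub>U\<^esub> \<in> carrier U"
  by (simp add: U_simps(3))

lemma U_mult_closed [simp, intro]: "u \<in> carrier U \<Longrightarrow> w \<in> carrier U \<Longrightarrow> u \<otimes>\<^bsub>U\<^esub> w \<in> carrier U"
  by (auto simp: env_class_mult elim!: U_cases)

lemma Ctx_monom_Hole_commute: "f \<in> carrier Ctx \<Longrightarrow> r \<in> carrier R \<Longrightarrow> f \<otimes>\<^bsub>Ctx\<^esub> ctx_monom r Hole = ctx_monom r Hole \<otimes>\<^bsub>Ctx\<^esub> f"
  by (induction rule: Ctx_induct)
     (simp_all add: Ctx_mult_zero Ctx.l_distr Ctx.r_distr Ctx_mult_monom graft_Hole R.m_comm)

lemma Ctx_mult_smult:
  assumes "f \<in> carrier Ctx" "g \<in> carrier Ctx" "r \<in> carrier R"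
  shows "f \<otimes>\<^bsub>Ctx\<^esub> (r \<odot>\<^bsub>Ctx\<^esub> g) = r \<odot>\<^bsub>Ctx\<^esub> (f \<otimes>\<^bsub>Ctx\<^esub> g)"
  using assms by (simp add: Ctx_smult_mult Ctx_monom_Hole_commute flip: Ctx_assoc)

theorem U_regular: "alg_module R U U (\<otimes>\<^bsub>U\<^esub>)"
  unfolding alg_module_def
proof (intro conjI ballI)
  fix u assume "u \<in> carrier U"
  then show "(\<otimes>\<^bsub>U\<^esub>) u \<in> module_hom R U U"
    by (auto simp: module_hom_def env_class_mult env_class_add env_class_smult Ctx.r_distr Ctx_mult_smult elim!: U_cases)
qed (auto simp: U_module env_class_mult env_class_add env_class_smult U_simps(3) Ctx.l_distr Ctx.m_assoc Ctx_smult_mult elim!: U_cases)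

definition ctx_class :: "(nat \<Rightarrow> 'k) tree \<Rightarrow> ((nat \<Rightarrow> 'k) tree \<Rightarrow> 'k) set" where
  "ctx_class C = env_class (ctx_elt R C)"

lemma ctx_class_closed [simp, intro]: "C \<in> contexts R m \<Longrightarrow> ctx_class C \<in> carrier U"
  by (simp add: ctx_class_def)

lemma U_one_ctx_class: "\<one>\<^bsub>U\<^esub> = ctx_class Hole"
  by (simp add: U_simps(3) ctx_class_def Ctx_one_elt)

lemma ctx_class_graft: "C \<in> contexts R m \<Longrightarrow> D \<in> contexts R m \<Longrightarrow> ctx_class (graft C D) = ctx_class C \<otimes>\<^bsub>U\<^esub> ctx_class D"
  by (simp add: ctx_class_def env_class_mult ctx_elt_monom Ctx_mult_monom)

lemma ctx_class_eqI:
  "C \<in> contexts R m \<Longrightarrow> D \<in> contexts R m \<Longrightarrow> ctx_elt R C \<ominus>\<^bsub>Ctx\<^esub> ctx_elt R D \<in> Uan_ideal R m \<Longrightarrow> ctx_class C = ctx_class D"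
  by (simp add: ctx_class_def env_class_eq_iff)

lemma ctx_class_assoc: "(C, D) \<in> assoc_moves R m \<Longrightarrow> ctx_class C = ctx_class D"
  using relations_ideal assoc_moves_contexts[of C D] unfolding assoc_rels_def by (intro ctx_class_eqI) blast+

lemma ctx_class_affine:
  assumes K: "K \<in> frames" "K (Leaf a) \<in> contexts R m" "a \<in> carrier T" "b \<in> carrier T" "r \<in> carrier R"
  shows "ctx_class (K (Leaf (r \<odot>\<^bsub>T\<^esub> a \<oplus>\<^bsub>T\<^esub> b))) = r \<odot>\<^bsub>U\<^esub> ctx_class (K (Leaf a)) \<oplus>\<^bsub>U\<^esub> ctx_class (K (Leaf b))"
proof -
  have c: "K (Leaf c) \<in> contexts R m" if "c \<in> carrier T" for c
    using frame_context[OF K(1,2), of "Leaf c"] that by simp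
  have ra: "r \<odot>\<^bsub>T\<^esub> a \<in> carrier T" using K by simp
  have "ctx_elt R (K (Leaf (r \<odot>\<^bsub>T\<^esub> a \<oplus>\<^bsub>T\<^esub> b)))
      \<ominus>\<^bsub>Ctx\<^esub> (ctx_elt R (K (Leaf (r \<odot>\<^bsub>T\<^esub> a))) \<oplus>\<^bsub>Ctx\<^esub> ctx_elt R (K (Leaf b))) \<in> Uan_ideal R m"
  proof (rule subsetD[OF relations_ideal])
    show "ctx_elt R (K (Leaf (r \<odot>\<^bsub>T\<^esub> a \<oplus>\<^bsub>T\<^esub> b))) \<ominus>\<^bsub>Ctx\<^esub>
        (ctx_elt R (K (Leaf (r \<odot>\<^bsub>T\<^esub> a))) \<oplus>\<^bsub>Ctx\<^esub> ctx_elt R (K (Leaf b)))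
      \<in> multilinearity_rels R m \<union> contraction_rels R m \<union> assoc_rels R m \<union> anchor_rels R m"
      unfolding multilinearity_rels_def
      by (intro UnI1 CollectI exI[of _ K] exI[of _ "r \<odot>\<^bsub>T\<^esub> a"] exI[of _ b] conjI refl K(1,4) ra c[OF ra])
  qed
  then have "env_class (ctx_elt R (K (Leaf (r \<odot>\<^bsub>T\<^esub> a \<oplus>\<^bsub>T\<^esub> b))))
      = env_class (ctx_elt R (K (Leaf (r \<odot>\<^bsub>T\<^esub> a))) \<oplus>\<^bsub>Ctx\<^esub> ctx_elt R (K (Leaf b)))"
    using c ra K by (subst env_class_eq_iff) auto
  also have "\<dots> = ctx_class (K (Leaf (r \<odot>\<^bsub>T\<^esub> a))) \<oplus>\<^bsub>U\<^esub> ctx_class (K (Leaf b))"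
    using c ra K by (simp add: env_class_add ctx_class_def)
  finally have 1: "ctx_class (K (Leaf (r \<odot>\<^bsub>T\<^esub> a \<oplus>\<^bsub>T\<^esub> b))) = ctx_class (K (Leaf (r \<odot>\<^bsub>T\<^esub> a))) \<oplus>\<^bsub>U\<^esub> ctx_class (K (Leaf b))"
    by (simp add: ctx_class_def)
  have "ctx_elt R (K (Leaf (r \<odot>\<^bsub>T\<^esub> a))) \<ominus>\<^bsub>Ctx\<^esub> (r \<odot>\<^bsub>Ctx\<^esub> ctx_elt R (K (Leaf a))) \<in> Uan_ideal R m"
  proof (rule subsetD[OF relations_ideal])
    show "ctx_elt R (K (Leaf (r \<odot>\<^bsub>T\<^esub> a))) \<ominus>\<^bsub>Ctx\<^esub> (r \<odot>\<^bsub>Ctx\<^esub> ctx_elt R (K (Leaf a)))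
      \<in> multilinearity_rels R m \<union> contraction_rels R m \<union> assoc_rels R m \<union> anchor_rels R m"
      unfolding multilinearity_rels_def
      by (rule UnI1, rule UnI1, rule UnI1, rule UnI2)
         (intro CollectI exI[of _ K] exI[of _ r] exI[of _ a] conjI refl K)
  qed
  then have "env_class (ctx_elt R (K (Leaf (r \<odot>\<^bsub>T\<^esub> a)))) = env_class (r \<odot>\<^bsub>Ctx\<^esub> ctx_elt R (K (Leaf a)))"
    using c ra K by (subst env_class_eq_iff) auto
  then have "ctx_class (K (Leaf (r \<odot>\<^bsub>T\<^esub> a))) = r \<odot>\<^bsub>U\<^esub> ctx_class (K (Leaf a))"
    using K by (simp add: ctx_class_def env_class_smult)
  with 1 show ?thesis by simp
qed

lemma ctx_class_contract:
  assumes K: "K \<in> frames" "K (Node (map Leaf as)) \<in> contexts R m" "length as = m + 1" "set as \<subseteq> carrier T"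
  shows "ctx_class (K (Node (map Leaf as))) = ctx_class (K (Leaf (mu R m as)))"
proof (rule ctx_class_eqI)
  have "Node (map Leaf as) \<in> scalar_trees" using K by auto
  then show "K (Leaf (mu R m as)) \<in> contexts R m"
    using frame_context[OF K(1,2), of "Leaf (mu R m as)"] K(3,4) by (simp add: scalar_trees_def del: holes.simps(3))
  show "ctx_elt R (K (Node (map Leaf as))) \<ominus>\<^bsub>Ctx\<^esub> ctx_elt R (K (Leaf (mu R m as))) \<in> Uan_ideal R m"
  proof (rule subsetD[OF relations_ideal])
    show "ctx_elt R (K (Node (map Leaf as))) \<ominus>\<^bsub>Ctx\<^esub> ctx_elt R (K (Leaf (mu R m as)))
      \<in> multilinearity_rels R m \<union> contraction_rels R m \<union> assoc_rels R m \<union> anchor_rels R m"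
      unfolding contraction_rels_def
      by (rule UnI1, rule UnI1, rule UnI2) (intro CollectI exI[of _ K] exI[of _ as] conjI refl K)
  qed
qed (use K in simp)

lemma frame_context_scalar:
  "K \<in> frames \<Longrightarrow> K s \<in> contexts R m \<Longrightarrow> s \<in> scalar_trees \<Longrightarrow> t \<in> scalar_trees \<Longrightarrow> K t \<in> contexts R m"
  using frame_context by (simp add: scalar_trees_def)

text \<open>
  Contraction applies only to vertices all of whose inputs are leaves, so a hole-free subtree is
  contracted from its leaves upwards. The list version provides the step for the inputs of one vertex.
\<close>

lemma ctx_class_scalar_list:
  assumes K: "K \<in> frames"
    and each: "\<And>t K. t \<in> set ts \<Longrightarrow> K \<in> frames \<Longrightarrow> K t \<in> contexts R m \<Longrightarrow> ctx_class (K t) = ctx_class (K (Leaf (scalar_value t)))"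
    and ctx: "K (Node (us @ ts @ vs)) \<in> contexts R m" and ts: "set ts \<subseteq> scalar_trees"
  shows "ctx_class (K (Node (us @ ts @ vs))) = ctx_class (K (Node (us @ map Leaf (map scalar_value ts) @ vs)))
    \<and> K (Node (us @ map Leaf (map scalar_value ts) @ vs)) \<in> contexts R m"
  using each ctx ts
proof (induction ts arbitrary: us)
  case (Cons t ts)
  let ?K = "\<lambda>s. K (Node (us @ s # ts @ vs))"
  have K': "?K \<in> frames" using frames_comp[OF K frames_Node] .
  have t: "?K t \<in> contexts R m" using Cons.prems(2) by simp
  have t2: "?K (Leaf (scalar_value t)) \<in> contexts R m"
    using frame_context_scalar[OF K' t] Cons.prems(3) scalar_value_closed by simp
  have 1: "ctx_class (?K t) = ctx_class (?K (Leaf (scalar_value t)))"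
    using Cons.prems(1)[of t ?K] K' t by simp
  have "ctx_class (K (Node ((us @ [Leaf (scalar_value t)]) @ ts @ vs)))
      = ctx_class (K (Node ((us @ [Leaf (scalar_value t)]) @ map Leaf (map scalar_value ts) @ vs)))
    \<and> K (Node ((us @ [Leaf (scalar_value t)]) @ map Leaf (map scalar_value ts) @ vs)) \<in> contexts R m"
    using Cons.prems t2 by (intro Cons.IH) auto
  then show ?case using 1 by simp
qed simp

lemma ctx_class_scalar:
  "t \<in> scalar_trees \<Longrightarrow> K \<in> frames \<Longrightarrow> K t \<in> contexts R m \<Longrightarrow> ctx_class (K t) = ctx_class (K (Leaf (scalar_value t)))"
proof (induction t arbitrary: K)
  case (Node ts)
  have ts: "set ts \<subseteq> scalar_trees" "length ts = m + 1" using Node.prems(1) by simp_all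
  have "ctx_class (K (Node ([] @ ts @ []))) = ctx_class (K (Node ([] @ map Leaf (map scalar_value ts) @ [])))
    \<and> K (Node ([] @ map Leaf (map scalar_value ts) @ [])) \<in> contexts R m"
    using Node ts by (intro ctx_class_scalar_list) auto
  then show ?case
    using ctx_class_contract[OF Node.prems(2), of "map scalar_value ts"] ts scalar_values_closed[OF ts(1)]
    by (simp del: map_map)
qed (simp_all add: scalar_trees_def)

lemma slot_context:
  "p \<in> slot_ops R m \<Longrightarrow> Node (map Leaf (fst p) @ Hole # map Leaf (snd p)) \<in> contexts R m"
  using Node_context[of "map Leaf (fst p)" Hole "map Leaf (snd p)"] scalar_Leafs(1)[of "fst p"] scalar_Leafs(1)[of "snd p"]
  by (auto simp: slot_ops_def)

lemma slot_elt_ctx_class: "slot_elt R m (as, bs) = ctx_class (Node (map Leaf as @ Hole # map Leaf bs))"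
  by (simp add: slot_elt_def ctx_class_def env_class_def)

lemma slot_elt_closed [simp, intro]: "p \<in> slot_ops R m \<Longrightarrow> slot_elt R m p \<in> carrier U"
  using slot_context[of p] by (cases p) (simp add: slot_elt_ctx_class)

lemma slot_ops_values:
  "set ls \<subseteq> scalar_trees \<Longrightarrow> set rs \<subseteq> scalar_trees \<Longrightarrow> length ls + length rs = m
    \<Longrightarrow> (map scalar_value ls, map scalar_value rs) \<in> slot_ops R m"
  using scalar_values_closed[of ls] scalar_values_closed[of rs] by (simp add: slot_ops_def)

text \<open>
  After contraction of its hole-free inputs, the lowest vertex becomes a one-vertex context onto which
  the rest is grafted. Consequently slot elements generate the envelope.
\<close>

theorem ctx_class_Node:
  assumes "set ls \<subseteq> scalar_trees" "t \<in> contexts R m" "set rs \<subseteq> scalar_trees" "length ls + length rs = m"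
  shows "ctx_class (Node (ls @ t # rs)) = slot_elt R m (map scalar_value ls, map scalar_value rs) \<otimes>\<^bsub>U\<^esub> ctx_class t"
proof -
  let ?ls = "map Leaf (map scalar_value ls)" and ?rs = "map Leaf (map scalar_value rs)"
  have c: "Node (ls @ t # rs) \<in> contexts R m" using assms by (rule Node_context)
  have 1: "ctx_class (Node ([] @ ls @ t # rs)) = ctx_class (Node ([] @ ?ls @ t # rs)) \<and> Node ([] @ ?ls @ t # rs) \<in> contexts R m"
    using c assms ctx_class_scalar by (intro ctx_class_scalar_list[OF frames.intros(1)]) auto
  have "ctx_class (Node ((?ls @ [t]) @ rs @ [])) = ctx_class (Node ((?ls @ [t]) @ ?rs @ [])) \<and> Node ((?ls @ [t]) @ ?rs @ []) \<in> contexts R m"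
    using 1 assms ctx_class_scalar by (intro ctx_class_scalar_list[OF frames.intros(1)]) auto
  with 1 have "ctx_class (Node (ls @ t # rs)) = ctx_class (Node (?ls @ t # ?rs))" by simp
  also have "Node (?ls @ t # ?rs) = graft (Node (?ls @ Hole # ?rs)) t" by (simp add: comp_def)
  also have "ctx_class \<dots> = slot_elt R m (map scalar_value ls, map scalar_value rs) \<otimes>\<^bsub>U\<^esub> ctx_class t"
    using slot_context[OF slot_ops_values[OF assms(1,3,4)]] assms(2) unfolding slot_elt_ctx_class
    by (intro ctx_class_graft) simp_all
  finally show ?thesis .
qed

theorem U_induct [consumes 1, case_names zero one slot lin]:
  assumes u: "u \<in> carrier U" and zero: "P \<zero>\<^bsub>U\<^esub>" and one: "P \<one>\<^bsub>U\<^esub>"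
    and slot: "\<And>p u. p \<in> slot_ops R m \<Longrightarrow> u \<in> carrier U \<Longrightarrow> P u \<Longrightarrow> P (slot_elt R m p \<otimes>\<^bsub>U\<^esub> u)"
    and lin: "\<And>r u w. r \<in> carrier R \<Longrightarrow> u \<in> carrier U \<Longrightarrow> w \<in> carrier U \<Longrightarrow> P u \<Longrightarrow> P w \<Longrightarrow> P (r \<odot>\<^bsub>U\<^esub> u \<oplus>\<^bsub>U\<^esub> w)"
  shows "P u"
proof -
  have ctx_class: "P (ctx_class C)" if "C \<in> contexts R m" for C
    using that
  proof (induction rule: context_induct)
    case Hole
    then show ?case using one by (simp add: U_one_ctx_class)
  next
    case (Node ls t rs)
    then show ?case using slot[OF slot_ops_values[of ls rs]] by (simp add: ctx_class_Node)
  qed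
  obtain f where f: "f \<in> carrier Ctx" "u = env_class f" using u by (rule U_cases)
  have "P (env_class f)" using f(1)
  proof (induction rule: Ctx_induct)
    case zero
    then show ?case using assms(2) by (simp add: env_class_zero)
  next
    case (add r C g)
    have "ctx_monom r C = r \<odot>\<^bsub>Ctx\<^esub> ctx_elt R C"
      using add by (auto simp: Ctx_simps ctx_monom_def ctx_elt_def fun_eq_iff)
    then have "env_class (ctx_monom r C \<oplus>\<^bsub>Ctx\<^esub> g) = r \<odot>\<^bsub>U\<^esub> ctx_class C \<oplus>\<^bsub>U\<^esub> env_class g"
      using add by (simp add: env_class_add env_class_smult ctx_class_def)
    then show ?case using add lin[of r "ctx_class C" "env_class g"] ctx_class by simp
  qed
  then show ?thesis using f by simp
qed

section \<open>Modules over the envelope are anchored slot modules\<close>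

lemma slot_elt_linear:
  assumes "(as, bs) \<in> slot_ops R m" "r \<in> carrier R" "a \<in> carrier T" "b \<in> carrier T"
  shows "i < length as \<Longrightarrow> slot_elt R m (as[i := r \<odot>\<^bsub>T\<^esub> a \<oplus>\<^bsub>T\<^esub> b], bs)
      = r \<odot>\<^bsub>U\<^esub> slot_elt R m (as[i := a], bs) \<oplus>\<^bsub>U\<^esub> slot_elt R m (as[i := b], bs)"
    and "i < length bs \<Longrightarrow> slot_elt R m (as, bs[i := r \<odot>\<^bsub>T\<^esub> a \<oplus>\<^bsub>T\<^esub> b])
      = r \<odot>\<^bsub>U\<^esub> slot_elt R m (as, bs[i := a]) \<oplus>\<^bsub>U\<^esub> slot_elt R m (as, bs[i := b])"
proof -
  have p: "set as \<subseteq> carrier T" "set bs \<subseteq> carrier T" "length as + length bs = m"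
    using assms(1) by (auto simp: slot_ops_def)
  have sub: "set (us[i := c]) \<subseteq> carrier T" if "set us \<subseteq> carrier T" "c \<in> carrier T" for us c
    using that set_update_subset_insert[of us i c] by auto
  show "slot_elt R m (as[i := r \<odot>\<^bsub>T\<^esub> a \<oplus>\<^bsub>T\<^esub> b], bs)
      = r \<odot>\<^bsub>U\<^esub> slot_elt R m (as[i := a], bs) \<oplus>\<^bsub>U\<^esub> slot_elt R m (as[i := b], bs)" if i: "i < length as"
  proof -
    let ?K = "\<lambda>t. Node (map Leaf (take i as) @ t # (map Leaf (drop (Suc i) as) @ Hole # map Leaf bs))"
    have e: "slot_elt R m (as[i := c], bs) = ctx_class (?K (Leaf c))" for c
      using i by (simp add: slot_elt_ctx_class upd_conv_take_nth_drop)
    have "(as[i := a], bs) \<in> slot_ops R m" using p sub[OF p(1) assms(3)] by (simp add: slot_ops_def)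
    then have "?K (Leaf a) \<in> contexts R m"
      using slot_context[of "(as[i := a], bs)"] i by (simp add: upd_conv_take_nth_drop)
    then show ?thesis unfolding e using assms by (intro ctx_class_affine frames_Node) auto
  qed
  show "slot_elt R m (as, bs[i := r \<odot>\<^bsub>T\<^esub> a \<oplus>\<^bsub>T\<^esub> b])
      = r \<odot>\<^bsub>U\<^esub> slot_elt R m (as, bs[i := a]) \<oplus>\<^bsub>U\<^esub> slot_elt R m (as, bs[i := b])" if i: "i < length bs"
  proof -
    let ?K = "\<lambda>t. Node ((map Leaf as @ Hole # map Leaf (take i bs)) @ t # map Leaf (drop (Suc i) bs))"
    have e: "slot_elt R m (as, bs[i := c]) = ctx_class (?K (Leaf c))" for c
      using i by (simp add: slot_elt_ctx_class upd_conv_take_nth_drop)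
    have "(as, bs[i := a]) \<in> slot_ops R m" using p sub[OF p(2) assms(3)] by (simp add: slot_ops_def)
    then have "?K (Leaf a) \<in> contexts R m"
      using slot_context[of "(as, bs[i := a])"] i by (simp add: upd_conv_take_nth_drop)
    then show ?thesis unfolding e using assms by (intro ctx_class_affine frames_Node) auto
  qed
qed

lemma slot_elt_anchor:
  "slot_elt R m ([], replicate m \<one>\<^bsub>T\<^esub>) = \<one>\<^bsub>U\<^esub>" "slot_elt R m (replicate m \<one>\<^bsub>T\<^esub>, []) = \<one>\<^bsub>U\<^esub>"
proof -
  have p: "([], replicate m \<one>\<^bsub>T\<^esub>) \<in> slot_ops R m" "(replicate m \<one>\<^bsub>T\<^esub>, []) \<in> slot_ops R m"
    by (auto simp: slot_ops_def)
  show "slot_elt R m ([], replicate m \<one>\<^bsub>T\<^esub>) = \<one>\<^bsub>U\<^esub>" "slot_elt R m (replicate m \<one>\<^bsub>T\<^esub>, []) = \<one>\<^bsub>U\<^esub>"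
    unfolding slot_elt_ctx_class U_one_ctx_class using slot_context[OF p(1)] slot_context[OF p(2)] relations_ideal
    by (simp_all add: anchor_rels_def Ctx_one_elt ctx_class_eqI)
qed

lemma alg_moduleD:
  assumes "alg_module R U V act"
  shows "module R V"
    and "u \<in> carrier U \<Longrightarrow> act u \<in> module_hom R V V"
    and "u \<in> carrier U \<Longrightarrow> x \<in> carrier V \<Longrightarrow> act u x \<in> carrier V"
    and "u \<in> carrier U \<Longrightarrow> w \<in> carrier U \<Longrightarrow> x \<in> carrier V \<Longrightarrow> act (u \<oplus>\<^bsub>U\<^esub> w) x = act u x \<oplus>\<^bsub>V\<^esub> act w x"
    and "u \<in> carrier U \<Longrightarrow> r \<in> carrier R \<Longrightarrow> x \<in> carrier V \<Longrightarrow> act (r \<odot>\<^bsub>U\<^esub> u) x = r \<odot>\<^bsub>V\<^esub> act u x"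
    and "u \<in> carrier U \<Longrightarrow> w \<in> carrier U \<Longrightarrow> x \<in> carrier V \<Longrightarrow> act (u \<otimes>\<^bsub>U\<^esub> w) x = act u (act w x)"
    and "x \<in> carrier V \<Longrightarrow> act \<one>\<^bsub>U\<^esub> x = x"
    and "x \<in> carrier V \<Longrightarrow> act \<zero>\<^bsub>U\<^esub> x = \<zero>\<^bsub>V\<^esub>"
proof -
  note * = assms[unfolded alg_module_def]
  show V: "module R V" using * by blast
  show hom: "act u \<in> module_hom R V V" if "u \<in> carrier U" for u using * that by blast
  show cl: "act u x \<in> carrier V" if "u \<in> carrier U" "x \<in> carrier V" for u x
    using hom[OF that(1)] that(2) by (auto simp: module_hom_def)
  show add: "act (u \<oplus>\<^bsub>U\<^esub> w) x = act u x \<oplus>\<^bsub>V\<^esub> act w x" if "u \<in> carrier U" "w \<in> carrier U" "x \<in> carrier V" for u w x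
    using * that R.one_closed by blast
  show "act (r \<odot>\<^bsub>U\<^esub> u) x = r \<odot>\<^bsub>V\<^esub> act u x" if "u \<in> carrier U" "r \<in> carrier R" "x \<in> carrier V" for u r x
    using * that by blast
  show "act (u \<otimes>\<^bsub>U\<^esub> w) x = act u (act w x)" if "u \<in> carrier U" "w \<in> carrier U" "x \<in> carrier V" for u w x
    using * that R.one_closed by blast
  show "act \<one>\<^bsub>U\<^esub> x = x" if "x \<in> carrier V" for x using * that by blast
  interpret V: module R V by (rule V)
  interpret U: module R U by (rule U_module)
  show "act \<zero>\<^bsub>U\<^esub> x = \<zero>\<^bsub>V\<^esub>" if "x \<in> carrier V" for x
    using add[of "\<zero>\<^bsub>U\<^esub>" "\<zero>\<^bsub>U\<^esub>" x] cl[of "\<zero>\<^bsub>U\<^esub>" x] that by (simp add: V.M.add.r_cancel_one)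
qed

lemma ctx_op_induced:
  assumes act: "alg_module R U V act" and C: "C \<in> contexts R m" and x: "x \<in> carrier V"
  shows "ctx_op (induced_slots R m act) C x = act (ctx_class C) x"
  using C
proof (induction rule: context_induct)
  case Hole
  then show ?case using alg_moduleD(7)[OF act x] by (simp flip: U_one_ctx_class)
next
  case (Node ls t rs)
  then show ?case
    using x slot_ops_values[of ls rs]
    by (simp add: ctx_op_Node ctx_class_Node induced_slots_def alg_moduleD(6)[OF act])
qed

text \<open>
  Contexts act on the module as their classes in the envelope do (\<open>ctx_op_induced\<close>), and classes are invariant under the
  associativity moves.
\<close>

theorem induced_anchored:
  assumes act: "alg_module R U V act"
  shows "anchored_slot_module R m V (induced_slots R m act)"
proof -
  have act_lin: "act (r \<odot>\<^bsub>U\<^esub> u \<oplus>\<^bsub>U\<^esub> w) x = r \<odot>\<^bsub>V\<^esub> act u x \<oplus>\<^bsub>V\<^esub> act w x"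
    if "r \<in> carrier R" "u \<in> carrier U" "w \<in> carrier U" "x \<in> carrier V" for r u w x
    using that module.smult_closed[OF U_module] by (simp add: alg_moduleD(4,5)[OF act])
  have sub: "set (us[i := c]) \<subseteq> carrier T" if "set us \<subseteq> carrier T" "c \<in> carrier T" for us c i
    using that set_update_subset_insert[of us i c] by auto
  show ?thesis
    unfolding anchored_slot_module_def slot_module_def
  proof (intro conjI ballI)
    show "module R V" by (rule alg_moduleD(1)[OF act])
    show "induced_slots R m act p \<in> module_hom R V V" if "p \<in> slot_ops R m" for p
      using that by (simp add: alg_moduleD(2)[OF act] induced_slots_def)
    fix p assume p: "p \<in> slot_ops R m"
    obtain as bs where [simp]: "p = (as, bs)" by (cases p)
    have q: "(as[i := c], bs) \<in> slot_ops R m" "(as, bs[i := c]) \<in> slot_ops R m" if "c \<in> carrier T" for c i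
      using p that sub[of as c i] sub[of bs c i] by (auto simp: slot_ops_def)
    show "case p of (as, bs) \<Rightarrow> \<forall>r\<in>carrier R. \<forall>a\<in>carrier T. \<forall>b\<in>carrier T. \<forall>x\<in>carrier V.
          (\<forall>i<length as. induced_slots R m act (as[i := r \<odot>\<^bsub>T\<^esub> a \<oplus>\<^bsub>T\<^esub> b], bs) x
             = r \<odot>\<^bsub>V\<^esub> induced_slots R m act (as[i := a], bs) x \<oplus>\<^bsub>V\<^esub> induced_slots R m act (as[i := b], bs) x)
        \<and> (\<forall>i<length bs. induced_slots R m act (as, bs[i := r \<odot>\<^bsub>T\<^esub> a \<oplus>\<^bsub>T\<^esub> b]) x
             = r \<odot>\<^bsub>V\<^esub> induced_slots R m act (as, bs[i := a]) x \<oplus>\<^bsub>V\<^esub> induced_slots R m act (as, bs[i := b]) x)"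
      using p q by (simp add: induced_slots_def slot_elt_linear act_lin)
  next
    fix p assume p: "p \<in> assoc_moves R m"
    obtain C D where [simp]: "p = (C, D)" by (cases p)
    show "case p of (C, D) \<Rightarrow> \<forall>x\<in>carrier V. tree_value (mu R m) (induced_slots R m act) x C
        = tree_value (mu R m) (induced_slots R m act) x D"
      using p assoc_moves_contexts[of C D] ctx_class_assoc[of C D]
      by (simp add: tree_value_context ctx_op_induced[OF act])
  next
    fix x assume "x \<in> carrier V"
    then show "induced_slots R m act ([], replicate m \<one>\<^bsub>T\<^esub>) x = x" "induced_slots R m act (replicate m \<one>\<^bsub>T\<^esub>, []) x = x"
      by (simp_all add: induced_slots_def slot_elt_anchor alg_moduleD(7)[OF act])
  qed
qed

text \<open>
  Slot elements generate the envelope.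
\<close>

theorem alg_module_unique:
  assumes act: "alg_module R U V act" "alg_module R U V act'"
    and eq: "\<And>p x. p \<in> slot_ops R m \<Longrightarrow> x \<in> carrier V \<Longrightarrow> act (slot_elt R m p) x = act' (slot_elt R m p) x"
    and "u \<in> carrier U" "x \<in> carrier V"
  shows "act u x = act' u x"
proof -
  have "\<forall>x\<in>carrier V. act u x = act' u x"
    using assms(4)
  proof (induction rule: U_induct)
    case zero
    show ?case by (simp add: alg_moduleD(8)[OF act(1)] alg_moduleD(8)[OF act(2)])
  next
    case one
    show ?case by (simp add: alg_moduleD(7)[OF act(1)] alg_moduleD(7)[OF act(2)])
  next
    case (slot p u)
    then show ?case
      by (simp add: alg_moduleD(3,6)[OF act(1)] alg_moduleD(3,6)[OF act(2)] eq)
  next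
    case (lin r u w)
    then show ?case
      by (simp add: alg_moduleD(4,5)[OF act(1)] alg_moduleD(4,5)[OF act(2)] module.smult_closed[OF U_module])
  qed
  then show ?thesis using assms(5) by simp
qed

theorem op_hom_induced:
  assumes act: "alg_module R U V act" "alg_module R U W act'"
  shows "op_hom R (carrier U) V act W act'
    = op_hom R (slot_ops R m) V (induced_slots R m act) W (induced_slots R m act')"
proof
  show "op_hom R (carrier U) V act W act' \<subseteq> op_hom R (slot_ops R m) V (induced_slots R m act) W (induced_slots R m act')"
    by (auto simp: op_hom_def induced_slots_def)
  show "op_hom R (slot_ops R m) V (induced_slots R m act) W (induced_slots R m act') \<subseteq> op_hom R (carrier U) V act W act'"
  proof
    fix f assume "f \<in> op_hom R (slot_ops R m) V (induced_slots R m act) W (induced_slots R m act')"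
    then have f: "f \<in> module_hom R V W"
      "\<And>p x. p \<in> slot_ops R m \<Longrightarrow> x \<in> carrier V \<Longrightarrow> f (act (slot_elt R m p) x) = act' (slot_elt R m p) (f x)"
      by (auto simp: op_hom_def induced_slots_def)
    have fc: "f x \<in> carrier W" if "x \<in> carrier V" for x using f(1) that by (auto simp: module_hom_def)
    have fa: "f (x \<oplus>\<^bsub>V\<^esub> y) = f x \<oplus>\<^bsub>W\<^esub> f y" if "x \<in> carrier V" "y \<in> carrier V" for x y
      using f(1) that by (auto simp: module_hom_def)
    have fs: "f (r \<odot>\<^bsub>V\<^esub> x) = r \<odot>\<^bsub>W\<^esub> f x" if "r \<in> carrier R" "x \<in> carrier V" for r x
      using f(1) that by (auto simp: module_hom_def)
    interpret V: module R V by (rule alg_moduleD(1)[OF act(1)])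
    interpret W: module R W by (rule alg_moduleD(1)[OF act(2)])
    interpret U: module R U by (rule U_module)
    have f0: "f \<zero>\<^bsub>V\<^esub> = \<zero>\<^bsub>W\<^esub>"
      using fa[of "\<zero>\<^bsub>V\<^esub>" "\<zero>\<^bsub>V\<^esub>"] fc[of "\<zero>\<^bsub>V\<^esub>"] by (simp add: W.M.add.r_cancel_one)
    note D = alg_moduleD(3-8)[OF act(1)] alg_moduleD(3-8)[OF act(2)]
    have "\<forall>x\<in>carrier V. f (act u x) = act' u (f x)" if "u \<in> carrier U" for u
      using that
    proof (induction rule: U_induct)
      case zero
      show ?case by (simp add: D fc f0)
    next
      case one
      show ?case by (simp add: D fc)
    next
      case (slot p u)
      then show ?case by (simp add: D fc f(2))
    next
      case (lin r u w)
      then show ?case by (simp add: D fc fa fs)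
    qed
    then show "f \<in> op_hom R (carrier U) V act W act'" using f(1) by (simp add: op_hom_def)
  qed
qed

end

context anchored_slots begin

text \<open>
  The choice of the representative does not matter, by \<open>Uan_ideal_kernel\<close>.
\<close>

definition uact :: "((nat \<Rightarrow> 'k) tree \<Rightarrow> 'k) set \<Rightarrow> 'v \<Rightarrow> 'v" where
  "uact u = act_ctx (SOME f. f \<in> carrier Ctx \<and> env_class f = u)"

lemma uact_env_class:
  assumes f: "f \<in> carrier Ctx" and x: "x \<in> carrier V"
  shows "uact (env_class f) x = act_ctx f x"
proof -
  let ?g = "SOME g. g \<in> carrier Ctx \<and> env_class g = env_class f"
  have g: "?g \<in> carrier Ctx" "env_class ?g = env_class f"
    using someI_ex[of "\<lambda>g. g \<in> carrier Ctx \<and> env_class g = env_class f"] f by auto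
  then have "?g \<ominus>\<^bsub>Ctx\<^esub> f \<in> Uan_ideal R m" using f by (simp add: env_class_eq_iff)
  then have "act_ctx (?g \<ominus>\<^bsub>Ctx\<^esub> f) x = \<zero>\<^bsub>V\<^esub>"
    using Uan_ideal_kernel x by (auto simp: act_kernel_def)
  then have "act_ctx ?g x \<ominus>\<^bsub>V\<^esub> act_ctx f x = \<zero>\<^bsub>V\<^esub>"
    using g f x by (simp add: a_minus_def act_ctx_add act_ctx_neg)
  then have "act_ctx ?g x = act_ctx f x" using g f x by simp
  then show ?thesis by (simp add: uact_def)
qed

theorem uact_module: "alg_module R U V uact"
  unfolding alg_module_def
proof (intro conjI ballI)
  show "module R V" by (rule V.module_axioms)
  fix u assume "u \<in> carrier U"
  then obtain f where f: "f \<in> carrier Ctx" "u = env_class f" by (rule U_cases)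
  show "uact u \<in> module_hom R V V"
    using act_ctx_hom[OF f(1)] f by (simp add: module_hom_def uact_env_class Pi_iff)
  fix w r x assume "w \<in> carrier U" and r: "r \<in> carrier R" and x: "x \<in> carrier V"
  then obtain g where g: "g \<in> carrier Ctx" "w = env_class g" by (elim U_cases)
  show "uact (u \<oplus>\<^bsub>U\<^esub> w) x = uact u x \<oplus>\<^bsub>V\<^esub> uact w x"
    "uact (r \<odot>\<^bsub>U\<^esub> u) x = r \<odot>\<^bsub>V\<^esub> uact u x"
    "uact (u \<otimes>\<^bsub>U\<^esub> w) x = uact u (uact w x)"
    using f g r x
    by (simp_all add: env_class_add env_class_smult env_class_mult uact_env_class act_ctx_add act_ctx_smult act_ctx_mult)
next
  fix x assume "x \<in> carrier V"
  then show "uact \<one>\<^bsub>U\<^esub> x = x"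
    by (simp add: U_simps(3) uact_env_class) (simp add: Ctx_one_elt act_ctx_elt)
qed

lemma uact_slot:
  assumes "p \<in> slot_ops R m" "x \<in> carrier V"
  shows "uact (slot_elt R m p) x = lam p x"
proof -
  obtain as bs where p: "p = (as, bs)" by (cases p)
  have s: "set as \<subseteq> carrier T" "set bs \<subseteq> carrier T" using assms(1) p by (auto simp: slot_ops_def)
  have "uact (slot_elt R m p) x = ctx_op lam (Node (map Leaf as @ Hole # map Leaf bs)) x"
    using slot_context[OF assms(1)] assms(2) by (simp add: p slot_elt_ctx_class ctx_class_def uact_env_class act_ctx_elt)
  also have "\<dots> = lam p x"
    using ctx_op_Node[of "map Leaf as" Hole "map Leaf bs" lam x] scalar_Leafs[OF s(1)] scalar_Leafs[OF s(2)]
    by (simp add: p del: map_map)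
  finally show ?thesis .
qed

end

section \<open>The envelope is a product of matrix algebras\<close>

context twisted_nary begin

text \<open>
  The action of the envelope is determined by the slot operations, so homomorphisms respect it.
\<close>

lemma op_hom_uact:
  assumes "anchored_slots R m V lam" "anchored_slots R m W lam'"
    and f: "f \<in> op_hom R (slot_ops R m) V lam W lam'"
  shows "f \<in> op_hom R (carrier U) V (anchored_slots.uact R m V lam) W (anchored_slots.uact R m W lam')"
proof -
  interpret V: anchored_slots R m V lam by fact
  interpret W: anchored_slots R m W lam' by fact
  have "f \<in> op_hom R (slot_ops R m) V (induced_slots R m V.uact) W (induced_slots R m W.uact)"
    using f by (auto simp: op_hom_def induced_slots_def V.uact_slot W.uact_slot module_hom_def Pi_iff)
  then show ?thesis by (simp add: op_hom_induced[OF V.uact_module W.uact_module])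
qed

lemma matrix_unit_natural:
  assumes "anchored_slots R m V lam" "anchored_slots R m W lam'"
    and f: "f \<in> op_hom R (slot_ops R m) V lam W lam'" and x: "x \<in> carrier V"
  shows "f (anchored_slots.matrix_unit R m lam d q r x) = anchored_slots.matrix_unit R m lam' d q r (f x)"
proof -
  interpret V: anchored_slots R m V lam by fact
  interpret W: anchored_slots R m W lam' by fact
  have "f (lam p y) = lam' p (f y)" if "p \<in> slot_ops R m" "y \<in> carrier V" for p y
    using f that by (simp add: op_hom_def)
  then show ?thesis
    using x by (simp add: V.matrix_unit_def W.matrix_unit_def V.lmul_def W.lmul_def V.shift_def W.shift_def V.rmul_def W.rmul_def)
qed

abbreviation "Mats \<equiv> prod_alg {..<m} (\<lambda>_. mat_alg R m)"

lemma Mats_simps: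
  "carrier Mats = {..<m} \<rightarrow>\<^sub>E (({..<m} \<times> {..<m}) \<rightarrow>\<^sub>E carrier R)"
  by (simp add: prod_alg_def mat_alg_def)

lemma Mats_app:
  assumes "d < m" "q < m" "r < m"
  shows "(x \<otimes>\<^bsub>Mats\<^esub> y) d (q, r) = (\<Oplus>l\<in>{..<m}. x d (q, l) \<otimes> y d (l, r))"
    "(x \<oplus>\<^bsub>Mats\<^esub> y) d (q, r) = x d (q, r) \<oplus> y d (q, r)"
    "(a \<odot>\<^bsub>Mats\<^esub> y) d (q, r) = a \<otimes> y d (q, r)"
    "\<one>\<^bsub>Mats\<^esub> d (q, r) = (if q = r then \<one> else \<zero>)"
  using assms by (simp_all add: prod_alg_def mat_alg_def)

lemma Mats_I:
  assumes "\<And>d q r. d < m \<Longrightarrow> q < m \<Longrightarrow> r < m \<Longrightarrow> x d (q, r) \<in> carrier R"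
    "\<And>d. d < m \<Longrightarrow> x d \<in> extensional ({..<m} \<times> {..<m})" "x \<in> extensional {..<m}"
  shows "x \<in> carrier Mats"
  unfolding Mats_simps using assms by (auto simp: PiE_def)

lemma Mats_ext:
  assumes "x \<in> carrier Mats" "y \<in> carrier Mats"
    "\<And>d q r. d < m \<Longrightarrow> q < m \<Longrightarrow> r < m \<Longrightarrow> x d (q, r) = y d (q, r)"
  shows "x = y"
proof (rule PiE_ext[OF assms(1,2)[unfolded Mats_simps]])
  fix d assume d: "d \<in> {..<m}"
  show "x d = y d"
  proof (rule PiE_ext)
    show "x d \<in> ({..<m} \<times> {..<m}) \<rightarrow>\<^sub>E carrier R"
      by (rule PiE_mem[OF assms(1)[unfolded Mats_simps] d])
    show "y d \<in> ({..<m} \<times> {..<m}) \<rightarrow>\<^sub>E carrier R"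
      by (rule PiE_mem[OF assms(2)[unfolded Mats_simps] d])
  qed (use assms(3) d in auto)
qed

lemma Mats_val: "x \<in> carrier Mats \<Longrightarrow> d < m \<Longrightarrow> q < m \<Longrightarrow> r < m \<Longrightarrow> x d (q, r) \<in> carrier R"
  unfolding Mats_simps by auto

lemma Mats_closed:
  assumes "x \<in> carrier Mats" "y \<in> carrier Mats"
  shows "x \<otimes>\<^bsub>Mats\<^esub> y \<in> carrier Mats" "x \<oplus>\<^bsub>Mats\<^esub> y \<in> carrier Mats" "a \<in> carrier R \<Longrightarrow> a \<odot>\<^bsub>Mats\<^esub> x \<in> carrier Mats" "\<one>\<^bsub>Mats\<^esub> \<in> carrier Mats"
proof -
  note v = Mats_val[OF assms(1)] Mats_val[OF assms(2)]
  have ext: "x \<otimes>\<^bsub>Mats\<^esub> y \<in> extensional {..<m}" "x \<oplus>\<^bsub>Mats\<^esub> y \<in> extensional {..<m}"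
    "a \<odot>\<^bsub>Mats\<^esub> x \<in> extensional {..<m}" "\<one>\<^bsub>Mats\<^esub> \<in> extensional {..<m}" for a
    by (simp_all add: prod_alg_def)
  have ext': "(x \<otimes>\<^bsub>Mats\<^esub> y) d \<in> extensional ({..<m} \<times> {..<m})" "(x \<oplus>\<^bsub>Mats\<^esub> y) d \<in> extensional ({..<m} \<times> {..<m})"
    "(a \<odot>\<^bsub>Mats\<^esub> x) d \<in> extensional ({..<m} \<times> {..<m})" "\<one>\<^bsub>Mats\<^esub> d \<in> extensional ({..<m} \<times> {..<m})"
    if "d < m" for a d
    using that by (simp_all add: prod_alg_def mat_alg_def)
  show "x \<otimes>\<^bsub>Mats\<^esub> y \<in> carrier Mats"
    using v by (intro Mats_I ext ext') (auto simp: Mats_app intro!: R.finsum_closed)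
  show "x \<oplus>\<^bsub>Mats\<^esub> y \<in> carrier Mats"
    using v by (intro Mats_I ext ext') (auto simp: Mats_app)
  show "a \<odot>\<^bsub>Mats\<^esub> x \<in> carrier Mats" if "a \<in> carrier R"
    using v that by (intro Mats_I ext ext') (auto simp: Mats_app)
  show "\<one>\<^bsub>Mats\<^esub> \<in> carrier Mats"
    by (intro Mats_I ext ext') (auto simp: Mats_app)
qed

text \<open>
  The matrices by which an element of the envelope acts on the standard modules; column \<open>r\<close> is the
  image of the coordinate vector \<open>\<epsilon>\<^sub>r\<close>.
\<close>

definition block_matrices :: "((nat \<Rightarrow> 'k) tree \<Rightarrow> 'k) set \<Rightarrow> nat \<Rightarrow> nat \<times> nat \<Rightarrow> 'k" where
  "block_matrices u = (\<lambda>d\<in>{..<m}. \<lambda>(q, r)\<in>{..<m} \<times> {..<m}. std.uact d u (eps R m r) q)"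

lemma block_matrices_app: "d < m \<Longrightarrow> q < m \<Longrightarrow> r < m \<Longrightarrow> block_matrices u d (q, r) = std.uact d u (eps R m r) q"
  by (simp add: block_matrices_def)

lemma std_uact_closed [simp]: "u \<in> carrier U \<Longrightarrow> x \<in> carrier T \<Longrightarrow> std.uact d u x \<in> carrier T"
  using alg_moduleD(3)[OF std.uact_module] .

lemma block_matrices_closed: "u \<in> carrier U \<Longrightarrow> block_matrices u \<in> carrier Mats"
  by (rule Mats_I) (auto simp: block_matrices_app, simp_all add: block_matrices_def)

lemma std_uact_expand:
  assumes "u \<in> carrier U" "x \<in> carrier T" "q < m"
  shows "std.uact d u x q = (\<Oplus>l\<in>{..<m}. x l \<otimes> std.uact d u (eps R m l) q)"
proof -
  have "std.uact d u x = std.uact d u (\<Oplus>\<^bsub>T\<^esub>l\<in>{..<m}. x l \<odot>\<^bsub>T\<^esub> eps R m l)"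
    using T_expand[OF assms(2)] by simp
  also have "\<dots> = (\<Oplus>\<^bsub>T\<^esub>l\<in>{..<m}. std.uact d u (x l \<odot>\<^bsub>T\<^esub> eps R m l))"
    by (rule module_hom_finsum[OF T_module T_module alg_moduleD(2)[OF std.uact_module assms(1)]]) (use assms in auto)
  also have "\<dots> = (\<Oplus>\<^bsub>T\<^esub>l\<in>{..<m}. x l \<odot>\<^bsub>T\<^esub> std.uact d u (eps R m l))"
    using assms alg_moduleD(2)[OF std.uact_module, of u] by (intro T.finsum_cong') (auto simp: module_hom_def)
  finally have "std.uact d u x q = (\<Oplus>\<^bsub>T\<^esub>l\<in>{..<m}. x l \<odot>\<^bsub>T\<^esub> std.uact d u (eps R m l)) q"
    by (rule fun_cong)
  also have "\<dots> = (\<Oplus>l\<in>{..<m}. (x l \<odot>\<^bsub>T\<^esub> std.uact d u (eps R m l)) q)"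
    using assms by (intro T_finsum_app) auto
  also have "\<dots> = (\<Oplus>l\<in>{..<m}. x l \<otimes> std.uact d u (eps R m l) q)"
    using assms by (intro R.finsum_cong') (auto simp: T_app)
  finally show ?thesis .
qed

lemma block_matrices_mult:
  assumes "u \<in> carrier U" "w \<in> carrier U"
  shows "block_matrices (u \<otimes>\<^bsub>U\<^esub> w) = block_matrices u \<otimes>\<^bsub>Mats\<^esub> block_matrices w"
proof (rule Mats_ext)
  fix d q r assume *: "d < m" "q < m" "r < m"
  have "block_matrices (u \<otimes>\<^bsub>U\<^esub> w) d (q, r) = std.uact d u (std.uact d w (eps R m r)) q"
    using * assms by (simp add: block_matrices_app alg_moduleD(6)[OF std.uact_module])
  also have "\<dots> = (\<Oplus>l\<in>{..<m}. std.uact d w (eps R m r) l \<otimes> std.uact d u (eps R m l) q)"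
    using * assms by (intro std_uact_expand) auto
  also have "\<dots> = (\<Oplus>l\<in>{..<m}. block_matrices u d (q, l) \<otimes> block_matrices w d (l, r))"
    using * assms by (intro R.finsum_cong') (auto simp: block_matrices_app R.m_comm)
  finally show "block_matrices (u \<otimes>\<^bsub>U\<^esub> w) d (q, r) = (block_matrices u \<otimes>\<^bsub>Mats\<^esub> block_matrices w) d (q, r)"
    using * by (simp add: Mats_app)
qed (use assms in \<open>auto intro!: block_matrices_closed Mats_closed\<close>)

lemma block_matrices_add:
  assumes "u \<in> carrier U" "w \<in> carrier U"
  shows "block_matrices (u \<oplus>\<^bsub>U\<^esub> w) = block_matrices u \<oplus>\<^bsub>Mats\<^esub> block_matrices w"
proof -
  interpret U: module R U by (rule U_module)
  show ?thesis
    by (rule Mats_ext) (use assms in \<open>auto intro!: block_matrices_closed Mats_closed simp: block_matrices_app Mats_app T_app alg_moduleD(4)[OF std.uact_module]\<close>)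
qed

lemma block_matrices_smult:
  assumes "u \<in> carrier U" "a \<in> carrier R"
  shows "block_matrices (a \<odot>\<^bsub>U\<^esub> u) = a \<odot>\<^bsub>Mats\<^esub> block_matrices u"
proof -
  interpret U: module R U by (rule U_module)
  show ?thesis
    by (rule Mats_ext) (use assms in \<open>auto intro!: block_matrices_closed Mats_closed simp: block_matrices_app Mats_app T_app alg_moduleD(5)[OF std.uact_module]\<close>)
qed

lemma block_matrices_one: "block_matrices \<one>\<^bsub>U\<^esub> = \<one>\<^bsub>Mats\<^esub>"
proof (rule Mats_ext)
  show "\<one>\<^bsub>Mats\<^esub> \<in> carrier Mats" using Mats_closed(4) block_matrices_closed[of "\<one>\<^bsub>U\<^esub>"] by blast
qed (auto intro!: block_matrices_closed simp: block_matrices_app Mats_app eps_app alg_moduleD(7)[OF std.uact_module])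

end

context anchored_slots begin

text \<open>
  The homomorphism \<open>from_std d r x\<close> sends \<open>\<epsilon>\<^sub>r\<close> to \<open>matrix_unit d r r x\<close> and commutes with the
  envelope, so the image of \<open>\<epsilon>\<^sub>r\<close> in \<open>std d\<close> determines the left-hand side.
\<close>

lemma uact_matrix_unit:
  assumes u: "u \<in> carrier U" and x: "x \<in> carrier V" and r: "d < m" "r < m"
  shows "uact u (matrix_unit d r r x) = (\<Oplus>\<^bsub>V\<^esub>q\<in>{..<m}. block_matrices u d (q, r) \<odot>\<^bsub>V\<^esub> matrix_unit d q r x)"
proof -
  have "from_std d r x \<in> op_hom R (carrier U) T (std.uact d) V uact"
    using op_hom_uact[OF std.anchored_slots_axioms anchored_slots_axioms from_std_hom[OF x r(2)]] .
  then have "from_std d r x (std.uact d u (eps R m r)) = uact u (from_std d r x (eps R m r))"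
    using u by (simp add: op_hom_def)
  moreover have "from_std d r x (std.uact d u (eps R m r)) = (\<Oplus>\<^bsub>V\<^esub>q\<in>{..<m}. block_matrices u d (q, r) \<odot>\<^bsub>V\<^esub> matrix_unit d q r x)"
    unfolding from_std_def using u x r Mats_val[OF block_matrices_closed[OF u]]
    by (intro V.finsum_cong') (auto simp: block_matrices_app)
  ultimately show ?thesis
    using x r by (simp add: from_std_eps)
qed

text \<open>
  By \<open>matrix_unit_sum\<close> every vector is a sum of vectors on which the action is read off from the matrices.
\<close>

theorem uact_determined:
  assumes u: "u \<in> carrier U" and w: "w \<in> carrier U" and x: "x \<in> carrier V" and eq: "block_matrices u = block_matrices w"
  shows "uact u x = uact w x"
proof -
  have hom: "uact v x = (\<Oplus>\<^bsub>V\<^esub>q\<in>{..<m}. \<Oplus>\<^bsub>V\<^esub>d\<in>{..<m}. uact v (matrix_unit d q q x))" if v: "v \<in> carrier U" for v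
  proof -
    note h = alg_moduleD(2)[OF uact_module v]
    have hc: "y \<in> carrier V \<Longrightarrow> uact v y \<in> carrier V" for y using alg_moduleD(3)[OF uact_module v] .
    have "uact v (\<Oplus>\<^bsub>V\<^esub>q\<in>{..<m}. \<Oplus>\<^bsub>V\<^esub>d\<in>{..<m}. matrix_unit d q q x)
      = (\<Oplus>\<^bsub>V\<^esub>q\<in>{..<m}. uact v (\<Oplus>\<^bsub>V\<^esub>d\<in>{..<m}. matrix_unit d q q x))"
      using x by (intro module_hom_finsum[OF V.module_axioms V.module_axioms h]) (auto intro!: V.finsum_closed)
    also have "\<dots> = (\<Oplus>\<^bsub>V\<^esub>q\<in>{..<m}. \<Oplus>\<^bsub>V\<^esub>d\<in>{..<m}. uact v (matrix_unit d q q x))"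
      using x hc
      by (intro V.finsum_cong' module_hom_finsum[OF V.module_axioms V.module_axioms h]) (auto intro!: V.finsum_closed)
    finally show ?thesis using x by (simp add: matrix_unit_sum)
  qed
  have "uact u (matrix_unit d q q x) = uact w (matrix_unit d q q x)" if "d < m" "q < m" for d q
    using that u w x by (simp add: uact_matrix_unit eq)
  moreover have "uact w (matrix_unit d q q x) \<in> carrier V" for d q
    using x alg_moduleD(3)[OF uact_module w] by simp
  ultimately show ?thesis
    unfolding hom[OF u] hom[OF w] by (intro V.finsum_cong') (auto intro!: V.finsum_closed V.finsum_cong')
qed

end

sublocale twisted_nary \<subseteq> reg: anchored_slots R m "Uan R m" "induced_slots R m (\<otimes>\<^bsub>Uan R m\<^esub>)"
  by unfold_locales (rule induced_anchored[OF U_regular])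

context twisted_nary begin

text \<open>
  The envelope acts on itself, seen as an anchored slot module, by left multiplication.
\<close>

lemma reg_uact:
  assumes "u \<in> carrier U" "x \<in> carrier U"
  shows "reg.uact u x = u \<otimes>\<^bsub>U\<^esub> x"
proof (rule alg_module_unique[OF reg.uact_module U_regular _ assms])
  fix p x assume "p \<in> slot_ops R m" "x \<in> carrier U"
  then show "reg.uact (slot_elt R m p) x = slot_elt R m p \<otimes>\<^bsub>U\<^esub> x"
    using reg.uact_slot[of p x] by (simp only: induced_slots_def)
qed

lemma U_r_one: "u \<in> carrier U \<Longrightarrow> u \<otimes>\<^bsub>U\<^esub> \<one>\<^bsub>U\<^esub> = u"
  by (auto simp: U_simps(3) env_class_mult elim!: U_cases)

text \<open>
  An element of the envelope is recovered from its action on the unit.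
\<close>

lemma block_matrices_inj: "inj_on block_matrices (carrier U)"
proof (rule inj_onI)
  fix u w assume "u \<in> carrier U" "w \<in> carrier U" "block_matrices u = block_matrices w"
  then show "u = w"
    using reg.uact_determined[of u w "\<one>\<^bsub>U\<^esub>"] by (simp add: reg_uact U_r_one)
qed

text \<open>
  Acting on \<open>\<epsilon>\<close> is a homomorphism from the envelope to \<open>std d'\<close>, and homomorphisms commute with
  \<open>matrix_unit\<close>. So the element \<open>matrix_unit d q r \<one>\<close> of the envelope is represented by a matrix
  unit.
\<close>

lemma std_uact_unit:
  assumes "d < m" "q < m" "r < m" "d' < m" "r' < m"
  shows "std.uact d' (reg.matrix_unit d q r \<one>\<^bsub>U\<^esub>) (eps R m r') = (if d = d' \<and> r = r' then eps R m q else \<zero>\<^bsub>T\<^esub>)"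
proof -
  let ?h = "\<lambda>u. std.uact d' u (eps R m r')"
  have "?h \<in> op_hom R (slot_ops R m) U (induced_slots R m (\<otimes>\<^bsub>U\<^esub>)) T (std d')"
    unfolding op_hom_def module_hom_def
    by (auto simp: alg_moduleD[OF std.uact_module] induced_slots_def std.uact_slot)
  then have "?h (reg.matrix_unit d q r \<one>\<^bsub>U\<^esub>) = std.matrix_unit d' d q r (?h \<one>\<^bsub>U\<^esub>)"
    by (intro matrix_unit_natural[OF reg.anchored_slots_axioms std.anchored_slots_axioms]) auto
  also have "?h \<one>\<^bsub>U\<^esub> = eps R m r'" by (simp add: alg_moduleD(7)[OF std.uact_module])
  also have "std.matrix_unit d' d q r (eps R m r') = (if d = d' \<and> r = r' then eps R m q else \<zero>\<^bsub>T\<^esub>)"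
    using assms by (simp add: std_matrix_unit eps_app)
  finally show ?thesis .
qed

lemma block_matrices_surj: "block_matrices ` carrier U = carrier Mats"
proof
  show "block_matrices ` carrier U \<subseteq> carrier Mats" using block_matrices_closed by auto
  show "carrier Mats \<subseteq> block_matrices ` carrier U"
  proof
    fix y assume y: "y \<in> carrier Mats"
    let ?I = "{..<m} \<times> {..<m} \<times> {..<m}"
    let ?g = "\<lambda>(d, q, r). y d (q, r) \<odot>\<^bsub>U\<^esub> reg.matrix_unit d q r \<one>\<^bsub>U\<^esub>"
    define u where "u = (\<Oplus>\<^bsub>U\<^esub>t\<in>?I. ?g t)"
    have g: "?g \<in> ?I \<rightarrow> carrier U" using Mats_val[OF y] by auto
    have u: "u \<in> carrier U" unfolding u_def using g by (rule reg.V.finsum_closed)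
    have "block_matrices u = y"
    proof (rule Mats_ext[OF block_matrices_closed[OF u] y])
      fix d' q' r' assume *: "d' < m" "q' < m" "r' < m"
      let ?h = "\<lambda>u. std.uact d' u (eps R m r')"
      have h: "?h \<in> module_hom R U T"
        unfolding module_hom_def by (auto simp: alg_moduleD[OF std.uact_module])
      have "?h u = (\<Oplus>\<^bsub>T\<^esub>t\<in>?I. ?h (?g t))"
        unfolding u_def using g by (intro module_hom_finsum[OF U_module T_module h]) auto
      then have "?h u q' = (\<Oplus>\<^bsub>T\<^esub>t\<in>?I. ?h (?g t)) q'" by (rule fun_cong)
      also have "\<dots> = (\<Oplus>t\<in>?I. ?h (?g t) q')"
        using * Mats_val[OF y] by (intro T_finsum_app) (auto intro!: std_uact_closed)
      also have "\<dots> = (\<Oplus>t\<in>?I. if (d', q', r') = t then y d' (q', r') else \<zero>)"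
        using * Mats_val[OF y]
        by (intro R.finsum_cong') (auto simp: alg_moduleD(5)[OF std.uact_module] std_uact_unit T_app eps_app split: if_splits)
      also have "\<dots> = y d' (q', r')"
        using * Mats_val[OF y] by (intro R.finsum_singleton) auto
      finally show "block_matrices u d' (q', r') = y d' (q', r')" using * by (simp add: block_matrices_app)
    qed
    then show "y \<in> block_matrices ` carrier U" using u by blast
  qed
qed

theorem block_matrices_alg_iso: "block_matrices \<in> alg_iso R U Mats"
proof -
  have "block_matrices \<in> ring_hom U Mats"
    by (rule ring_hom_memI) (simp_all add: block_matrices_closed block_matrices_mult block_matrices_add block_matrices_one)
  then show ?thesis
    using block_matrices_inj block_matrices_surj by (simp add: alg_iso_def ring_iso_def bij_betw_def block_matrices_smult)
qed

end

section \<open>Finite sums of simple submodules\<close>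

text \<open>
  The setting in which simple and semisimple modules are defined: a module with a set of linear operators.
\<close>

locale operator_module = module R V for R :: "'k ring" (structure) and V :: "('k, 'v) module" +
  fixes Op :: "'o set" and act :: "'o \<Rightarrow> 'v \<Rightarrow> 'v"
  assumes act_hom: "p \<in> Op \<Longrightarrow> act p \<in> module_hom R V V"
begin

abbreviation "op_stable \<equiv> op_submodule R Op V act"

lemma act_closed: "p \<in> Op \<Longrightarrow> x \<in> carrier V \<Longrightarrow> act p x \<in> carrier V"
  and act_add: "p \<in> Op \<Longrightarrow> x \<in> carrier V \<Longrightarrow> y \<in> carrier V \<Longrightarrow> act p (x \<oplus>\<^bsub>V\<^esub> y) = act p x \<oplus>\<^bsub>V\<^esub> act p y"
  and act_smult: "p \<in> Op \<Longrightarrow> r \<in> carrier R \<Longrightarrow> x \<in> carrier V \<Longrightarrow> act p (r \<odot>\<^bsub>V\<^esub> x) = r \<odot>\<^bsub>V\<^esub> act p x"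
  using act_hom[of p] by (auto simp: module_hom_def)

lemma act_zero: "p \<in> Op \<Longrightarrow> act p \<zero>\<^bsub>V\<^esub> = \<zero>\<^bsub>V\<^esub>"
  using act_add[of p "\<zero>\<^bsub>V\<^esub>" "\<zero>\<^bsub>V\<^esub>"] act_closed[of p "\<zero>\<^bsub>V\<^esub>"] by (simp add: M.add.r_cancel_one)

lemma stableI:
  assumes "N \<subseteq> carrier V" "\<zero>\<^bsub>V\<^esub> \<in> N" "\<And>x y. x \<in> N \<Longrightarrow> y \<in> N \<Longrightarrow> x \<oplus>\<^bsub>V\<^esub> y \<in> N"
    "\<And>r x. r \<in> carrier R \<Longrightarrow> x \<in> N \<Longrightarrow> r \<odot>\<^bsub>V\<^esub> x \<in> N" "\<And>p x. p \<in> Op \<Longrightarrow> x \<in> N \<Longrightarrow> act p x \<in> N"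
  shows "op_stable N"
  unfolding op_submodule_def LinearCombinations.submodule_def using assms module_axioms by auto

lemma stableD:
  assumes "op_stable N"
  shows "N \<subseteq> carrier V" "\<zero>\<^bsub>V\<^esub> \<in> N" "x \<in> N \<Longrightarrow> y \<in> N \<Longrightarrow> x \<oplus>\<^bsub>V\<^esub> y \<in> N"
    "r \<in> carrier R \<Longrightarrow> x \<in> N \<Longrightarrow> r \<odot>\<^bsub>V\<^esub> x \<in> N" "p \<in> Op \<Longrightarrow> x \<in> N \<Longrightarrow> act p x \<in> N"
  using assms unfolding op_submodule_def LinearCombinations.submodule_def by auto

lemma stable_carrier: "op_stable (carrier V)"
  by (rule stableI) (auto simp: act_closed)

lemma stable_finsum:
  assumes "op_stable N" "\<And>i. i \<in> I \<Longrightarrow> g i \<in> N"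
  shows "(\<Oplus>\<^bsub>V\<^esub>i\<in>I. g i) \<in> N"
proof (cases "finite I")
  case True
  then show ?thesis using assms(2)
  proof (induction I)
    case empty
    then show ?case using stableD(2)[OF assms(1)] by simp
  next
    case (insert i I)
    then have "g \<in> I \<rightarrow> carrier V" "g i \<in> carrier V" using stableD(1)[OF assms(1)] by auto
    then show ?case using insert stableD(3)[OF assms(1)] by simp
  qed
qed (use stableD(2)[OF assms(1)] in simp)

lemma stable_restrict:
  assumes "op_stable N"
  shows "op_submodule R Op (V\<lparr>carrier := N\<rparr>) act K \<longleftrightarrow> op_stable K \<and> K \<subseteq> N"
proof -
  have "submodule R N V" using assms by (simp add: op_submodule_def)
  then have "module R (V\<lparr>carrier := N\<rparr>)" by (rule submodule_is_module)
  then show ?thesis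
    using module_axioms stableD(1)[OF assms] unfolding op_submodule_def LinearCombinations.submodule_def by auto
qed

text \<open>
  Simplicity of \<open>N\<close> expressed inside the ambient module; \<open>simple_submodule_iff\<close> relates it to simplicity of
  the restricted module.
\<close>

definition simple_submodule :: "'v set \<Rightarrow> bool" where
  "simple_submodule N \<longleftrightarrow> op_stable N \<and> N \<noteq> {\<zero>\<^bsub>V\<^esub>} \<and> (\<forall>K. op_stable K \<longrightarrow> K \<subseteq> N \<longrightarrow> K = {\<zero>\<^bsub>V\<^esub>} \<or> K = N)"

lemma simple_submodule_iff:
  "simple_submodule N \<longleftrightarrow> op_stable N \<and> op_simple R Op (V\<lparr>carrier := N\<rparr>) act"
  unfolding simple_submodule_def op_simple_def using stable_restrict by auto

definition sums :: "'v set set \<Rightarrow> 'v set" where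
  "sums F = {(\<Oplus>\<^bsub>V\<^esub>N\<in>F. g N) | g. g \<in> (\<Pi> N\<in>F. N)}"

lemma sums_stable:
  assumes "finite F" "\<And>N. N \<in> F \<Longrightarrow> op_stable N"
  shows "op_stable (sums F)"
proof (rule stableI)
  have V: "g \<in> F \<rightarrow> carrier V" if "g \<in> (\<Pi> N\<in>F. N)" for g
    using that stableD(1)[OF assms(2)] by (auto simp: Pi_iff)
  show "sums F \<subseteq> carrier V" using V by (auto simp: sums_def)
  have "\<zero>\<^bsub>V\<^esub> = (\<Oplus>\<^bsub>V\<^esub>N\<in>F. \<zero>\<^bsub>V\<^esub>)" by simp
  moreover have "(\<lambda>N. \<zero>\<^bsub>V\<^esub>) \<in> (\<Pi> N\<in>F. N)" using stableD(2)[OF assms(2)] by auto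
  ultimately show "\<zero>\<^bsub>V\<^esub> \<in> sums F" unfolding sums_def by blast
  show "x \<oplus>\<^bsub>V\<^esub> y \<in> sums F" if xy: "x \<in> sums F" "y \<in> sums F" for x y
  proof -
    obtain g h where g: "g \<in> (\<Pi> N\<in>F. N)" "x = (\<Oplus>\<^bsub>V\<^esub>N\<in>F. g N)" and h: "h \<in> (\<Pi> N\<in>F. N)" "y = (\<Oplus>\<^bsub>V\<^esub>N\<in>F. h N)"
      using xy by (auto simp: sums_def)
    have "x \<oplus>\<^bsub>V\<^esub> y = (\<Oplus>\<^bsub>V\<^esub>N\<in>F. g N \<oplus>\<^bsub>V\<^esub> h N)"
      using V[OF g(1)] V[OF h(1)] by (simp add: g h M.finsum_addf)
    moreover have "(\<lambda>N. g N \<oplus>\<^bsub>V\<^esub> h N) \<in> (\<Pi> N\<in>F. N)"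
      using g(1) h(1) stableD(3)[OF assms(2)] by (auto simp: Pi_iff)
    ultimately show ?thesis unfolding sums_def by blast
  qed
  show "r \<odot>\<^bsub>V\<^esub> x \<in> sums F" if rx: "r \<in> carrier R" "x \<in> sums F" for r x
  proof -
    obtain g where g: "g \<in> (\<Pi> N\<in>F. N)" "x = (\<Oplus>\<^bsub>V\<^esub>N\<in>F. g N)" using rx by (auto simp: sums_def)
    have "r \<odot>\<^bsub>V\<^esub> x = (\<Oplus>\<^bsub>V\<^esub>N\<in>F. r \<odot>\<^bsub>V\<^esub> g N)"
      using V[OF g(1)] rx assms(1) by (simp add: g finsum_smult_ldistr)
    moreover have "(\<lambda>N. r \<odot>\<^bsub>V\<^esub> g N) \<in> (\<Pi> N\<in>F. N)"
      using g(1) rx stableD(4)[OF assms(2)] by (auto simp: Pi_iff)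
    ultimately show ?thesis unfolding sums_def by blast
  qed
  show "act p x \<in> sums F" if px: "p \<in> Op" "x \<in> sums F" for p x
  proof -
    obtain g where g: "g \<in> (\<Pi> N\<in>F. N)" "x = (\<Oplus>\<^bsub>V\<^esub>N\<in>F. g N)" using px by (auto simp: sums_def)
    have "act p x = (\<Oplus>\<^bsub>V\<^esub>N\<in>F. act p (g N))"
      unfolding g by (rule module_hom_finsum[OF module_axioms module_axioms act_hom[OF px(1)] assms(1) V[OF g(1)]])
    moreover have "(\<lambda>N. act p (g N)) \<in> (\<Pi> N\<in>F. N)"
      using g(1) px stableD(5)[OF assms(2)] by (auto simp: Pi_iff)
    ultimately show ?thesis unfolding sums_def by blast
  qed
qed

lemma sums_upper:
  assumes "finite F" "\<And>N. N \<in> F \<Longrightarrow> op_stable N" "N \<in> F"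
  shows "N \<subseteq> sums F"
proof
  fix x assume x: "x \<in> N"
  let ?g = "\<lambda>L. if N = L then x else \<zero>\<^bsub>V\<^esub>"
  have xV: "x \<in> carrier V" using x stableD(1)[OF assms(2)[OF assms(3)]] by auto
  have e: "(\<Oplus>\<^bsub>V\<^esub>L\<in>F. ?g L) = x"
    using M.finsum_singleton[of N F "\<lambda>_. x"] assms(1,3) xV by simp
  have "?g \<in> (\<Pi> L\<in>F. L)" using x stableD(2)[OF assms(2)] by auto
  then show "x \<in> sums F" unfolding sums_def by (intro CollectI exI[of _ ?g] conjI e[symmetric])
qed

lemma sums_least:
  assumes "op_stable K" "\<And>N. N \<in> F \<Longrightarrow> N \<subseteq> K"
  shows "sums F \<subseteq> K"
proof
  fix x assume "x \<in> sums F"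
  then obtain g where "g \<in> (\<Pi> N\<in>F. N)" "x = (\<Oplus>\<^bsub>V\<^esub>N\<in>F. g N)" by (auto simp: sums_def)
  then show "x \<in> K" using assms by (auto intro!: stable_finsum)
qed

text \<open>
  If the component in \<open>N\<close> of a vanishing sum were nonzero, it would lie in the sum of the other members. As
  \<open>N\<close> is simple, all of \<open>N\<close> would lie there, and \<open>N\<close> could be omitted from the family.
\<close>

lemma minimal_family_independent:
  assumes F: "finite F" "\<And>N. N \<in> F \<Longrightarrow> simple_submodule N" "sums F = carrier V"
    and minimal: "\<And>F'. F' \<subset> F \<Longrightarrow> sums F' \<noteq> carrier V"
    and g: "g \<in> (\<Pi> N\<in>F. N)" "(\<Oplus>\<^bsub>V\<^esub>N\<in>F. g N) = \<zero>\<^bsub>V\<^esub>" and N: "N \<in> F"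
  shows "g N = \<zero>\<^bsub>V\<^esub>"
proof (rule ccontr)
  assume ne: "g N \<noteq> \<zero>\<^bsub>V\<^esub>"
  have st: "op_stable L" if "L \<in> F" for L using F(2)[OF that] by (simp add: simple_submodule_def)
  define S where "S = sums (F - {N})"
  have S: "op_stable S" unfolding S_def using F(1) st by (intro sums_stable) auto
  have gV: "g L \<in> carrier V" if "L \<in> F" for L using g(1) that stableD(1)[OF st[OF that]] by auto
  let ?y = "\<Oplus>\<^bsub>V\<^esub>L\<in>F - {N}. g L"
  have y: "?y \<in> S" unfolding S_def sums_def using g(1) by auto
  then have yV: "?y \<in> carrier V" using stableD(1)[OF S] by auto
  have "(\<Oplus>\<^bsub>V\<^esub>L\<in>F. g L) = (\<Oplus>\<^bsub>V\<^esub>L\<in>insert N (F - {N}). g L)" using N by (simp add: insert_absorb)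
  also have "\<dots> = g N \<oplus>\<^bsub>V\<^esub> ?y" using F(1) gV N by (subst M.finsum_insert) auto
  finally have "g N \<oplus>\<^bsub>V\<^esub> ?y = \<zero>\<^bsub>V\<^esub>" using g(2) by simp
  then have "g N = \<ominus>\<^bsub>V\<^esub> ?y" using yV gV[OF N] M.minus_equality by metis
  also have "\<dots> = (\<ominus> \<one>) \<odot>\<^bsub>V\<^esub> ?y" using yV by (simp add: smult_l_minus)
  also have "\<dots> \<in> S" using y by (intro stableD(4)[OF S]) auto
  finally have gS: "g N \<in> S" .
  let ?K = "N \<inter> S"
  have "op_stable ?K" using stableD[OF S] stableD[OF st[OF N]] by (intro stableI) auto
  moreover have "?K \<noteq> {\<zero>\<^bsub>V\<^esub>}" using gS g(1) N ne by auto
  ultimately have "?K = N" using F(2)[OF N] by (auto simp: simple_submodule_def)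
  then have "N \<subseteq> S" by blast
  moreover have "L \<subseteq> S" if "L \<in> F" "L \<noteq> N" for L
    unfolding S_def using F(1) st that by (intro sums_upper) auto
  ultimately have "sums F \<subseteq> S" using S by (intro sums_least) auto
  then have "sums (F - {N}) = carrier V" using F(3) stableD(1)[OF S] by (auto simp: S_def)
  then show False using minimal[of "F - {N}"] N by auto
qed

text \<open>
  A subfamily of least cardinality with the same sum is independent. Enumerating it gives the direct sum
  decomposition; uniqueness of components follows by applying independence to differences.
\<close>

theorem op_semisimple_if_sum_of_simples:
  assumes F: "finite F" "\<And>N. N \<in> F \<Longrightarrow> simple_submodule N" "sums F = carrier V"
  shows "op_semisimple R Op V act"
proof -
  let ?P = "\<lambda>F. finite F \<and> (\<forall>N\<in>F. simple_submodule N) \<and> sums F = carrier V"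
  \<comment> \<open>least cardinality implies minimality under inclusion\<close>
  obtain G where G: "?P G" "\<And>F'. ?P F' \<Longrightarrow> card G \<le> card F'"
    using ex_has_least_nat[of ?P F card] F by blast
  have minimal: "sums F' \<noteq> carrier V" if "F' \<subset> G" for F'
  proof
    assume "sums F' = carrier V"
    then have "?P F'" using that G(1) by (auto intro: finite_subset)
    then show False using G(2)[of F'] psubset_card_mono[OF _ that] G(1) by simp
  qed
  obtain h where h: "bij_betw h {..<card G} G"
    using ex_bij_betw_nat_finite[of G] G(1) by (auto simp: lessThan_atLeast0)
  then have hG: "h i \<in> G" if "i < card G" for i using that by (auto simp: bij_betw_def)
  have st: "op_stable N" if "N \<in> G" for N using G(1) that by (simp add: simple_submodule_def)
  then have GV: "N \<subseteq> carrier V" if "N \<in> G" for N using that stableD(1) by blast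
  let ?r = "card G"
  let ?inv = "the_inv_into {..<?r} h"
  have inv: "?inv (h i) = i" if "i < ?r" for i
    using that h by (intro the_inv_into_f_f) (auto simp: bij_betw_def)
  have inv_mem: "?inv N < ?r" "h (?inv N) = N" if "N \<in> G" for N
  proof -
    have hb: "inj_on h {..<?r}" "h ` {..<?r} = G" using h by (simp_all add: bij_betw_def)
    show "?inv N < ?r" using the_inv_into_into[OF hb(1), of N "{..<?r}"] that hb(2) by simp
    show "h (?inv N) = N" using f_the_inv_into_f[OF hb(1), of N] that hb(2) by simp
  qed
  have reindex: "(\<Oplus>\<^bsub>V\<^esub>N\<in>G. g N) = (\<Oplus>\<^bsub>V\<^esub>i\<in>{..<?r}. g (h i))" if "g \<in> (\<Pi> N\<in>G. N)" for g
  proof (rule M.finsum_bij[OF h])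
    show "g \<in> G \<rightarrow> carrier V" using that GV by (auto simp: Pi_iff)
  qed
  have zero: "f i = \<zero>\<^bsub>V\<^esub>" if f: "f \<in> (\<Pi> i\<in>{..<?r}. h i)" "(\<Oplus>\<^bsub>V\<^esub>i\<in>{..<?r}. f i) = \<zero>\<^bsub>V\<^esub>" and i: "i < ?r" for f i
  proof -
    have fh: "f j \<in> h j" if "j < ?r" for j using f(1) that by auto
    have g: "f \<circ> ?inv \<in> (\<Pi> N\<in>G. N)"
    proof
      fix N assume "N \<in> G"
      then show "(f \<circ> ?inv) N \<in> N" using fh[OF inv_mem(1)] inv_mem(2) by simp
    qed
    have "(\<Oplus>\<^bsub>V\<^esub>i\<in>{..<?r}. (f \<circ> ?inv) (h i)) = (\<Oplus>\<^bsub>V\<^esub>i\<in>{..<?r}. f i)"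
    proof (rule M.finsum_cong')
      show "f \<in> {..<?r} \<rightarrow> carrier V" using fh GV[OF hG] by blast
    qed (auto simp: inv)
    then have sum0: "(\<Oplus>\<^bsub>V\<^esub>N\<in>G. (f \<circ> ?inv) N) = \<zero>\<^bsub>V\<^esub>" using reindex[OF g] f(2) by simp
    have "(f \<circ> ?inv) (h i) = \<zero>\<^bsub>V\<^esub>"
    proof (rule minimal_family_independent[OF _ _ _ minimal g sum0 hG[OF i]])
      show "finite G" using G(1) by blast
      show "simple_submodule N" if "N \<in> G" for N using G(1) that by blast
      show "sums G = carrier V" using G(1) by blast
    qed
    then show ?thesis using i by (simp add: inv)
  qed
  show ?thesis
    unfolding op_semisimple_def
  proof (intro exI[of _ ?r] exI[of _ h] conjI allI impI ballI)
    fix i assume "i < ?r"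
    then have "simple_submodule (h i)" using G(1) hG by blast
    then show "op_submodule R Op V act (h i)" "op_simple R Op (V\<lparr>carrier := h i\<rparr>) act"
      by (simp_all add: simple_submodule_iff)
  next
    fix x assume x: "x \<in> carrier V"
    have mem: "f i \<in> carrier V" if "f \<in> (\<Pi>\<^sub>E i\<in>{..<?r}. h i)" "i < ?r" for f i
      using PiE_mem[OF that(1), of i] that(2) GV[OF hG[OF that(2)]] by auto
    have "x \<in> sums G" using x G(1) by blast
    then obtain g where g: "g \<in> (\<Pi> N\<in>G. N)" "x = (\<Oplus>\<^bsub>V\<^esub>N\<in>G. g N)"
      by (auto simp: sums_def)
    let ?f = "\<lambda>i\<in>{..<?r}. g (h i)"
    show "\<exists>!f. f \<in> (\<Pi>\<^sub>E i\<in>{..<?r}. h i) \<and> x = (\<Oplus>\<^bsub>V\<^esub>i\<in>{..<?r}. f i)"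
    proof (rule ex1I[of _ ?f], intro conjI)
      show f: "?f \<in> (\<Pi>\<^sub>E i\<in>{..<?r}. h i)" using g(1) hG by auto
      have "(\<Oplus>\<^bsub>V\<^esub>i\<in>{..<?r}. ?f i) = (\<Oplus>\<^bsub>V\<^esub>i\<in>{..<?r}. g (h i))"
        using mem[OF f] by (intro M.finsum_cong') auto
      then show xf: "x = (\<Oplus>\<^bsub>V\<^esub>i\<in>{..<?r}. ?f i)" using reindex[OF g(1)] g(2) by simp
      fix f' assume f': "f' \<in> (\<Pi>\<^sub>E i\<in>{..<?r}. h i) \<and> x = (\<Oplus>\<^bsub>V\<^esub>i\<in>{..<?r}. f' i)"
      have fV: "?f \<in> {..<?r} \<rightarrow> carrier V" "f' \<in> {..<?r} \<rightarrow> carrier V" using mem[OF f] mem[OF f'[THEN conjunct1]] by auto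
      \<comment> \<open>the difference of two decompositions, with the sign written as a scalar so that \<open>finsum_smult_ldistr\<close> applies\<close>
      let ?d = "\<lambda>i. f' i \<oplus>\<^bsub>V\<^esub> (\<ominus> \<one>) \<odot>\<^bsub>V\<^esub> ?f i"
      have d: "?d \<in> (\<Pi> i\<in>{..<?r}. h i)"
      proof
        fix i assume i: "i \<in> {..<?r}"
        then have s: "op_stable (h i)" using st hG by auto
        have "?f i \<in> h i" "f' i \<in> h i" using PiE_mem[OF f i] PiE_mem[OF f'[THEN conjunct1] i] .
        then show "?d i \<in> h i" by (intro stableD(3,4)[OF s]) auto
      qed
      have "(\<Oplus>\<^bsub>V\<^esub>i\<in>{..<?r}. ?d i) = (\<Oplus>\<^bsub>V\<^esub>i\<in>{..<?r}. f' i) \<oplus>\<^bsub>V\<^esub> (\<Oplus>\<^bsub>V\<^esub>i\<in>{..<?r}. (\<ominus> \<one>) \<odot>\<^bsub>V\<^esub> ?f i)"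
        using fV by (intro M.finsum_addf) (auto simp: Pi_iff)
      also have "(\<Oplus>\<^bsub>V\<^esub>i\<in>{..<?r}. (\<ominus> \<one>) \<odot>\<^bsub>V\<^esub> ?f i) = (\<ominus> \<one>) \<odot>\<^bsub>V\<^esub> (\<Oplus>\<^bsub>V\<^esub>i\<in>{..<?r}. ?f i)"
        using fV by (intro finsum_smult_ldistr[symmetric]) (auto simp: Pi_iff)
      also have "(\<Oplus>\<^bsub>V\<^esub>i\<in>{..<?r}. f' i) \<oplus>\<^bsub>V\<^esub> (\<ominus> \<one>) \<odot>\<^bsub>V\<^esub> (\<Oplus>\<^bsub>V\<^esub>i\<in>{..<?r}. ?f i) = \<zero>\<^bsub>V\<^esub>"
      proof -
        have "x \<oplus>\<^bsub>V\<^esub> (\<ominus> \<one>) \<odot>\<^bsub>V\<^esub> x = \<zero>\<^bsub>V\<^esub>" using x by (simp add: smult_l_minus M.r_neg)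
        then show ?thesis by (simp only: xf[symmetric] f'[THEN conjunct2, symmetric])
      qed
      finally have "?d i = \<zero>\<^bsub>V\<^esub>" if "i < ?r" for i using zero[OF d _ that] by blast
      then have "f' i = ?f i" if "i < ?r" for i
        using that fV by (simp add: smult_l_minus M.minus_equality Pi_iff)
          (metis M.add.inv_closed M.add.inv_inv M.minus_equality M.a_comm lessThan_iff restrict_apply')
      then show "f' = ?f" using f f' by (intro PiE_ext[of f' "{..<?r}" h ?f]) auto
    qed
  qed
qed

end

lemma op_hom_image:
  assumes "operator_module R W Op act" "operator_module R V Op act'" "f \<in> op_hom R Op W act V act'"
  shows "op_submodule R Op V act' (f ` carrier W)"
proof -
  interpret W: operator_module R W Op act by fact
  interpret V: operator_module R V Op act' by fact
  have f: "f x \<in> carrier V" "y \<in> carrier W \<Longrightarrow> f x \<oplus>\<^bsub>V\<^esub> f y = f (x \<oplus>\<^bsub>W\<^esub> y)"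
    "r \<in> carrier R \<Longrightarrow> r \<odot>\<^bsub>V\<^esub> f x = f (r \<odot>\<^bsub>W\<^esub> x)" "p \<in> Op \<Longrightarrow> act' p (f x) = f (act p x)"
    if "x \<in> carrier W" for x y r p
    using assms(3) that by (auto simp: op_hom_def module_hom_def)
  show ?thesis
  proof (rule V.stableI)
    show "\<zero>\<^bsub>V\<^esub> \<in> f ` carrier W"
      using f(3)[of "\<zero>\<^bsub>W\<^esub>" "\<zero>\<^bsub>R\<^esub>"] f(1)[of "\<zero>\<^bsub>W\<^esub>"] by (auto intro!: image_eqI[of _ _ "\<zero>\<^bsub>W\<^esub>"])
  qed (auto simp: f W.act_closed)
qed

lemma op_hom_preimage:
  assumes W: "operator_module R W Op act" and V: "operator_module R V Op act'"
    and f: "f \<in> op_hom R Op W act V act'" and K: "op_submodule R Op V act' K"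
  shows "op_submodule R Op W act {x \<in> carrier W. f x \<in> K}"
proof -
  interpret W: operator_module R W Op act by fact
  interpret V: operator_module R V Op act' by fact
  have f0: "f \<zero>\<^bsub>W\<^esub> = \<zero>\<^bsub>V\<^esub>"
    using f W.module_axioms V.module_axioms by (intro module_hom_zero) (auto simp: op_hom_def)
  show ?thesis
    using f V.stableD[OF K] by (intro W.stableI) (auto simp: op_hom_def module_hom_def W.act_closed f0)
qed

text \<open>
  Preimages of submodules are submodules, hence zero or everything. For the zero submodule this gives
  injectivity, and for submodules of the image it gives simplicity of the image.
\<close>

lemma op_hom_from_simple:
  assumes W: "operator_module R W Op act" and V: "operator_module R V Op act'"
    and f: "f \<in> op_hom R Op W act V act'" and simple: "op_simple R Op W act"
    and nz: "f ` carrier W \<noteq> {\<zero>\<^bsub>V\<^esub>}"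
  shows "inj_on f (carrier W)" "operator_module.simple_submodule R V Op act' (f ` carrier W)"
proof -
  interpret W: operator_module R W Op act by fact
  interpret V: operator_module R V Op act' by fact
  have f0: "f \<zero>\<^bsub>W\<^esub> = \<zero>\<^bsub>V\<^esub>"
    using f W.module_axioms V.module_axioms by (intro module_hom_zero) (auto simp: op_hom_def)
  have pre: "{x \<in> carrier W. f x \<in> K} = {\<zero>\<^bsub>W\<^esub>} \<or> {x \<in> carrier W. f x \<in> K} = carrier W"
    if "op_submodule R Op V act' K" for K
    using simple op_hom_preimage[OF W V f that] by (simp add: op_simple_def)
  have "V.op_stable {\<zero>\<^bsub>V\<^esub>}" by (rule V.stableI) (auto simp: V.act_zero)
  then have ker: "{x \<in> carrier W. f x \<in> {\<zero>\<^bsub>V\<^esub>}} = {\<zero>\<^bsub>W\<^esub>}"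
    using pre[of "{\<zero>\<^bsub>V\<^esub>}"] nz f0 by (auto simp: image_iff) (metis W.M.zero_closed)+
  have add: "f (x \<oplus>\<^bsub>W\<^esub> y) = f x \<oplus>\<^bsub>V\<^esub> f y" and cl: "f x \<in> carrier V"
    and sm: "r \<in> carrier R \<Longrightarrow> f (r \<odot>\<^bsub>W\<^esub> x) = r \<odot>\<^bsub>V\<^esub> f x"
    if "x \<in> carrier W" "y \<in> carrier W" for x y r
    using f that by (auto simp: op_hom_def module_hom_def)
  show "inj_on f (carrier W)"
  proof (rule inj_onI)
    fix x y assume xy: "x \<in> carrier W" "y \<in> carrier W" "f x = f y"
    have neg: "f (\<ominus>\<^bsub>W\<^esub> y) = \<ominus>\<^bsub>V\<^esub> f y"
      using sm[of y y "\<ominus>\<^bsub>R\<^esub> \<one>\<^bsub>R\<^esub>"] xy cl[of y y] by (simp add: W.smult_l_minus V.smult_l_minus)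
    have "f (x \<ominus>\<^bsub>W\<^esub> y) = \<zero>\<^bsub>V\<^esub>"
      using xy cl[of y y] by (simp add: a_minus_def add neg V.M.r_neg)
    then have "x \<ominus>\<^bsub>W\<^esub> y \<in> {x \<in> carrier W. f x \<in> {\<zero>\<^bsub>V\<^esub>}}" using xy by simp
    then have "x \<ominus>\<^bsub>W\<^esub> y = \<zero>\<^bsub>W\<^esub>" using ker by blast
    then show "x = y" using xy(1,2) by simp
  qed
  show "V.simple_submodule (f ` carrier W)"
    unfolding V.simple_submodule_def
  proof (intro conjI allI impI nz op_hom_image[OF W V f])
    fix K assume K: "V.op_stable K" "K \<subseteq> f ` carrier W"
    from pre[OF K(1)] show "K = {\<zero>\<^bsub>V\<^esub>} \<or> K = f ` carrier W"
    proof
      assume "{x \<in> carrier W. f x \<in> K} = {\<zero>\<^bsub>W\<^esub>}"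
      then have "K \<subseteq> {\<zero>\<^bsub>V\<^esub>}" using K(2) f0 by (auto simp: image_iff subset_iff) (metis (mono_tags, lifting) mem_Collect_eq singletonD)
      then show ?thesis using V.stableD(2)[OF K(1)] by auto
    next
      assume "{x \<in> carrier W. f x \<in> K} = carrier W"
      then show ?thesis using K(2) by blast
    qed
  qed
qed

lemma op_isomorphic_sym:
  assumes W: "operator_module R W Op act"
    and f: "f \<in> op_hom R Op W act V act'" "bij_betw f (carrier W) (carrier V)"
  shows "op_isomorphic R Op V act' W act"
proof -
  interpret W: operator_module R W Op act by fact
  let ?g = "the_inv_into (carrier W) f"
  have inj: "inj_on f (carrier W)" and img: "f ` carrier W = carrier V" using f(2) by (auto simp: bij_betw_def)
  have g: "bij_betw ?g (carrier V) (carrier W)" by (rule bij_betw_the_inv_into[OF f(2)])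
  have gf: "?g (f x) = x" if "x \<in> carrier W" for x using that inj by (simp add: the_inv_into_f_f)
  have "?g \<in> op_hom R Op V act' W act"
    unfolding op_hom_def module_hom_def
  proof (intro CollectI conjI allI impI ballI)
    show "?g \<in> carrier V \<rightarrow> carrier W" using g by (auto simp: bij_betw_def)
    fix y z assume "y \<in> carrier V \<and> z \<in> carrier V"
    then obtain u v where "u \<in> carrier W" "v \<in> carrier W" "y = f u" "z = f v" using img by blast
    moreover have "f u \<oplus>\<^bsub>V\<^esub> f v = f (u \<oplus>\<^bsub>W\<^esub> v)" using f(1) calculation by (simp add: op_hom_def module_hom_def)
    ultimately show "?g (y \<oplus>\<^bsub>V\<^esub> z) = ?g y \<oplus>\<^bsub>W\<^esub> ?g z" by (simp add: gf)
  next
    fix r y assume r: "r \<in> carrier R \<and> y \<in> carrier V"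
    then obtain u where "u \<in> carrier W" "y = f u" using img by blast
    moreover have "r \<odot>\<^bsub>V\<^esub> f u = f (r \<odot>\<^bsub>W\<^esub> u)" using f(1) calculation r by (simp add: op_hom_def module_hom_def)
    ultimately show "?g (r \<odot>\<^bsub>V\<^esub> y) = r \<odot>\<^bsub>W\<^esub> ?g y" using r by (simp add: gf)
  next
    fix p y assume p: "p \<in> Op" "y \<in> carrier V"
    then obtain u where "u \<in> carrier W" "y = f u" using img by blast
    moreover have "act' p (f u) = f (act p u)" using f(1) calculation p by (simp add: op_hom_def)
    ultimately show "?g (act' p y) = act p (?g y)" using p by (simp add: gf W.act_closed)
  qed
  then show ?thesis using g by (auto simp: op_isomorphic_def)
qed

section \<open>Simple modules over a field\<close>

sublocale anchored_slots \<subseteq> O: operator_module R V "slot_ops R m" lam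
  by unfold_locales (rule lam_hom)

context anchored_slots begin

lemma matrix_unit_stable:
  assumes N: "O.op_stable N" and x: "x \<in> N"
  shows "matrix_unit d q r x \<in> N"
  using x unfolding matrix_unit_def lmul_def rmul_def shift_def by (intro O.stableD(5)[OF N]) auto

text \<open>
  The vector \<open>x\<close> is a sum of images of coordinate vectors.
\<close>

lemma from_std_nonzero:
  assumes x: "x \<in> carrier V" and nz: "\<And>d q. d < m \<Longrightarrow> q < m \<Longrightarrow> from_std d q x ` carrier T = {\<zero>\<^bsub>V\<^esub>}"
  shows "x = \<zero>\<^bsub>V\<^esub>"
proof -
  have "matrix_unit d q q x = \<zero>\<^bsub>V\<^esub>" if "d < m" "q < m" for d q
    using nz[OF that] from_std_eps[OF x that(2), of d q] by (metis eps_closed image_eqI singletonD)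
  then have "(\<Oplus>\<^bsub>V\<^esub>q\<in>{..<m}. \<Oplus>\<^bsub>V\<^esub>d\<in>{..<m}. matrix_unit d q q x) = \<zero>\<^bsub>V\<^esub>"
    by (intro V.M.add.finprod_one_eqI) auto
  then show ?thesis using matrix_unit_sum[OF x] by simp
qed

end

locale twisted_nary_field = twisted_nary R m + F: field R for R :: "'k ring" (structure) and m

context twisted_nary_field begin

text \<open>
  From a vector with a nonzero coordinate the matrix units produce every coordinate vector.
\<close>

lemma std_simple: "op_simple R (slot_ops R m) T (std d)" if d: "d < m"
  unfolding op_simple_def
proof (intro conjI allI impI)
  have "eps R m 0 \<noteq> \<zero>\<^bsub>T\<^esub>"
  proof
    assume "eps R m 0 = \<zero>\<^bsub>T\<^esub>"
    then have "eps R m 0 0 = \<zero>" using m_pos by (simp add: T_app)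
    then show False using m_pos F.one_not_zero by (simp add: eps_app)
  qed
  then show "carrier T \<noteq> {\<zero>\<^bsub>T\<^esub>}" using eps_closed by blast
  fix N assume N: "std.O.op_stable d N"
  show "N = {\<zero>\<^bsub>T\<^esub>} \<or> N = carrier T"
  proof (cases "N \<subseteq> {\<zero>\<^bsub>T\<^esub>}")
    case True
    then show ?thesis using std.O.stableD(2)[OF N] by auto
  next
    case False
    then obtain c where c: "c \<in> N" "c \<noteq> \<zero>\<^bsub>T\<^esub>" by auto
    have cT: "c \<in> carrier T" using c std.O.stableD(1)[OF N] by auto
    obtain q where q: "q < m" "c q \<noteq> \<zero>"
      using c(2) cT T_ext[of c "\<zero>\<^bsub>T\<^esub>"] by (auto simp: T_app)
    have cq: "c q \<in> carrier R" "inv c q \<in> carrier R" "inv c q \<otimes> c q = \<one>"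
      using cT q by (auto simp: F.field_Units)
    have e: "eps R m t \<in> N" if t: "t < m" for t
    proof -
      have "std.matrix_unit d d t q c \<in> N" by (rule std.matrix_unit_stable[OF N c(1)])
      then have "c q \<odot>\<^bsub>T\<^esub> eps R m t \<in> N" using d t q cT by (simp add: std_matrix_unit)
      then have "inv c q \<odot>\<^bsub>T\<^esub> (c q \<odot>\<^bsub>T\<^esub> eps R m t) \<in> N" by (rule std.O.stableD(4)[OF N cq(2)])
      moreover have "inv c q \<odot>\<^bsub>T\<^esub> (c q \<odot>\<^bsub>T\<^esub> eps R m t) = eps R m t"
        using cq by (simp flip: T.smult_assoc1)
      ultimately show ?thesis by simp
    qed
    have "x \<in> N" if "x \<in> carrier T" for x
    proof -
      have "(\<Oplus>\<^bsub>T\<^esub>t\<in>{..<m}. x t \<odot>\<^bsub>T\<^esub> eps R m t) \<in> N"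
        using e that by (intro std.O.stable_finsum[OF N] std.O.stableD(4)[OF N]) auto
      then show ?thesis using T_expand[OF that] by simp
    qed
    then show ?thesis using std.O.stableD(1)[OF N] by auto
  qed
qed

lemma vectorspaceI: "module R V \<Longrightarrow> vectorspace R V"
  by (simp add: vectorspace_def F.field_axioms)

text \<open>
  The images of the coordinate vectors are a basis.
\<close>

lemma dim_of_iso:
  fixes V :: "('k, 'v) module"
  assumes V: "module R V" and f: "f \<in> module_hom R T V" "bij_betw f (carrier T) (carrier V)"
  shows "vectorspace.dim R V = m" "vectorspace.fin_dim R V"
proof -
  interpret V: vectorspace R V by (rule vectorspaceI[OF V])
  have inj: "inj_on f (carrier T)" and img: "f ` carrier T = carrier V" using f(2) by (auto simp: bij_betw_def)
  have fs: "f (r \<odot>\<^bsub>T\<^esub> x) = r \<odot>\<^bsub>V\<^esub> f x" if "r \<in> carrier R" "x \<in> carrier T" for r x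
    using f(1) that by (auto simp: module_hom_def)
  have eps_inj: "inj_on (eps R m) {..<m}"
  proof (rule inj_onI)
    fix s t assume "s \<in> {..<m}" "t \<in> {..<m}" "eps R m s = eps R m t"
    then show "s = t" using F.one_not_zero eps_app[of s s] eps_app[of s t] by (auto split: if_splits)
  qed
  define b where "b = f \<circ> eps R m"
  define A where "A = b ` {..<m}"
  have b_inj: "inj_on b {..<m}"
    unfolding b_def using eps_inj inj by (intro comp_inj_on) (auto intro: inj_on_subset)
  have bV: "b t \<in> carrier V" for t using img by (auto simp: b_def)
  have A: "finite A" "A \<subseteq> carrier V" "card A = m" using b_inj bV by (auto simp: A_def card_image)
  have comb: "V.lincomb a A = f (\<lambda>t\<in>{..<m}. a (b t))" if a: "a \<in> A \<rightarrow> carrier R" for a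
  proof -
    let ?c = "\<lambda>t\<in>{..<m}. a (b t)"
    have aR: "a (b t) \<in> carrier R" if "t < m" for t using a that by (auto simp: A_def)
    have c: "?c \<in> carrier T" using aR by (intro T_restrict) auto
    have "V.lincomb a A = (\<Oplus>\<^bsub>V\<^esub>t\<in>{..<m}. a (b t) \<odot>\<^bsub>V\<^esub> b t)"
      unfolding V.lincomb_def A_def using a bV b_inj by (intro V.M.finsum_reindex) (auto simp: A_def)
    also have "\<dots> = (\<Oplus>\<^bsub>V\<^esub>t\<in>{..<m}. f (?c t \<odot>\<^bsub>T\<^esub> eps R m t))"
      using aR bV by (intro V.M.finsum_cong') (auto simp: fs b_def)
    also have "\<dots> = f (\<Oplus>\<^bsub>T\<^esub>t\<in>{..<m}. ?c t \<odot>\<^bsub>T\<^esub> eps R m t)"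
      using aR by (intro module_hom_finsum[OF T_module V f(1), symmetric]) auto
    also have "\<dots> = f ?c" by (simp only: T_expand[OF c, symmetric])
    finally show ?thesis .
  qed
  have "V.gen_set A"
  proof
    show "V.span A \<subseteq> carrier V" using A by (intro V.span_is_subset2)
    show "carrier V \<subseteq> V.span A"
    proof
      fix x assume "x \<in> carrier V"
      then obtain c where c: "c \<in> carrier T" "x = f c" using img by blast
      let ?a = "\<lambda>v. c (the_inv_into {..<m} b v)"
      have inv: "the_inv_into {..<m} b (b t) = t" if "t < m" for t
        using that b_inj by (simp add: the_inv_into_f_f)
      have a: "?a \<in> A \<rightarrow> carrier R" using c by (auto simp: A_def inv)
      have "(\<lambda>t\<in>{..<m}. ?a (b t)) = c" using c(1) by (intro T_ext T_restrict) (auto simp: inv)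
      then have "x = V.lincomb ?a A" using comb[OF a] c by simp
      then show "x \<in> V.span A" using a A unfolding V.span_def by blast
    qed
  qed
  moreover have "V.lin_indpt A"
  proof (rule V.finite_lin_indpt2[OF A(1,2)])
    fix a assume a: "a \<in> A \<rightarrow> carrier R" "V.lincomb a A = \<zero>\<^bsub>V\<^esub>"
    let ?c = "\<lambda>t\<in>{..<m}. a (b t)"
    have c: "?c \<in> carrier T" using a(1) by (intro T_restrict) (auto simp: A_def)
    have "f ?c = f \<zero>\<^bsub>T\<^esub>" using comb[OF a(1)] a(2) module_hom_zero[OF T_module V f(1)] by simp
    then have "?c = \<zero>\<^bsub>T\<^esub>" using inj c by (simp add: inj_on_def)
    then have "a (b t) = \<zero>" if "t < m" for t using that T_app(4)[of t] by (metis lessThan_iff restrict_apply')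
    then show "\<forall>v\<in>A. a v = \<zero>" by (auto simp: A_def)
  qed
  ultimately have "V.basis A" using A by (simp add: V.basis_def)
  then show "vectorspace.dim R V = m" using V.dim_basis[OF A(1)] A(3) by simp
  show "vectorspace.fin_dim R V" using A \<open>V.gen_set A\<close> by (auto simp: V.fin_dim_def)
qed

lemma std_dim: "vectorspace.dim R T = m" "vectorspace.fin_dim R T"
  by (rule dim_of_iso[OF T_module, of id]; simp add: module_hom_def)+

lemma std_fd: "fd_anchored_slot_module R m T (std d)"
  by (simp add: fd_anchored_slot_module_def std_anchored std_dim)

text \<open>
  The operator \<open>matrix_unit d 0 0\<close> is nonzero on \<open>std d\<close> and zero on \<open>std e\<close>.
\<close>

lemma std_not_isomorphic:
  assumes "d < m" "e < m" "d \<noteq> e"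
  shows "\<not> op_isomorphic R (slot_ops R m) T (std d) T (std e)"
proof
  assume "op_isomorphic R (slot_ops R m) T (std d) T (std e)"
  then obtain f where f: "f \<in> op_hom R (slot_ops R m) T (std d) T (std e)" "bij_betw f (carrier T) (carrier T)"
    by (auto simp: op_isomorphic_def)
  have fT: "f (eps R m 0) \<in> carrier T" using f(1) by (auto simp: op_hom_def module_hom_def)
  have "f (std.matrix_unit d d 0 0 (eps R m 0)) = std.matrix_unit e d 0 0 (f (eps R m 0))"
    by (rule matrix_unit_natural[OF std.anchored_slots_axioms std.anchored_slots_axioms f(1)]) simp
  then have "f (eps R m 0) = \<zero>\<^bsub>T\<^esub>"
    using assms m_pos fT by (simp add: std_matrix_unit eps_app)
  also have "\<dots> = f \<zero>\<^bsub>T\<^esub>"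
    using f(1) by (intro module_hom_zero[symmetric, OF T_module T_module]) (simp add: op_hom_def)
  finally have "eps R m 0 = \<zero>\<^bsub>T\<^esub>" using f(2) by (simp add: bij_betw_def inj_on_def)
  then have "eps R m 0 0 = \<zero>" using m_pos by (simp add: T_app)
  then show False using m_pos F.one_not_zero by (simp add: eps_app)
qed

lemma from_std_simple:
  assumes "anchored_slots R m V lam" "x \<in> carrier V" "d < m" "r < m"
    "anchored_slots.from_std R m V lam d r x ` carrier T \<noteq> {\<zero>\<^bsub>V\<^esub>}"
  shows "inj_on (anchored_slots.from_std R m V lam d r x) (carrier T)"
    "operator_module.simple_submodule R V (slot_ops R m) lam (anchored_slots.from_std R m V lam d r x ` carrier T)"
proof -
  interpret V: anchored_slots R m V lam by fact
  show "inj_on (V.from_std d r x) (carrier T)" "V.O.simple_submodule (V.from_std d r x ` carrier T)"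
    using op_hom_from_simple[OF std.O.operator_module_axioms V.O.operator_module_axioms V.from_std_hom std_simple] assms by blast+
qed

text \<open>
  For a finite generating set, the nonzero images of the standard modules that correspond to the generators
  are finitely many simple submodules, and their sum contains every generator.
\<close>

theorem fd_semisimple:
  fixes V :: "('k, 'v) module"
  assumes "fd_anchored_slot_module R m V lam"
  shows "op_semisimple R (slot_ops R m) V lam"
proof -
  interpret V: anchored_slots R m V lam
    using assms by unfold_locales (simp add: fd_anchored_slot_module_def)
  interpret VS: vectorspace R V by (rule vectorspaceI[OF V.V.module_axioms])
  obtain A where A: "finite A" "A \<subseteq> carrier V" "V.V.span A = carrier V"
    using assms by (auto simp: fd_anchored_slot_module_def VS.fin_dim_def)
  define F where "F = (\<lambda>(x, d, r). V.from_std d r x ` carrier T) ` (A \<times> {..<m} \<times> {..<m}) - {{\<zero>\<^bsub>V\<^esub>}}"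
  have fin: "finite F" using A(1) by (simp add: F_def)
  have simple: "V.O.simple_submodule N" if N: "N \<in> F" for N
  proof -
    have "N \<in> (\<lambda>(x, d, r). V.from_std d r x ` carrier T) ` (A \<times> {..<m} \<times> {..<m})"
      by (rule DiffD1[OF N[unfolded F_def]])
    moreover have nz: "N \<noteq> {\<zero>\<^bsub>V\<^esub>}"
    proof -
      have "N \<notin> {{\<zero>\<^bsub>V\<^esub>}}" by (rule N[unfolded F_def Diff_iff, THEN conjunct2])
      then show ?thesis by (simp only: singleton_iff not_False_eq_True)
    qed
    ultimately obtain t where t: "N = (\<lambda>(x, d, r). V.from_std d r x ` carrier T) t" "t \<in> A \<times> {..<m} \<times> {..<m}"
      by (elim imageE)
    obtain x d r where xdr: "t = (x, d, r)" by (cases t)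
    then have *: "x \<in> carrier V" "d < m" "r < m" using t(2) A(2) by auto
    have "N = V.from_std d r x ` carrier T" by (simp only: t(1) xdr prod.case)
    then show ?thesis using from_std_simple(2)[OF V.anchored_slots_axioms *] nz by simp
  qed
  then have st: "V.O.op_stable N" if "N \<in> F" for N using that by (simp add: V.O.simple_submodule_def)
  note S = V.O.sums_stable[OF fin st]
  have "x \<in> V.O.sums F" if x: "x \<in> A" for x
  proof -
    have xV: "x \<in> carrier V" using x A(2) by auto
    have "V.matrix_unit d q q x \<in> V.O.sums F" if "d < m" "q < m" for d q
    proof -
      let ?N = "V.from_std d q x ` carrier T"
      have mem: "V.matrix_unit d q q x \<in> ?N"
        using V.from_std_eps[OF xV that(2), of d q] by (metis eps_closed image_eqI)
      show ?thesis
      proof (cases "?N = {\<zero>\<^bsub>V\<^esub>}")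
        case True
        then show ?thesis using mem V.O.stableD(2)[OF S] by simp
      next
        case False
        have "?N \<in> (\<lambda>(x, d, r). V.from_std d r x ` carrier T) ` (A \<times> {..<m} \<times> {..<m})"
          using x that by (intro image_eqI[of _ _ "(x, d, q)"]) simp_all
        with False have "?N \<in> F" by (simp only: F_def Diff_iff singleton_iff not_False_eq_True simp_thms)
        then show ?thesis using V.O.sums_upper[OF fin st] mem by blast
      qed
    qed
    then have "(\<Oplus>\<^bsub>V\<^esub>q\<in>{..<m}. \<Oplus>\<^bsub>V\<^esub>d\<in>{..<m}. V.matrix_unit d q q x) \<in> V.O.sums F"
      by (intro V.O.stable_finsum[OF S]) auto
    then show ?thesis using V.matrix_unit_sum[OF xV] by simp
  qed
  then have "V.V.lincomb a B \<in> V.O.sums F" if "B \<subseteq> A" "a \<in> B \<rightarrow> carrier R" for a B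
    unfolding V.V.lincomb_def using that by (intro V.O.stable_finsum[OF S] V.O.stableD(4)[OF S]) auto
  then have "V.V.span A \<subseteq> V.O.sums F" by (auto simp: V.V.span_def)
  then have "V.O.sums F = carrier V" using A(3) V.O.stableD(1)[OF S] by auto
  then show ?thesis using V.O.op_semisimple_if_sum_of_simples[OF fin simple] by blast
qed

text \<open>
  Some homomorphism from a standard module is nonzero, and between simple modules it is bijective.
\<close>

theorem simple_classification:
  fixes V :: "('k, 'v) module"
  assumes "anchored_slot_module R m V lam" and simple: "op_simple R (slot_ops R m) V lam"
  shows "vectorspace.dim R V = m" "\<exists>d<m. op_isomorphic R (slot_ops R m) V lam T (std d)"
proof -
  interpret V: anchored_slots R m V lam using assms by unfold_locales
  obtain x where x: "x \<in> carrier V" "x \<noteq> \<zero>\<^bsub>V\<^esub>"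
    using simple V.O.stableD(2)[OF V.O.stable_carrier] by (auto simp: op_simple_def)
  then obtain d q where dq: "d < m" "q < m" "V.from_std d q x ` carrier T \<noteq> {\<zero>\<^bsub>V\<^esub>}"
    using V.from_std_nonzero by blast
  let ?f = "V.from_std d q x"
  have f: "?f \<in> op_hom R (slot_ops R m) T (std d) V lam" by (rule V.from_std_hom[OF x(1) dq(2)])
  have "V.O.op_stable (?f ` carrier T)"
    by (rule op_hom_image[OF std.O.operator_module_axioms V.O.operator_module_axioms f])
  then have "?f ` carrier T = carrier V" using simple dq(3) by (auto simp: op_simple_def)
  then have bij: "bij_betw ?f (carrier T) (carrier V)"
    using from_std_simple(1)[OF V.anchored_slots_axioms x(1) dq] by (simp add: bij_betw_def)
  show "vectorspace.dim R V = m"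
    using f by (intro dim_of_iso[OF V.V.module_axioms _ bij]) (simp add: op_hom_def)
  show "\<exists>d<m. op_isomorphic R (slot_ops R m) V lam T (std d)"
    using op_isomorphic_sym[OF std.O.operator_module_axioms f bij] dq(1) by blast
qed

end

theorem corollary4p7:
  fixes R :: "'k ring" and m :: nat
  assumes "cring R" and "m \<ge> 2"
  shows
    "alg_iso R (Uan R m) (prod_alg {..<m} (\<lambda>_. mat_alg R m)) \<noteq> {}
   \<and> (field R \<longrightarrow>
       (\<comment> \<open>the two categories agree: objects\<close>
         (\<forall>(V :: ('k, 'v) module) act.
            fd_Uan_module R m V act \<longrightarrow> fd_anchored_slot_module R m V (induced_slots R m act))
       \<and> (\<forall>(V :: ('k, 'v) module) lam. fd_anchored_slot_module R m V lam \<longrightarrow>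
            (\<exists>act. fd_Uan_module R m V act
               \<and> (\<forall>p\<in>slot_ops R m. \<forall>x\<in>carrier V. induced_slots R m act p x = lam p x)
               \<and> (\<forall>act'. fd_Uan_module R m V act'
                    \<and> (\<forall>p\<in>slot_ops R m. \<forall>x\<in>carrier V. induced_slots R m act' p x = lam p x)
                    \<longrightarrow> (\<forall>u\<in>carrier (Uan R m). \<forall>x\<in>carrier V. act' u x = act u x))))
         \<comment> \<open>morphisms\<close>
       \<and> (\<forall>(V :: ('k, 'v) module) act (W :: ('k, 'w) module) act'.
            fd_Uan_module R m V act \<and> fd_Uan_module R m W act' \<longrightarrow>
            op_hom R (carrier (Uan R m)) V act W act'
            = op_hom R (slot_ops R m) V (induced_slots R m act) W (induced_slots R m act'))
         \<comment> \<open>semisimplicity\<close>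
       \<and> (\<forall>(V :: ('k, 'v) module) lam.
            fd_anchored_slot_module R m V lam \<longrightarrow> op_semisimple R (slot_ops R m) V lam)
         \<comment> \<open>exactly \<open>m\<close> simple objects, each of dimension \<open>m\<close>\<close>
       \<and> (\<exists>(S :: nat \<Rightarrow> ('k, nat \<Rightarrow> 'k) module) L.
            (\<forall>d<m. fd_anchored_slot_module R m (S d) (L d)
                 \<and> op_simple R (slot_ops R m) (S d) (L d) \<and> vectorspace.dim R (S d) = m)
          \<and> (\<forall>d<m. \<forall>e<m. d \<noteq> e \<longrightarrow>
                 \<not> op_isomorphic R (slot_ops R m) (S d) (L d) (S e) (L e))
          \<and> (\<forall>(V :: ('k, 'v) module) lam.
               fd_anchored_slot_module R m V lam \<and> op_simple R (slot_ops R m) V lam \<longrightarrow>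
               vectorspace.dim R V = m
             \<and> (\<exists>d<m. op_isomorphic R (slot_ops R m) V lam (S d) (L d))))))"
proof -
  interpret twisted_nary R m
    using assms by (simp add: twisted_nary_def twisted_nary_axioms_def)
  show ?thesis
  proof (intro conjI impI)
    show "alg_iso R (Uan R m) (prod_alg {..<m} (\<lambda>_. mat_alg R m)) \<noteq> {}"
      using block_matrices_alg_iso by blast
    assume "field R"
    then interpret twisted_nary_field R m
      by (simp add: twisted_nary_field_def twisted_nary_axioms)
    show "\<forall>(V :: ('k, 'v) module) act.
        fd_Uan_module R m V act \<longrightarrow> fd_anchored_slot_module R m V (induced_slots R m act)"
      by (simp add: fd_Uan_module_def fd_anchored_slot_module_def induced_anchored)
    show "\<forall>(V :: ('k, 'v) module) lam. fd_anchored_slot_module R m V lam \<longrightarrow>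
        (\<exists>act. fd_Uan_module R m V act
           \<and> (\<forall>p\<in>slot_ops R m. \<forall>x\<in>carrier V. induced_slots R m act p x = lam p x)
           \<and> (\<forall>act'. fd_Uan_module R m V act'
                \<and> (\<forall>p\<in>slot_ops R m. \<forall>x\<in>carrier V. induced_slots R m act' p x = lam p x)
                \<longrightarrow> (\<forall>u\<in>carrier (Uan R m). \<forall>x\<in>carrier V. act' u x = act u x)))"
    proof (intro allI impI)
      fix V :: "('k, 'v) module" and lam
      assume fd: "fd_anchored_slot_module R m V lam"
      interpret V: anchored_slots R m V lam
        using fd by unfold_locales (simp add: fd_anchored_slot_module_def)
      have "fd_Uan_module R m V V.uact"
        using fd V.uact_module by (simp add: fd_Uan_module_def fd_anchored_slot_module_def)
      moreover have "\<forall>p\<in>slot_ops R m. \<forall>x\<in>carrier V. induced_slots R m V.uact p x = lam p x"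
        by (simp add: induced_slots_def V.uact_slot)
      moreover have "act' u x = V.uact u x"
        if "fd_Uan_module R m V act'" "\<forall>p\<in>slot_ops R m. \<forall>x\<in>carrier V. induced_slots R m act' p x = lam p x"
          "u \<in> carrier U" "x \<in> carrier V" for act' u x
      proof (rule alg_module_unique[OF _ V.uact_module _ that(3,4)])
        show "alg_module R U V act'" using that(1) by (simp add: fd_Uan_module_def)
        fix p y assume "p \<in> slot_ops R m" "y \<in> carrier V"
        then show "act' (slot_elt R m p) y = V.uact (slot_elt R m p) y"
          using that(2) by (simp add: induced_slots_def V.uact_slot)
      qed
      ultimately show "\<exists>act. fd_Uan_module R m V act
           \<and> (\<forall>p\<in>slot_ops R m. \<forall>x\<in>carrier V. induced_slots R m act p x = lam p x)
           \<and> (\<forall>act'. fd_Uan_module R m V act'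
                \<and> (\<forall>p\<in>slot_ops R m. \<forall>x\<in>carrier V. induced_slots R m act' p x = lam p x)
                \<longrightarrow> (\<forall>u\<in>carrier (Uan R m). \<forall>x\<in>carrier V. act' u x = act u x))"
        by blast
    qed
    show "\<forall>(V :: ('k, 'v) module) act (W :: ('k, 'w) module) act'.
        fd_Uan_module R m V act \<and> fd_Uan_module R m W act' \<longrightarrow>
        op_hom R (carrier (Uan R m)) V act W act'
        = op_hom R (slot_ops R m) V (induced_slots R m act) W (induced_slots R m act')"
      by (simp add: fd_Uan_module_def op_hom_induced)
    show "\<forall>(V :: ('k, 'v) module) lam.
        fd_anchored_slot_module R m V lam \<longrightarrow> op_semisimple R (slot_ops R m) V lam"
      by (simp add: fd_semisimple)
    show "\<exists>(S :: nat \<Rightarrow> ('k, nat \<Rightarrow> 'k) module) L.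
        (\<forall>d<m. fd_anchored_slot_module R m (S d) (L d)
             \<and> op_simple R (slot_ops R m) (S d) (L d) \<and> vectorspace.dim R (S d) = m)
      \<and> (\<forall>d<m. \<forall>e<m. d \<noteq> e \<longrightarrow>
             \<not> op_isomorphic R (slot_ops R m) (S d) (L d) (S e) (L e))
      \<and> (\<forall>(V :: ('k, 'v) module) lam.
           fd_anchored_slot_module R m V lam \<and> op_simple R (slot_ops R m) V lam \<longrightarrow>
           vectorspace.dim R V = m
         \<and> (\<exists>d<m. op_isomorphic R (slot_ops R m) V lam (S d) (L d)))"
      by (intro exI[of _ "\<lambda>_. T"] exI[of _ std])
         (auto simp: std_fd std_anchored std_simple std_dim std_not_isomorphic fd_anchored_slot_module_def simple_classification)
  qed
qed

end
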